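(* Let $P$ be a set of $n$ points in the plane in general position (no three collinear, no two with the same $x$-coordinate), and let $\mathfrak{C}^{\mathsf{st}}_P$ be the set of crossing-free spanning trees on $P$, each regarded as a set of segments. Then there exists a combination graph of size $\mathrm{O}(6^n n^3)$ that represents $\mathfrak{C}^{\mathsf{st}}_P$, and it can be constructed (given $P$) in $\mathrm{O}(6^n n^4)$ time. The constants in the $\mathrm{O}$-notation do not depend on $P$ or $n$.
   Context: $\mathcal{S}_P$ denotes the set of line segments whose two (distinct) endpoints are in $P$. Two different segments are non-crossing if they do not share internal points (i.e. their relative interiors are disjoint). A subset $C \subseteq \mathcal{S}_P$ is called a combination; it is crossing-free if every two different segments in $C$ are non-crossing. A crossing-free spanning tree on $P$ is a crossing-free $C\subseteq\mathcal{S}_P$ such that the graph with vertex set $P$ and edge set $C$ is cycle-free and connected. A combination graph is a directed acyclic multigraph $\Gamma$ with two distinguished vertices $\bot$ (source) and $\top$ (sink), such that all edges except those ending in $\top$ are labeled with a segment in $\mathcal{S}_P$ (edges ending in $\top$ are unlabeled), and $\top$ has no outgoing edges. The size of $\Gamma$ is its number of vertices plus its number of edges. A $\bot$-$\top$ path represents the combination consisting of the labels of the edges on the path. $\Gamma$ represents a set $\mathfrak{C}$ of combinations if mapping each $\bot$-$\top$ path to the combination it represents is a one-to-one correspondence between the $\bot$-$\top$ paths of $\Gamma$ and $\mathfrak{C}$. *)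

theory Defs
  imports "HOL-Analysis.Analysis" "Graph_Theory.Graph_Theory"
begin

section \<open>Crossing-free spanning trees\<close>

type_synonym point = "real \<times> real"

text \<open>A segment is the point set \<^term>\<open>closed_segment a b\<close>, which determines its two
  endpoints as an unordered pair.\<close>

type_synonym segment = "point set"

definition general_position :: "point set \<Rightarrow> bool" where
  "general_position P \<longleftrightarrow>
     (\<forall>a\<in>P. \<forall>b\<in>P. \<forall>c\<in>P. a \<noteq> b \<longrightarrow> b \<noteq> c \<longrightarrow> a \<noteq> c \<longrightarrow> \<not> collinear {a, b, c}) \<and>
     inj_on fst P"

definition segments :: "point set \<Rightarrow> segment set" where
  "segments P = {closed_segment a b | a b. a \<in> P \<and> b \<in> P \<and> a \<noteq> b}"

definition crossing_free :: "segment set \<Rightarrow> bool" where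
  "crossing_free C \<longleftrightarrow>
     (\<forall>s\<in>C. \<forall>t\<in>C. s \<noteq> t \<longrightarrow> rel_interior s \<inter> rel_interior t = {})"

text \<open>As usual in the AFP graph library, an undirected graph is a symmetric digraph: every segment
  contributes both of its orientations.\<close>

definition geometric_graph :: "point set \<Rightarrow> segment set \<Rightarrow> point pair_pre_digraph" where
  "geometric_graph P C =
     \<lparr> pverts = P, parcs = {(a, b). a \<in> P \<and> b \<in> P \<and> a \<noteq> b \<and> closed_segment a b \<in> C} \<rparr>"

text \<open>In a symmetric digraph, going along an edge and back is a directed cycle of length 2;
  the cycles of the undirected graph are the directed cycles of length at least 3.\<close>

definition cycle_free :: "('a, 'b) pre_digraph \<Rightarrow> bool" where
  "cycle_free G \<longleftrightarrow> (\<nexists>p. pre_digraph.cycle G p \<and> 3 \<le> length p)"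

definition crossing_free_spanning_trees :: "point set \<Rightarrow> segment set set" where
  "crossing_free_spanning_trees P =
     {C. C \<subseteq> segments P \<and> crossing_free C \<and>
         cycle_free (with_proj (geometric_graph P C)) \<and>
         Digraph_Component.connected (with_proj (geometric_graph P C))}"


section \<open>Combination graphs\<close>

record ('v, 'e) comb_graph =
  dgraph :: "('v, 'e) pre_digraph"
  source :: 'v
  sink :: 'v
  label :: "'e \<Rightarrow> segment option"

text \<open>Directed cycles here include loops and cycles of length 2.\<close>

definition combination_graph :: "point set \<Rightarrow> ('v, 'e) comb_graph \<Rightarrow> bool" where
  "combination_graph P \<Gamma> \<longleftrightarrow>
     fin_digraph (dgraph \<Gamma>) \<and>
     (\<nexists>p. pre_digraph.cycle (dgraph \<Gamma>) p) \<and>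
     source \<Gamma> \<in> verts (dgraph \<Gamma>) \<and> sink \<Gamma> \<in> verts (dgraph \<Gamma>) \<and> source \<Gamma> \<noteq> sink \<Gamma> \<and>
     out_arcs (dgraph \<Gamma>) (sink \<Gamma>) = {} \<and>
     (\<forall>e\<in>arcs (dgraph \<Gamma>).
        if head (dgraph \<Gamma>) e = sink \<Gamma> then label \<Gamma> e = None
        else (\<exists>s\<in>segments P. label \<Gamma> e = Some s))"

definition graph_size :: "('v, 'e) comb_graph \<Rightarrow> nat" where
  "graph_size \<Gamma> = card (verts (dgraph \<Gamma>)) + card (arcs (dgraph \<Gamma>))"

definition source_sink_paths :: "('v, 'e) comb_graph \<Rightarrow> 'e list set" where
  "source_sink_paths \<Gamma> = {p. pre_digraph.apath (dgraph \<Gamma>) (source \<Gamma>) p (sink \<Gamma>)}"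

definition path_combination :: "('v, 'e) comb_graph \<Rightarrow> 'e list \<Rightarrow> segment set" where
  "path_combination \<Gamma> p = {s. \<exists>e\<in>set p. label \<Gamma> e = Some s}"

definition represents :: "('v, 'e) comb_graph \<Rightarrow> segment set set \<Rightarrow> bool" where
  "represents \<Gamma> \<CC> \<longleftrightarrow> bij_betw (path_combination \<Gamma>) (source_sink_paths \<Gamma>) \<CC>"


section \<open>Model of computation\<close>

text \<open>Running times refer to the real RAM of computational geometry, presented as a structured
  language. A program is a finite piece of syntax. Its memory consists of finitely many named
  arrays of machine words (natural numbers) and of real numbers, zero except for the input;
  a variable is an array used at index 0. Reals support exact field arithmetic and comparison,
  but there is no conversion between reals and words (in particular no floor), and the only real
  constants are integers.

  Words are bounded: a store succeeds only if the address and the value of a word are below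
  the bound \<open>B\<close>, and execution is stuck otherwise. Intermediate values inside an
  expression exceed \<open>B\<close> at most polynomially, since a program contains only finitely many
  expressions. For the same reason the charge of one time unit for every assignment and every
  test, whatever the size of the expressions in it, counts the elementary operations up to a
  constant factor that depends only on the program.\<close>

datatype nexp =
    NConst nat
  | NCell string nexp
  | NAdd nexp nexp | NSub nexp nexp | NMul nexp nexp | NDiv nexp nexp | NMod nexp nexp

datatype rexp =
    RConst int
  | RCell string nexp
  | RAdd rexp rexp | RSub rexp rexp | RMul rexp rexp | RDiv rexp rexp

datatype bexp =
    NLess nexp nexp | NEq nexp nexp
  | RLess rexp rexp | REq rexp rexp
  | Neg bexp | Conj bexp bexp

datatype com =
    Skip
  | NStore string nexp nexp
  | RStore string nexp rexp
  | Seq com com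
  | Ite bexp com com
  | While bexp com

record state =
  nmem :: "string \<Rightarrow> nat \<Rightarrow> nat"
  rmem :: "string \<Rightarrow> nat \<Rightarrow> real"

primrec nval :: "nexp \<Rightarrow> state \<Rightarrow> nat" where
  "nval (NConst m) \<sigma> = m"
| "nval (NCell a i) \<sigma> = nmem \<sigma> a (nval i \<sigma>)"
| "nval (NAdd e f) \<sigma> = nval e \<sigma> + nval f \<sigma>"
| "nval (NSub e f) \<sigma> = nval e \<sigma> - nval f \<sigma>"
| "nval (NMul e f) \<sigma> = nval e \<sigma> * nval f \<sigma>"
| "nval (NDiv e f) \<sigma> = nval e \<sigma> div nval f \<sigma>"
| "nval (NMod e f) \<sigma> = nval e \<sigma> mod nval f \<sigma>"

primrec rval :: "rexp \<Rightarrow> state \<Rightarrow> real" where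
  "rval (RConst z) \<sigma> = of_int z"
| "rval (RCell a i) \<sigma> = rmem \<sigma> a (nval i \<sigma>)"
| "rval (RAdd e f) \<sigma> = rval e \<sigma> + rval f \<sigma>"
| "rval (RSub e f) \<sigma> = rval e \<sigma> - rval f \<sigma>"
| "rval (RMul e f) \<sigma> = rval e \<sigma> * rval f \<sigma>"
| "rval (RDiv e f) \<sigma> = rval e \<sigma> / rval f \<sigma>"

primrec bval :: "bexp \<Rightarrow> state \<Rightarrow> bool" where
  "bval (NLess e f) \<sigma> \<longleftrightarrow> nval e \<sigma> < nval f \<sigma>"
| "bval (NEq e f) \<sigma> \<longleftrightarrow> nval e \<sigma> = nval f \<sigma>"
| "bval (RLess e f) \<sigma> \<longleftrightarrow> rval e \<sigma> < rval f \<sigma>"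
| "bval (REq e f) \<sigma> \<longleftrightarrow> rval e \<sigma> = rval f \<sigma>"
| "bval (Neg b) \<sigma> \<longleftrightarrow> \<not> bval b \<sigma>"
| "bval (Conj b c) \<sigma> \<longleftrightarrow> bval b \<sigma> \<and> bval c \<sigma>"

definition nupdate :: "string \<Rightarrow> nat \<Rightarrow> nat \<Rightarrow> state \<Rightarrow> state" where
  "nupdate a i v \<sigma> = \<sigma>\<lparr>nmem := (nmem \<sigma>)(a := (nmem \<sigma> a)(i := v))\<rparr>"

definition rupdate :: "string \<Rightarrow> nat \<Rightarrow> real \<Rightarrow> state \<Rightarrow> state" where
  "rupdate a i v \<sigma> = \<sigma>\<lparr>rmem := (rmem \<sigma>)(a := (rmem \<sigma> a)(i := v))\<rparr>"

text \<open>\<open>exec B c \<sigma> t \<tau>\<close>: with words below \<open>B\<close>, the program \<open>c\<close> started in \<open>\<sigma>\<close>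
  terminates in \<open>\<tau>\<close> after \<open>t\<close> steps.\<close>

inductive exec :: "nat \<Rightarrow> com \<Rightarrow> state \<Rightarrow> nat \<Rightarrow> state \<Rightarrow> bool" for B :: nat where
  Skip: "exec B Skip \<sigma> 1 \<sigma>"
| NStore: "nval i \<sigma> < B \<Longrightarrow> nval e \<sigma> < B \<Longrightarrow>
    exec B (NStore a i e) \<sigma> 1 (nupdate a (nval i \<sigma>) (nval e \<sigma>) \<sigma>)"
| RStore: "nval i \<sigma> < B \<Longrightarrow>
    exec B (RStore a i r) \<sigma> 1 (rupdate a (nval i \<sigma>) (rval r \<sigma>) \<sigma>)"
| Seq: "exec B c \<sigma> t \<sigma>' \<Longrightarrow> exec B d \<sigma>' u \<tau> \<Longrightarrow> exec B (Seq c d) \<sigma> (t + u) \<tau>"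
| IteTrue: "bval b \<sigma> \<Longrightarrow> exec B c \<sigma> t \<tau> \<Longrightarrow> exec B (Ite b c d) \<sigma> (1 + t) \<tau>"
| IteFalse: "\<not> bval b \<sigma> \<Longrightarrow> exec B d \<sigma> t \<tau> \<Longrightarrow> exec B (Ite b c d) \<sigma> (1 + t) \<tau>"
| WhileFalse: "\<not> bval b \<sigma> \<Longrightarrow> exec B (While b c) \<sigma> 1 \<sigma>"
| WhileTrue: "bval b \<sigma> \<Longrightarrow> exec B c \<sigma> t \<sigma>' \<Longrightarrow> exec B (While b c) \<sigma>' u \<tau> \<Longrightarrow>
    exec B (While b c) \<sigma> (1 + t + u) \<tau>"

text \<open>The input lists the points \<open>p 0, \<dots>, p (n - 1)\<close> in an arbitrary order.\<close>

definition input_state :: "nat \<Rightarrow> (nat \<Rightarrow> point) \<Rightarrow> state" where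
  "input_state n p =
     \<lparr> nmem = (\<lambda>a i. if a = ''n'' \<and> i = 0 then n else 0),
       rmem = (\<lambda>a i. if i < n \<and> a = ''x'' then fst (p i)
                     else if i < n \<and> a = ''y'' then snd (p i) else 0) \<rparr>"

text \<open>The output is an explicit edge list; the two endpoints of the label of edge \<open>e\<close> are the
  points with indices \<open>left[e]\<close> and \<open>right[e]\<close>, which are ignored for edges into the sink.\<close>

definition output_graph :: "(nat \<Rightarrow> point) \<Rightarrow> state \<Rightarrow> (nat, nat) comb_graph" where
  "output_graph p \<sigma> =
     \<lparr> dgraph = \<lparr> verts = {..<nmem \<sigma> ''vertices'' 0}, arcs = {..<nmem \<sigma> ''edges'' 0},
                  tail = nmem \<sigma> ''tail'', head = nmem \<sigma> ''head'' \<rparr>,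
       source = nmem \<sigma> ''source'' 0,
       sink = nmem \<sigma> ''sink'' 0,
       label = (\<lambda>e. if nmem \<sigma> ''head'' e = nmem \<sigma> ''sink'' 0 then None
                    else Some (closed_segment (p (nmem \<sigma> ''left'' e)) (p (nmem \<sigma> ''right'' e)))) \<rparr>"

end

theory Submission
  imports Defs
begin

text \<open>
  Number the points by x-coordinate and order the segments of a crossing-free set from bottom to top.
  Whether a segment can be put on top of the segments built so far depends only on which points lie
  below one of them, which points are endpoints of one of them, and which are neither. The points
  that are not covered yet are split into blocks by the components of the forest built so far.
  Blocks never cross, so every point only has to remember whether its block continues to the left and
  to the right: the state is a word over six letters, and a block structure is recovered from its
  word by matching parentheses. A state without an uncovered point in some component is a dead end,
  and a tree is complete when one block is left.

  To make paths and trees correspond one-to-one, a mark remembers the left endpoint of the previous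
  segment, and the next segment may not lie entirely to the left of it. This selects a unique
  bottom-up order: the last segment must be the rightmost one among the maximal segments.
  There are at most \<open>6 ^ n * n\<close> pairs of words and marks with at most \<open>n ^ 2\<close> segments each, and the
  successor of a word under a segment is computed in \<open>O(n ^ 2)\<close> time independently of the mark.
\<close>

section \<open>Segments over points sorted by x-coordinate\<close>

text \<open>A new segment fits on top iff its endpoints are uncovered and every point above it is
  still without segments and uncovered: height differences are affine, so they can go wrong only at
  an end of the common x-range, and such an end is an endpoint of one of the two segments. Three
  kinds of points are therefore enough for the geometry. Components need more. A component whose
  points are all covered would vanish from the word; demanding an uncovered point in each makes
  blocks and components correspond, so that every segment lowers the number of blocks and one block
  means connectedness. No tree is lost by this, since point 0 is never covered and later segments
  never end at covered points.

  All \<open>6 ^ n\<close> words are processed, not only those that describe states, so no search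
  for reachable states is needed. In return, decoding, transition test and successor have to be
  total, and acyclicity has to hold at meaningless words too. The time is \<open>6 ^ n\<close> words
  times \<open>n ^ 2\<close> segments times a quadratic transition; writing the \<open>n\<close>
  arcs of one segment, one per mark, is of lower order.\<close>

lemma affine_nonneg_inside:
  fixes f :: "real \<Rightarrow> real"
  assumes f: "\<And>u. f u = A + u * B" and x: "l < x" "x < r" "f x \<ge> 0"
  shows "f l > 0 \<or> f r > 0 \<or> (f l = 0 \<and> f r = 0)"
proof -
  \<comment> \<open>The value inside is a mean of the end values with positive weights.\<close>
  have eq: "(r - l) * f x = (r - x) * f l + (x - l) * f r"
    unfolding f by (simp add: algebra_simps)
  have "(r - l) * f x \<ge> 0"
    using x by simp
  then have sum: "(r - x) * f l + (x - l) * f r \<ge> 0"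
    using eq by simp
  show ?thesis
  proof (rule ccontr)
    assume "\<not> ?thesis"
    then have "f l \<le> 0" "f r \<le> 0" "f l < 0 \<or> f r < 0"
      by linarith+
    moreover have "(r - x) * f l \<le> 0" "(x - l) * f r \<le> 0"
      using x calculation by (simp_all add: mult_nonneg_nonpos)
    moreover have "(r - x) * f l < 0 \<or> (x - l) * f r < 0"
      using x calculation by (auto intro: mult_pos_neg)
    ultimately show False
      using sum by linarith
  qed
qed

lemma affine_neg_inside:
  fixes f :: "real \<Rightarrow> real"
  assumes f: "\<And>u. f u = A + u * B" and neg: "\<And>x. l < x \<Longrightarrow> x < r \<Longrightarrow> f x < 0"
    and "l < r" "l \<le> u" "u \<le> r"
  shows "f u \<le> 0"
proof (rule ccontr)
  assume *: "\<not> f u \<le> 0"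
  \<comment> \<open>A positive value at \<open>u\<close> would persist near \<open>u\<close>, and
    every neighbourhood of \<open>u\<close> meets the open interval, even when \<open>u\<close> is
    one of its ends.\<close>
  have "continuous_on UNIV f"
    unfolding f by (intro continuous_intros)
  then have "open {x. f x > 0}"
    by (intro open_Collect_less continuous_intros) auto
  moreover have "u \<in> {x. f x > 0}"
    using * by simp
  ultimately obtain e where e: "e > 0" "\<And>x. dist x u < e \<Longrightarrow> f x > 0"
    unfolding open_dist by blast
  have "\<exists>x. l < x \<and> x < r \<and> dist x u < e"
  proof (cases "u < r")
    case True
    then obtain x where "u < x" "x < min r (u + e)"
      using dense[of u "min r (u + e)"] e by auto
    then show ?thesis
      using \<open>l \<le> u\<close> by (intro exI[of _ x]) (auto simp: dist_real_def)
  next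
    case False
    then obtain x where "max l (u - e) < x" "x < u"
      using dense[of "max l (u - e)" u] e assms by auto
    then show ?thesis
      using \<open>u \<le> r\<close> by (intro exI[of _ x]) (auto simp: dist_real_def)
  qed
  then show False
    using e(2) neg by (meson less_asym)
qed

type_synonym edge = "nat \<times> nat"

text \<open>The second assumption is a nonvanishing orientation determinant, kept free of division
  like the test that the program evaluates.\<close>

locale sorted_points =
  fixes n :: nat and X Y :: "nat \<Rightarrow> real"
  assumes X_less: "i < j \<Longrightarrow> j < n \<Longrightarrow> X i < X j"
    and not_collinear: "i < j \<Longrightarrow> j < k \<Longrightarrow> k < n \<Longrightarrow>
      (Y j - Y i) * (X k - X i) \<noteq> (X j - X i) * (Y k - Y i)"
begin

lemma X_less_iff: "i < n \<Longrightarrow> j < n \<Longrightarrow> X i < X j \<longleftrightarrow> i < j"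
  by (metis X_less linorder_neq_iff less_asym)

definition pairs :: "edge set" where
  "pairs = {(a, b). a < b \<and> b < n}"

lemma pairsD: "s \<in> pairs \<Longrightarrow> fst s < snd s" "s \<in> pairs \<Longrightarrow> snd s < n" "s \<in> pairs \<Longrightarrow> fst s < n"
  by (auto simp: pairs_def)

lemma pairs_iff: "(a, b) \<in> pairs \<longleftrightarrow> a < b \<and> b < n"
  by (auto simp: pairs_def)

lemma finite_pairs: "finite pairs"
  by (rule finite_subset[of _ "{..<n} \<times> {..<n}"]) (auto simp: pairs_def)

definition slope :: "edge \<Rightarrow> real" where
  "slope s = (Y (snd s) - Y (fst s)) / (X (snd s) - X (fst s))"

text \<open>Height of the supporting line rather than of the segment: it is defined at every
  abscissa, which makes differences of heights affine everywhere.\<close>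

definition ht :: "edge \<Rightarrow> real \<Rightarrow> real" where
  "ht s x = Y (fst s) + (x - X (fst s)) * slope s"

lemma ht_diff_affine:
  "ht t u - ht s u = (ht t 0 - ht s 0) + u * (slope t - slope s)"
  by (simp add: ht_def algebra_simps)

lemma ht_fst [simp]: "ht s (X (fst s)) = Y (fst s)"
  by (simp add: ht_def)

lemma ht_snd [simp]: "s \<in> pairs \<Longrightarrow> ht s (X (snd s)) = Y (snd s)"
  using X_less[of "fst s" "snd s"] pairsD[of s] by (simp add: ht_def slope_def)

lemma below_ht_iff:
  assumes "(a, b) \<in> pairs"
  shows "Y k < ht (a, b) (X k) \<longleftrightarrow> (Y k - Y a) * (X b - X a) < (X k - X a) * (Y b - Y a)"
proof -
  have "0 < X b - X a"
    using assms X_less by (auto simp: pairs_iff)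
  then have "Y k - Y a < (X k - X a) * (Y b - Y a) / (X b - X a) \<longleftrightarrow>
      (Y k - Y a) * (X b - X a) < (X k - X a) * (Y b - Y a)"
    by (simp add: pos_less_divide_eq)
  then show ?thesis
    by (simp add: ht_def slope_def) linarith
qed

text \<open>Clearing the denominator turns equality of heights into the determinant equation that
  general position forbids. Hence no point lies in the interior of a segment.\<close>

lemma ht_neq:
  assumes "s \<in> pairs" "fst s < k" "k < snd s"
  shows "ht s (X k) \<noteq> Y k"
proof
  have pos: "0 < X (snd s) - X (fst s)"
    using assms X_less pairsD by simp
  assume "ht s (X k) = Y k"
  then have "(X k - X (fst s)) * (Y (snd s) - Y (fst s)) / (X (snd s) - X (fst s)) = Y k - Y (fst s)"
    by (simp add: ht_def slope_def)
  then have "(X k - X (fst s)) * (Y (snd s) - Y (fst s)) = (Y k - Y (fst s)) * (X (snd s) - X (fst s))"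
    using pos by (simp add: divide_eq_eq)
  then show False
    using not_collinear[of "fst s" k "snd s"] assms pairsD by simp
qed

definition overlap :: "edge \<Rightarrow> edge \<Rightarrow> bool" where
  "overlap s t \<longleftrightarrow> max (fst s) (fst t) < min (snd s) (snd t)"

text \<open>In \<open>over t s\<close> it is \<open>t\<close> that lies underneath. The relation
  holds vacuously in both directions for segments beside each other, and it is not
  transitive.\<close>

definition over :: "edge \<Rightarrow> edge \<Rightarrow> bool" where
  "over t s \<longleftrightarrow> (\<forall>x. X (fst s) < x \<and> x < X (snd s) \<and> X (fst t) < x \<and> x < X (snd t)
     \<longrightarrow> ht t x < ht s x)"

definition nc :: "edge \<Rightarrow> edge \<Rightarrow> bool" where
  "nc s t \<longleftrightarrow> over s t \<or> over t s"

lemma overlap_sym: "overlap s t \<longleftrightarrow> overlap t s"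
  by (auto simp: overlap_def)

text \<open>Replaces the common x-range of two segments by a single interval between two of their
  endpoints, so that later arguments only ask which segment owns each end.\<close>

lemma X_ends:
  assumes "s \<in> pairs" "t \<in> pairs"
  obtains m M where "m \<in> {fst s, fst t}" "M \<in> {snd s, snd t}"
    "fst s \<le> m" "fst t \<le> m" "M \<le> snd s" "M \<le> snd t" "m < n" "M < n"
    "\<And>x. X (fst s) < x \<and> x < X (snd s) \<and> X (fst t) < x \<and> x < X (snd t) \<longleftrightarrow> X m < x \<and> x < X M"
    "overlap s t \<longleftrightarrow> m < M"
proof -
  let ?m = "max (fst s) (fst t)" and ?M = "min (snd s) (snd t)"
  have "X ?m < x \<longleftrightarrow> X (fst s) < x \<and> X (fst t) < x" for x
    using X_less_iff[of "fst s" "fst t"] X_less_iff[of "fst t" "fst s"] assms pairsD(3)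
    by (cases "fst s" "fst t" rule: linorder_cases) (auto simp: max_def)
  moreover have "x < X ?M \<longleftrightarrow> x < X (snd s) \<and> x < X (snd t)" for x
    using X_less_iff[of "snd s" "snd t"] X_less_iff[of "snd t" "snd s"] assms pairsD(2)
    by (cases "snd s" "snd t" rule: linorder_cases) (auto simp: min_def)
  moreover have "?m \<in> {fst s, fst t}" "?M \<in> {snd s, snd t}"
    by (simp_all add: max_def min_def)
  moreover have "?m < n" "?M < n"
    using assms pairsD by (simp_all add: min_def)
  ultimately show thesis
    by (intro that[of ?m ?M]) (auto simp: overlap_def)
qed

lemma not_overlap_over: "s \<in> pairs \<Longrightarrow> t \<in> pairs \<Longrightarrow> \<not> overlap s t \<Longrightarrow> over s t"
  unfolding over_def using X_less_iff pairsD
  by (smt (verit, del_insts) max_less_iff_conj min_less_iff_conj overlap_def)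

text \<open>Strict inequality inside the common range passes to its ends as a weak one by
  continuity; at the ends it may become equality, when the segments share an endpoint.\<close>

lemma over_weak:
  assumes st: "s \<in> pairs" "t \<in> pairs" and "over t s" "overlap t s"
    and u: "fst s \<le> u" "u \<le> snd s" "fst t \<le> u" "u \<le> snd t"
  shows "ht t (X u) \<le> ht s (X u)"
proof -
  obtain m M where m: "m \<in> {fst s, fst t}" "M \<in> {snd s, snd t}"
    "fst s \<le> m" "fst t \<le> m" "M \<le> snd s" "M \<le> snd t" "m < n" "M < n"
    and iff: "\<And>x. X (fst s) < x \<and> x < X (snd s) \<and> X (fst t) < x \<and> x < X (snd t) \<longleftrightarrow> X m < x \<and> x < X M"
    and ov: "overlap s t \<longleftrightarrow> m < M"
    by (rule X_ends[OF st], rule that; assumption)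
  have "m < M"
    using assms overlap_sym ov by blast
  then have "X m < X M"
    using m X_less by blast
  have "u < n"
    using st u pairsD(2) by (meson le_less_trans)
  have "m \<le> u" "u \<le> M"
    using m u by auto
  then have u':  "X m \<le> X u" "X u \<le> X M"
    using m X_less \<open>u < n\<close> by (metis le_less order_refl)+
  have "ht t x - ht s x < 0" if "X m < x" "x < X M" for x
    using \<open>over t s\<close> iff[of x] that unfolding over_def by simp
  from affine_neg_inside[of "\<lambda>x. ht t x - ht s x", OF ht_diff_affine this \<open>X m < X M\<close> u']
  show ?thesis
    by simp
qed

text \<open>Two opposite strict inequalities would clash at any common abscissa.\<close>

lemma over_not_overlap:
  assumes st: "s \<in> pairs" "t \<in> pairs" and "over t s" "over s t"
  shows "\<not> overlap s t"
proof
  assume "overlap s t"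
  obtain m M where m: "m \<in> {fst s, fst t}" "M \<in> {snd s, snd t}"
    "fst s \<le> m" "fst t \<le> m" "M \<le> snd s" "M \<le> snd t" "m < n" "M < n"
    and iff: "\<And>x. X (fst s) < x \<and> x < X (snd s) \<and> X (fst t) < x \<and> x < X (snd t) \<longleftrightarrow> X m < x \<and> x < X M"
    and ov: "overlap s t \<longleftrightarrow> m < M"
    by (rule X_ends[OF st], rule that; assumption)
  obtain x where "X m < x" "x < X M"
    using X_less dense ov m \<open>overlap s t\<close> by blast
  then show False
    using iff assms unfolding over_def by (meson less_asym)
qed

text \<open>By the intermediate value theorem, a height difference without zeros on the common
  interval has constant sign.\<close>

lemma nc_iff:
  assumes st: "s \<in> pairs" "t \<in> pairs"
  shows "nc s t \<longleftrightarrow> (\<forall>x. X (fst s) < x \<and> x < X (snd s) \<and> X (fst t) < x \<and> x < X (snd t)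
     \<longrightarrow> ht t x \<noteq> ht s x)"
proof
  assume R: "\<forall>x. X (fst s) < x \<and> x < X (snd s) \<and> X (fst t) < x \<and> x < X (snd t)
     \<longrightarrow> ht t x \<noteq> ht s x"
  let ?f = "\<lambda>x. ht t x - ht s x"
  have cont: "continuous_on S ?f" for S
    unfolding ht_def by (intro continuous_intros)
  show "nc s t"
  proof (rule ccontr)
    assume "\<not> nc s t"
    then obtain x z where x: "X (fst s) < x" "x < X (snd s)" "X (fst t) < x" "x < X (snd t)" "?f x \<ge> 0"
      and z: "X (fst s) < z" "z < X (snd s)" "X (fst t) < z" "z < X (snd t)" "?f z \<le> 0"
      unfolding nc_def over_def by (force simp: not_less)
    have "\<exists>v. min x z \<le> v \<and> v \<le> max x z \<and> ?f v = 0"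
    proof (cases "x \<le> z")
      case True
      then show ?thesis
        using IVT2'[of ?f z 0 x] x z cont by auto
    next
      case False
      then show ?thesis
        using IVT'[of ?f z 0 x] x z cont by auto
    qed
    then obtain v where "min x z \<le> v" "v \<le> max x z" "ht t v = ht s v"
      by auto
    then show False
      using R x z by (metis le_less_trans less_le_trans max_def min_def)
  qed
qed (force simp: nc_def over_def)

section \<open>Covered and touched points decide what can be put on top\<close>

definition cov :: "edge set \<Rightarrow> nat \<Rightarrow> bool" where
  "cov D k \<longleftrightarrow> (\<exists>t\<in>D. fst t < k \<and> k < snd t \<and> Y k < ht t (X k))"

definition tch :: "edge set \<Rightarrow> nat \<Rightarrow> bool" where
  "tch D k \<longleftrightarrow> (\<exists>t\<in>D. k = fst t \<or> k = snd t)"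

text \<open>If the left endpoints differed, the one at \<open>m\<close> would lie in the interior of
  the other segment, against \<open>ht_neq\<close>.\<close>

lemma ht_eqD:
  assumes "s \<in> pairs" "t \<in> pairs" and "m \<in> {fst s, fst t}" "fst s \<le> m" "fst t \<le> m" "m < snd s" "m < snd t"
    and "ht s (X m) = ht t (X m)"
  shows "fst s = fst t"
proof (rule ccontr)
  assume "fst s \<noteq> fst t"
  then consider "m = fst s" "fst t < fst s" | "m = fst t" "fst s < fst t"
    using assms by fastforce
  then show False
    using assms ht_neq[of s "fst t"] ht_neq[of t "fst s"] by cases auto
qed

lemma ht_eqD':
  assumes "s \<in> pairs" "t \<in> pairs" and "m \<in> {snd s, snd t}" "fst s < m" "fst t < m" "m \<le> snd s" "m \<le> snd t"
    and "ht s (X m) = ht t (X m)"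
  shows "snd s = snd t"
proof (rule ccontr)
  assume "snd s \<noteq> snd t"
  then consider "m = snd s" "snd s < snd t" | "m = snd t" "snd t < snd s"
    using assms by fastforce
  then show False
    using assms ht_neq[of s "snd t"] ht_neq[of t "snd s"] by cases auto
qed

text \<open>The hypotheses are exactly what the letters of a word record. If some \<open>t\<close>
  is not below \<open>s\<close>, then \<open>t\<close> is strictly higher at an end of the common
  range, or they agree at both ends. An end belonging to \<open>s\<close> is then covered by
  \<open>t\<close>; an end belonging to \<open>t\<close> is a touched point above \<open>s\<close>;
  agreement at both ends forces \<open>t = s\<close>.\<close>

lemma over_allI:
  assumes D: "D \<subseteq> pairs" and s: "s \<in> pairs" "s \<notin> D"
    and "\<not> cov D (fst s)" "\<not> cov D (snd s)"
    and above: "\<And>k. fst s < k \<Longrightarrow> k < snd s \<Longrightarrow> ht s (X k) < Y k \<Longrightarrow> \<not> tch D k"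
  shows "\<forall>t\<in>D. over t s"
proof (rule ballI, rule ccontr)
  fix t
  assume t: "t \<in> D" "\<not> over t s"
  then have tp: "t \<in> pairs"
    using D by blast
  obtain m M where m: "m \<in> {fst s, fst t}" "M \<in> {snd s, snd t}"
    "fst s \<le> m" "fst t \<le> m" "M \<le> snd s" "M \<le> snd t" "m < n" "M < n"
    and iff: "\<And>x. X (fst s) < x \<and> x < X (snd s) \<and> X (fst t) < x \<and> x < X (snd t) \<longleftrightarrow> X m < x \<and> x < X M"
    and ov: "overlap s t \<longleftrightarrow> m < M"
    by (rule X_ends[OF s(1) tp], rule that; assumption)
  from t(2) obtain x where "X m < x \<and> x < X M" "\<not> ht t x < ht s x"
    unfolding over_def iff by blast
  then have x: "X m < x" "x < X M" "ht t x - ht s x \<ge> 0"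
    by auto
  have "m < M"
    using X_less_iff[OF m(7,8)] less_trans[OF x(1,2)] by simp
  have "ht t (X m) - ht s (X m) > 0 \<or> ht t (X M) - ht s (X M) > 0 \<or>
      (ht t (X m) - ht s (X m) = 0 \<and> ht t (X M) - ht s (X M) = 0)"
    by (rule affine_nonneg_inside[of "\<lambda>x. ht t x - ht s x", OF _ x]) (rule ht_diff_affine)
  then consider "ht s (X m) < ht t (X m)" | "ht s (X M) < ht t (X M)" |
    "ht s (X m) = ht t (X m)" "ht s (X M) = ht t (X M)"
    by fastforce
  then show False
  proof cases
    case 1
    show False
    proof (cases "m = fst s")
      case True
      then have "fst t < fst s"
        using 1 m by (metis ht_fst le_neq_implies_less less_irrefl)
      then show False
        using 1 True \<open>m < M\<close> m t assms unfolding cov_def by (metis ht_fst less_le_trans)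
    next
      case False
      then show False
        using 1 above[of m] m \<open>m < M\<close> t(1) unfolding tch_def
        by (metis empty_iff ht_fst insert_iff le_neq_implies_less less_le_trans)
    qed
  next
    case 2
    show False
    proof (cases "M = snd s")
      case True
      then have "snd s < snd t"
        using 2 m s tp by (metis ht_snd le_neq_implies_less less_irrefl)
      then show False
        using 2 True \<open>m < M\<close> m t s assms unfolding cov_def by (metis ht_snd le_less_trans)
    next
      case False
      then show False
        using 2 above[of M] m \<open>m < M\<close> t(1) tp unfolding tch_def
        by (metis empty_iff ht_snd insert_iff le_neq_implies_less le_less_trans)
    qed
  next
    case 3
    have "fst s = fst t"
      using ht_eqD[OF s(1) tp] m \<open>m < M\<close> 3 by (meson less_le_trans)
    moreover have "snd s = snd t"
      using ht_eqD'[OF s(1) tp] m \<open>m < M\<close> 3 by (meson le_less_trans)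
    ultimately show False
      using t(1) s(2) by (metis prod.collapse)
  qed
qed

text \<open>Converse of \<open>over_allI\<close>, by \<open>over_weak\<close> at the endpoints.
  Points above \<open>s\<close> are moreover uncovered, because a segment covering them would lie
  above \<open>s\<close> there; so their letter is 0.\<close>

lemma over_allD:
  assumes D: "D \<subseteq> pairs" and s: "s \<in> pairs" and ov: "\<forall>t\<in>D. over t s"
  shows "s \<notin> D" "\<not> cov D (fst s)" "\<not> cov D (snd s)"
    "\<And>k. fst s < k \<Longrightarrow> k < snd s \<Longrightarrow> ht s (X k) < Y k \<Longrightarrow> \<not> tch D k \<and> \<not> cov D k"
proof -
  have weak: "ht t (X u) \<le> ht s (X u)"
    if "t \<in> D" "overlap t s" "fst s \<le> u" "u \<le> snd s" "fst t \<le> u" "u \<le> snd t" for t u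
    using over_weak[OF s] that D ov by blast
  show "s \<notin> D"
    using over_not_overlap[OF s s] ov pairsD(1)[OF s] by (auto simp: overlap_def)
  show "\<not> cov D (fst s)"
    unfolding cov_def using weak[of _ "fst s"] pairsD[OF s]
    by (fastforce simp: overlap_def)
  show "\<not> cov D (snd s)"
    unfolding cov_def using weak[of _ "snd s"] pairsD[OF s] s
    by (fastforce simp: overlap_def)
  fix k
  assume k: "fst s < k" "k < snd s" "ht s (X k) < Y k"
  have "t \<in> D \<Longrightarrow> k \<noteq> fst t" for t
    using weak[of t k] k D pairsD(1)[of t] by (fastforce simp: overlap_def)
  moreover have "t \<in> D \<Longrightarrow> k \<noteq> snd t" for t
    using weak[of t k] k D pairsD(1)[of t] ht_snd[of t] by (fastforce simp: overlap_def)
  moreover have "\<not> cov D k"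
  proof
    assume "cov D k"
    then obtain t where t: "t \<in> D" "fst t < k" "k < snd t" "Y k < ht t (X k)"
      unfolding cov_def by blast
    then have "overlap t s"
      using k by (simp add: overlap_def)
    then show False
      using weak[of t k] t k by simp
  qed
  ultimately show "\<not> tch D k \<and> \<not> cov D k"
    unfolding tch_def by blast
qed

text \<open>Among the segments whose left endpoint is not covered, the steepest one at the rightmost left
  endpoint has nothing above it.\<close>

lemma exists_maximal:
  assumes D: "D \<subseteq> pairs" "D \<noteq> {}" and ncD: "\<And>s t. s \<in> D \<Longrightarrow> t \<in> D \<Longrightarrow> s \<noteq> t \<Longrightarrow> nc s t"
  shows "\<exists>z\<in>D. \<forall>t\<in>D. t \<noteq> z \<longrightarrow> over t z"
proof -
  have fin: "finite D"
    using D(1) finite_pairs by (rule finite_subset)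
  define A where "A = fst ` {s \<in> D. \<not> cov D (fst s)}"
  have "finite A"
    unfolding A_def using fin by simp
  \<comment> \<open>Covering a point takes a segment that starts strictly to its left, so the
    leftmost left endpoint is uncovered.\<close>
  have "Min (fst ` D) \<in> A"
  proof -
    have "Min (fst ` D) \<in> fst ` D"
      using fin D by simp
    moreover have "\<not> cov D (Min (fst ` D))"
      unfolding cov_def using fin by (metis Min_le finite_imageI image_eqI not_less)
    ultimately show ?thesis
      unfolding A_def by auto
  qed
  define a where "a = Max A"
  have a: "a \<in> A" "\<And>k. k \<in> A \<Longrightarrow> k \<le> a"
    unfolding a_def using \<open>finite A\<close> \<open>Min (fst ` D) \<in> A\<close> by (auto intro: Max_in)
  define S where "S = {s \<in> D. fst s = a}"
  have S: "finite S" "S \<noteq> {}" "\<not> cov D a"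
    using fin a(1) unfolding S_def A_def by auto
  define z where "z = arg_max_on slope S"
  have z: "z \<in> S" "\<And>t. t \<in> S \<Longrightarrow> slope t \<le> slope z"
  proof -
    have "Max (slope ` S) \<in> slope ` S"
      using S by simp
    then obtain u where "u \<in> S" "slope u = Max (slope ` S)"
      by auto
    then have "is_arg_max slope (\<lambda>x. x \<in> S) u"
      using S by (simp add: is_arg_max_linorder)
    then have "is_arg_max slope (\<lambda>x. x \<in> S) z"
      unfolding z_def arg_max_on_def arg_max_def by (rule someI)
    then show "z \<in> S" "\<And>t. t \<in> S \<Longrightarrow> slope t \<le> slope z"
      by (auto simp: is_arg_max_linorder)
  qed
  then have zD: "z \<in> D" "fst z = a" "z \<in> pairs"
    using D by (auto simp: S_def)
  \<comment> \<open>The segments that lie above \<open>z\<close>; the aim is to show that there are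
    none.\<close>
  define B where "B = {t \<in> D. t \<noteq> z \<and> overlap z t \<and> over z t}"
  have B_iff: "t \<in> B" if t: "t \<in> D" "t \<noteq> z" "fst z \<le> u" "u < snd z" "fst t < u" "u < snd t"
    "ht z (X u) < ht t (X u)" for t u
  proof -
    have ov: "overlap t z" "overlap z t"
      using t by (simp_all add: overlap_def)
    have "t \<in> pairs"
      using t D(1) by blast
    have "ht t (X u) \<le> ht z (X u)" if "over t z"
      by (rule over_weak[OF zD(3) \<open>t \<in> pairs\<close> that ov(1)]) (use t in simp_all)
    then have "\<not> over t z"
      using t(7) by linarith
    then have "over z t"
      using t(1,2) ncD[of t z] zD(1) by (simp add: nc_def)
    then show ?thesis
      using t(1,2) ov by (simp add: B_def)
  qed
  \<comment> \<open>A segment above \<open>z\<close> that starts left of \<open>a\<close> would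
    cover \<open>a\<close>, and one that starts at \<open>a\<close> would be steeper than
    \<open>z\<close>.\<close>
  have right: "a < fst t" if "t \<in> B" for t
  proof (rule ccontr)
    have t: "t \<in> D" "t \<in> pairs" "overlap z t" "over z t" "t \<noteq> z"
      using that D(1) unfolding B_def by blast+
    assume "\<not> a < fst t"
    then have "fst t < a \<or> fst t = a"
      by linarith
    then show False
    proof
      assume "fst t < a"
      moreover have "a < snd t"
        using t zD by (auto simp: overlap_def)
      moreover have "ht z (X a) \<le> ht t (X a)"
        using over_weak[OF t(2) zD(3) t(4,3), of a] calculation zD pairsD(1)[OF zD(3)] by simp
      ultimately have "cov D a"
        unfolding cov_def using t ht_neq[of t a] zD ht_fst[of z]
        by (intro bexI[of _ t]) auto
      then show False
        using S by simp
    next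
      assume eq: "fst t = a"
      then have "slope t \<le> slope z"
        using z t by (simp add: S_def)
      obtain x where x: "X a < x" "x < X (snd z)" "x < X (snd t)"
        using dense[of "X a" "min (X (snd z)) (X (snd t))"] X_less pairsD t(2) zD eq
        by (metis min_less_iff_conj)
      then have "ht z x < ht t x"
        using t(4) eq zD(2) unfolding over_def by simp
      moreover have "(x - X a) * slope t \<le> (x - X a) * slope z"
        using \<open>slope t \<le> slope z\<close> x by (simp add: mult_left_mono)
      ultimately show False
        using eq zD by (simp add: ht_def)
    qed
  qed
  \<comment> \<open>Descent on left endpoints: the leftmost member of \<open>B\<close> starts right
    of \<open>a\<close>, so by the choice of \<open>a\<close> its left endpoint is covered by some
    \<open>t'\<close>. There \<open>t'\<close> is above \<open>z\<close> too, hence belongs to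
    \<open>B\<close> and starts further left.\<close>
  have "B = {}"
  proof (rule ccontr)
    assume "B \<noteq> {}"
    have "finite B"
      using fin by (simp add: B_def)
    then have "Min (fst ` B) \<in> fst ` B"
      using \<open>B \<noteq> {}\<close> by simp
    then obtain t where t: "t \<in> B" "fst t = Min (fst ` B)"
      by auto
    have least: "fst t \<le> fst t'" if "t' \<in> B" for t'
      using t(2) that \<open>finite B\<close> by simp
    have tD: "t \<in> D" "t \<in> pairs" "overlap z t" "over z t"
      using t D by (auto simp: B_def)
    have "fst t < snd z"
      using tD(3) by (auto simp: overlap_def)
    have "ht z (X (fst t)) \<le> ht t (X (fst t))"
      by (rule over_weak[OF tD(2) zD(3) tD(4,3)])
        (use right[OF t(1)] zD(2) \<open>fst t < snd z\<close> pairsD(1)[OF tD(2)] in simp_all)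
    then have "ht z (X (fst t)) \<le> Y (fst t)"
      by simp
    have "fst t \<notin> A"
      using a(2) right[OF t(1)] by force
    then obtain t' where t': "t' \<in> D" "fst t' < fst t" "fst t < snd t'" "Y (fst t) < ht t' (X (fst t))"
      using tD(1) unfolding A_def cov_def by blast
    have "t' \<noteq> z"
      using t' \<open>ht z (X (fst t)) \<le> Y (fst t)\<close> by auto
    then have "t' \<in> B"
      by (intro B_iff[of t' "fst t"])
        (use t' zD(2) right[OF t(1)] \<open>fst t < snd z\<close> \<open>ht z (X (fst t)) \<le> Y (fst t)\<close> in simp_all)
    then show False
      using least[of t'] t'(2) by simp
  qed
  then have "over t z" if "t \<in> D" "t \<noteq> z" for t
    using that ncD[of t z] zD(1,3) D(1) not_overlap_over[of t z] overlap_sym[of t z]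
    unfolding B_def nc_def by blast
  then show ?thesis
    using zD by blast
qed

text \<open>Two segments can be exchanged in such an order only if they lie beside each other. Hence the
  condition on neighbours selects exactly one of all the orders in which no segment is below an
  earlier one, and it only refers to the left endpoint of the previous segment.\<close>

definition canonical :: "edge list \<Rightarrow> bool" where
  "canonical ss \<longleftrightarrow> sorted_wrt over ss \<and> successively (\<lambda>s t. fst s < snd t) ss"

text \<open>Everything listed after a maximal segment \<open>y\<close> is above \<open>y\<close> by
  the order and below it by maximality, hence beside it. The condition on neighbours then never lets
  the list pass from the right of \<open>y\<close> to its left.\<close>

lemma canonical_last_rightmost:
  assumes can: "canonical (ss @ [z])" and sub: "set (ss @ [z]) \<subseteq> pairs"
    and y: "y \<in> set ss" and max: "\<And>t. t \<in> set (ss @ [z]) \<Longrightarrow> t \<noteq> y \<Longrightarrow> over t y"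
  shows "snd y \<le> fst z"
proof -
  obtain us vs where ss: "ss = us @ y # vs"
    using y by (auto simp: in_set_conv_decomp)
  have srt: "sorted_wrt over (y # vs @ [z])" and suc: "successively (\<lambda>s t. fst s < snd t) (y # vs @ [z])"
    using can unfolding canonical_def ss by (auto simp: sorted_wrt_append successively_append_iff)
  have ypair: "y \<in> pairs"
    using sub ss by auto
  have beside: "snd v \<le> fst y \<or> snd y \<le> fst v" if "v \<in> set (vs @ [z])" for v
  proof -
    have v: "v \<in> pairs" "over y v" "v \<in> set (ss @ [z])"
      using that srt sub ss by auto
    have "v \<noteq> y"
      using v over_not_overlap[OF ypair ypair] pairsD(1)[OF ypair] by (auto simp: overlap_def)
    then have "\<not> overlap v y"
      using over_not_overlap[OF v(1) ypair] max v by blast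
    then show ?thesis
      using pairsD(1)[OF ypair] pairsD(1)[OF v(1)] unfolding overlap_def
      by (auto simp: max_def min_def split: if_splits)
  qed
  \<comment> \<open>If the previous left endpoint is not left of \<open>y\<close>, the next segment
    ends right of the left endpoint of \<open>y\<close>; being beside \<open>y\<close>, it lies
    entirely to the right.\<close>
  have "\<forall>v\<in>set ws. snd y \<le> fst v"
    if "successively (\<lambda>s t. fst s < snd t) (u # ws)" "fst y \<le> fst u"
      "\<forall>v\<in>set ws. snd v \<le> fst y \<or> snd y \<le> fst v" for u ws
    using that
  proof (induction ws arbitrary: u)
    case (Cons v ws)
    then have "snd y \<le> fst v"
      by auto
    moreover have "fst y \<le> fst v"
      using calculation pairsD(1)[OF ypair] by linarith
    ultimately show ?case
      using Cons.IH[of v] Cons.prems by simp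
  qed simp
  from this[OF suc] beside show ?thesis
    by auto
qed

lemma over_irrefl: "s \<in> pairs \<Longrightarrow> \<not> over s s"
  using over_not_overlap[of s s] pairsD(1)[of s] by (auto simp: overlap_def)

text \<open>Both last segments are maximal. If they differed, each would lie entirely to the right
  of the other; so they agree and can be removed.\<close>

lemma canonical_unique:
  assumes "canonical ss" "canonical ts" "set ss = set ts" "set ss \<subseteq> pairs"
  shows "ss = ts"
  using assms
proof (induction ss arbitrary: ts rule: rev_induct)
  case (snoc z ss)
  then obtain ts' z' where ts: "ts = ts' @ [z']"
    by (metis append_is_Nil_conv empty_set list.distinct(1) rev_exhaust set_empty)
  have "z \<in> pairs" "z' \<in> pairs"
    using snoc.prems(3,4) unfolding ts by auto
  then have "\<not> over z z" "\<not> over z' z'"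
    using over_irrefl by blast+
  then have notin: "z \<notin> set ss" "z' \<notin> set ts'"
    using snoc.prems(1,2) unfolding ts canonical_def sorted_wrt_append by auto
  have "z = z'"
  proof (rule ccontr)
    assume "z \<noteq> z'"
    have z: "z' \<in> set ss" "z \<in> set ts'"
      using snoc.prems(3) \<open>z \<noteq> z'\<close> unfolding ts by auto
    have maxz: "over t z" if "t \<in> set ts" "t \<noteq> z" for t
      using snoc.prems(1,3) that unfolding canonical_def by (auto simp: sorted_wrt_append)
    have maxz': "over t z'" if "t \<in> set (ss @ [z])" "t \<noteq> z'" for t
      using snoc.prems(2,3) that unfolding canonical_def ts by (auto simp: sorted_wrt_append)
    have "snd z' \<le> fst z"
      using canonical_last_rightmost[OF snoc.prems(1,4) z(1)] maxz' by blast
    moreover have "snd z \<le> fst z'"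
      using canonical_last_rightmost[of ts' z' z] snoc.prems z(2) maxz unfolding ts by blast
    ultimately show False
      using snoc.prems(4) z(1) pairsD(1)[of z] pairsD(1)[of z'] by auto
  qed
  moreover have "ss = ts'"
  proof (rule snoc.IH)
    show "canonical ss" "canonical ts'"
      using snoc.prems unfolding ts canonical_def by (auto simp: sorted_wrt_append successively_append_iff)
    show "set ss = set ts'"
      using snoc.prems(3) notin \<open>z = z'\<close> unfolding ts by auto
  qed (use snoc.prems in auto)
  ultimately show ?case
    by (simp add: ts)
qed simp

text \<open>Remove the maximal segment with the rightmost left endpoint, order the rest by
  induction, and append it again.\<close>

lemma canonical_exists:
  assumes "D \<subseteq> pairs" "\<And>s t. s \<in> D \<Longrightarrow> t \<in> D \<Longrightarrow> s \<noteq> t \<Longrightarrow> nc s t"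
  shows "\<exists>ss. canonical ss \<and> set ss = D"
proof -
  have "finite D"
    using assms(1) finite_pairs by (rule finite_subset)
  then show ?thesis
    using assms
  proof (induction "card D" arbitrary: D)
    case 0
    then show ?case
      by (auto simp: canonical_def)
  next
    case (Suc m)
    define M where "M = {z \<in> D. \<forall>t\<in>D. t \<noteq> z \<longrightarrow> over t z}"
    have "D \<noteq> {}"
      using Suc.hyps(2) by auto
    have "\<exists>z\<in>D. \<forall>t\<in>D. t \<noteq> z \<longrightarrow> over t z"
      by (rule exists_maximal[OF Suc.prems(2) \<open>D \<noteq> {}\<close> Suc.prems(3)])
    then have "M \<noteq> {}"
      unfolding M_def by blast
    moreover have "finite M"
      using Suc.prems(1) by (simp add: M_def)
    ultimately have "Max (fst ` M) \<in> fst ` M"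
      by simp
    then obtain z where z: "z \<in> M" "fst z = Max (fst ` M)"
      by auto
    have right: "fst t \<le> fst z" if "t \<in> M" for t
      using z(2) that \<open>finite M\<close> by simp
    have zD: "z \<in> D" "\<forall>t\<in>D. t \<noteq> z \<longrightarrow> over t z" "z \<in> pairs"
      using z(1) Suc.prems(2) unfolding M_def by blast+
    have "\<exists>ss. canonical ss \<and> set ss = D - {z}"
    proof (rule Suc.hyps(1))
      show "m = card (D - {z})"
        using Suc.hyps(2) Suc.prems(1) zD(1) by simp
      show "finite (D - {z})" "D - {z} \<subseteq> pairs"
        using Suc.prems(1,2) by auto
      show "nc s t" if "s \<in> D - {z}" "t \<in> D - {z}" "s \<noteq> t" for s t
        by (rule Suc.prems(3)) (use that in auto)
    qed
    then obtain ss where ss: "canonical ss" "set ss = D - {z}"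
      by blast
    \<comment> \<open>Otherwise the last segment of the rest lies entirely right of
      \<open>z\<close>. It is then maximal in all of \<open>D\<close> and starts further right,
      against the choice of \<open>z\<close>.\<close>
    have "fst (last ss) < snd z" if "ss \<noteq> []"
    proof (rule ccontr)
      assume neg: "\<not> ?thesis"
      let ?y = "last ss"
      have ss': "ss = butlast ss @ [?y]"
        using that by simp
      have yD: "?y \<in> D" "?y \<in> pairs" "?y \<noteq> z"
        using ss(2) last_in_set[OF that] Suc.prems(2) by blast+
      have "over t ?y" if "t \<in> D" "t \<noteq> ?y" for t
      proof (cases "t = z")
        case True
        have "\<not> overlap z ?y"
          using neg by (auto simp: overlap_def)
        then show ?thesis
          using True not_overlap_over zD yD by blast
      next
        case False
        then have "t \<in> set (butlast ss)"
          using that False ss(2) arg_cong[OF ss', of set] by auto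
        then show ?thesis
          using ss(1) arg_cong[OF ss', of "sorted_wrt over"] unfolding canonical_def sorted_wrt_append
          by simp
      qed
      then have "?y \<in> M"
        using yD by (simp add: M_def)
      then show False
        using right[of ?y] neg pairsD(1)[OF zD(3)] by linarith
    qed
    then have "canonical (ss @ [z])"
      using ss zD(2) unfolding canonical_def
      by (auto simp: sorted_wrt_append successively_append_iff)
    moreover have "set (ss @ [z]) = D"
      using ss zD by auto
    ultimately show ?case
      by blast
  qed
qed

end

section \<open>Connectivity and words\<close>

lemma digit_of_sum:
  fixes f :: "nat \<Rightarrow> nat"
  assumes "\<And>k. k < n \<Longrightarrow> f k < B" "i < n"
  shows "(\<Sum>k<n. f k * B ^ k) div B ^ i mod B = f i"
  using assms
proof (induction n arbitrary: f i)
  case (Suc n)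
  have "B > 0"
    using Suc.prems(1)[of 0] by simp
  \<comment> \<open>The lowest digit is split off, because division by powers removes digits from
    that end.\<close>
  have split: "(\<Sum>k<Suc n. f k * B ^ k) = f 0 + B * (\<Sum>k<n. f (Suc k) * B ^ k)"
    by (simp add: sum.lessThan_Suc_shift sum_distrib_left mult_ac del: sum.lessThan_Suc)
  show ?case
  proof (cases i)
    case 0
    then show ?thesis
      using Suc.prems(1)[of 0] unfolding split by simp
  next
    case (Suc j)
    have "(f 0 + B * (\<Sum>k<n. f (Suc k) * B ^ k)) div B ^ i = (\<Sum>k<n. f (Suc k) * B ^ k) div B ^ j"
      using Suc.prems(1)[of 0] \<open>B > 0\<close> by (simp add: Suc div_mult2_eq)
    then show ?thesis
      unfolding split using Suc.IH[of "\<lambda>k. f (Suc k)" j] Suc.prems Suc by simp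
  qed
qed simp

lemma digit_sum_less:
  fixes f :: "nat \<Rightarrow> nat"
  assumes "\<And>k. k < n \<Longrightarrow> f k < B"
  shows "(\<Sum>k<n. f k * B ^ k) < B ^ n"
  using assms
proof (induction n)
  case (Suc n)
  then have "(\<Sum>k<n. f k * B ^ k) < B ^ n"
    by simp
  moreover have "f n * B ^ n \<le> (B - 1) * B ^ n"
    using Suc.prems[of n] by (intro mult_right_mono) auto
  moreover have "B ^ n + (B - 1) * B ^ n = B ^ Suc n"
    using Suc.prems[of n] by (cases B) auto
  ultimately show ?case
    unfolding sum.lessThan_Suc by linarith
qed simp

section \<open>Components of the segments built so far\<close>

definition conn :: "edge set \<Rightarrow> nat \<Rightarrow> nat \<Rightarrow> bool" where
  "conn D x y \<longleftrightarrow> (x, y) \<in> (D \<union> D\<inverse>)\<^sup>*"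

lemma conn_refl [simp]: "conn D x x"
  by (simp add: conn_def)

lemma conn_sym: "conn D x y \<Longrightarrow> conn D y x"
  unfolding conn_def by (metis converse_Un converse_converse rtrancl_converseI sup_commute)

lemma conn_commute: "conn D x y \<longleftrightarrow> conn D y x"
  using conn_sym by blast

lemma conn_trans: "conn D x y \<Longrightarrow> conn D y z \<Longrightarrow> conn D x z"
  unfolding conn_def by (rule rtrancl_trans)

lemma conn_edge: "(x, y) \<in> D \<Longrightarrow> conn D x y"
  unfolding conn_def by blast

lemma conn_mono: "D \<subseteq> E \<Longrightarrow> conn D x y \<Longrightarrow> conn E x y"
  unfolding conn_def using rtrancl_mono[of "D \<union> D\<inverse>" "E \<union> E\<inverse>"] by blast

text \<open>A walk that passes the new edge several times can be shortened, so one passage in one of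
  the two directions is enough.\<close>

lemma conn_insert:
  "conn (insert (a, b) D) x y \<longleftrightarrow>
     conn D x y \<or> conn D x a \<and> conn D b y \<or> conn D x b \<and> conn D a y"
proof
  assume "conn (insert (a, b) D) x y"
  then have "(x, y) \<in> (insert (a, b) D \<union> (insert (a, b) D)\<inverse>)\<^sup>*"
    by (simp add: conn_def)
  then show "conn D x y \<or> conn D x a \<and> conn D b y \<or> conn D x b \<and> conn D a y"
  proof (induction rule: rtrancl_induct)
    case (step y z)
    then consider "conn D y z" | "y = a" "z = b" | "y = b" "z = a"
      by (auto simp: conn_edge conn_sym[OF conn_edge])
    then show ?case
      using step.IH by cases (meson conn_trans conn_refl)+
  qed simp
next
  have "conn (insert (a, b) D) a b"
    by (rule conn_edge) simp
  moreover have "conn D u v \<Longrightarrow> conn (insert (a, b) D) u v" for u v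
    by (rule conn_mono) auto
  ultimately show "conn D x y \<or> conn D x a \<and> conn D b y \<or> conn D x b \<and> conn D a y \<Longrightarrow>
      conn (insert (a, b) D) x y"
    by (meson conn_sym conn_trans)
qed

lemma conn_closed:
  assumes "conn D x y" "x \<in> A" "\<And>u v. (u, v) \<in> D \<Longrightarrow> u \<in> A \<and> v \<in> A"
  shows "y \<in> A"
  using assms(1,2) unfolding conn_def
  by (induction rule: rtrancl_induct) (use assms(3) in blast)+

text \<open>A letter describes one point of a state: 5 is a point below some segment, 0 a point without
  segments, and 1, 2, 3, 4 stand for a point with segments whose component has further uncovered
  points on neither side, on the right, on the left, and on both sides, respectively.\<close>

definition linL :: "nat \<Rightarrow> bool" where
  "linL x \<longleftrightarrow> 2 < x \<and> x < 5"

text \<open>Letter 0 is even but stands for an untouched point and has to be excluded; among the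
  letters this leaves 2 and 4.\<close>

definition linR :: "nat \<Rightarrow> bool" where
  "linR x \<longleftrightarrow> 0 < x \<and> x mod 2 = 0"

text \<open>Parenthesis matching from left to right. The second component is the stack of positions
  still waiting for a partner; its top is always its maximum, so a set suffices. The first names
  each block by its first point. On an unmatched closing letter the point just starts a new block,
  which keeps the function total.\<close>

fun decode :: "(nat \<Rightarrow> nat) \<Rightarrow> nat \<Rightarrow> (nat \<Rightarrow> nat) \<times> nat set" where
  "decode d 0 = (id, {})"
| "decode d (Suc i) =
     (let (blk, op) = decode d i;
          hit = linL (d i) \<and> op \<noteq> {};
          op' = (if hit then op - {Max op} else op)
      in (blk(i := if hit then blk (Max op) else i), if linR (d i) then insert i op' else op'))"

text \<open>For a forest this is the number of segments. Requiring it to grow makes the graph acyclic also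
  at words that do not describe any state.\<close>

definition pot :: "nat \<Rightarrow> (nat \<Rightarrow> nat) \<Rightarrow> nat" where
  "pot n d = card {k. k < n \<and> 2 < d k}"

text \<open>The complementary points are uncovered and have no left partner: they are the leftmost
  points of blocks, so the second summand counts blocks.\<close>

lemma pot_compl: "pot n d + card {k. k < n \<and> d k \<le> 2} = n"
proof -
  have "{k. k < n \<and> 2 < d k} \<union> {k. k < n \<and> d k \<le> 2} = {..<n}"
    by auto
  moreover have "{k. k < n \<and> 2 < d k} \<inter> {k. k < n \<and> d k \<le> 2} = {}"
    by auto
  ultimately show ?thesis
    unfolding pot_def by (metis (no_types, lifting) card_Un_disjoint card_lessThan finite_Un finite_lessThan)
qed

section \<open>States as words\<close>

context sorted_points
begin

lemma conn_less: "D \<subseteq> pairs \<Longrightarrow> conn D x y \<Longrightarrow> x < n \<Longrightarrow> y < n"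
  using conn_closed[of D x y "{..<n}"] by (fastforce simp: pairs_iff)

lemma conn_untouched: "conn D x y \<Longrightarrow> \<not> tch D x \<Longrightarrow> y = x"
  using conn_sym[of D x y] unfolding conn_def tch_def
  by (metis (no_types, lifting) Un_iff conn_def conn_sym converseD converse_rtranclE fst_conv snd_conv)

lemma cov_insert: "cov (insert s D) k \<longleftrightarrow> cov D k \<or> fst s < k \<and> k < snd s \<and> Y k < ht s (X k)"
  unfolding cov_def by blast

lemma tch_insert: "tch (insert s D) k \<longleftrightarrow> tch D k \<or> k = fst s \<or> k = snd s"
  unfolding tch_def by blast

definition hl :: "edge set \<Rightarrow> nat \<Rightarrow> bool" where
  "hl D k \<longleftrightarrow> (\<exists>j<k. \<not> cov D j \<and> conn D j k)"

definition hr :: "edge set \<Rightarrow> nat \<Rightarrow> bool" where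
  "hr D k \<longleftrightarrow> (\<exists>j. k < j \<and> j < n \<and> \<not> cov D j \<and> conn D j k)"

definition letter :: "edge set \<Rightarrow> nat \<Rightarrow> nat" where
  "letter D k = (if cov D k then 5 else if \<not> tch D k then 0
     else 1 + of_bool (hr D k) + 2 * of_bool (hl D k))"

lemma letter_less: "letter D k < 6"
  by (simp add: letter_def)

definition code :: "edge set \<Rightarrow> nat" where
  "code D = (\<Sum>k<n. letter D k * 6 ^ k)"

lemma digit_code: "k < n \<Longrightarrow> code D div 6 ^ k mod 6 = letter D k"
  unfolding code_def by (rule digit_of_sum) (simp_all add: letter_less)

text \<open>An untouched point is alone in its component, so letter 0 hides no link, and links can
  be read off the letters.\<close>

lemma hl_tch: "hl D k \<Longrightarrow> tch D k"
  unfolding hl_def using conn_untouched[of D k] conn_sym[of D _ k] by (metis less_irrefl)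

lemma hr_tch: "hr D k \<Longrightarrow> tch D k"
  unfolding hr_def using conn_untouched[of D k] conn_sym[of D _ k] by (metis less_irrefl)

lemma letter_covered: "letter D k = 5 \<longleftrightarrow> cov D k"
  by (simp add: letter_def)

lemma letter_untouched: "letter D k = 0 \<longleftrightarrow> \<not> cov D k \<and> \<not> tch D k"
  by (simp add: letter_def)

lemma letter_linL: "linL (letter D k) \<longleftrightarrow> \<not> cov D k \<and> hl D k"
  using hl_tch[of D k] by (auto simp: letter_def linL_def)

lemma letter_linR: "linR (letter D k) \<longleftrightarrow> \<not> cov D k \<and> hr D k"
  using hr_tch[of D k] by (auto simp: letter_def linR_def)

lemma letter_le_2: "letter D k \<le> 2 \<longleftrightarrow> \<not> cov D k \<and> \<not> hl D k"
  using hl_tch[of D k] by (auto simp: letter_def)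

definition alive :: "edge set \<Rightarrow> bool" where
  "alive D \<longleftrightarrow> (\<forall>k<n. \<exists>j<n. \<not> cov D j \<and> conn D k j)"

definition noncrossing_blocks :: "edge set \<Rightarrow> bool" where
  "noncrossing_blocks D \<longleftrightarrow> (\<forall>x y z w. x < y \<and> y < z \<and> z < w \<and> w < n \<longrightarrow>
     \<not> cov D x \<longrightarrow> \<not> cov D y \<longrightarrow> \<not> cov D z \<longrightarrow> \<not> cov D w \<longrightarrow> conn D x z \<longrightarrow> conn D y w \<longrightarrow> conn D x y)"

text \<open>The leftmost uncovered point names a block; this is meaningful only when the component
  has an uncovered point.\<close>

definition root :: "edge set \<Rightarrow> nat \<Rightarrow> nat" where
  "root D k = (LEAST j. \<not> cov D j \<and> conn D j k)"

lemma root_props: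
  assumes "\<not> cov D j" "conn D j k"
  shows "\<not> cov D (root D k)" "conn D (root D k) k" "root D k \<le> j" "\<not> hl D (root D k)"
proof -
  have *: "\<not> cov D (root D k) \<and> conn D (root D k) k"
    unfolding root_def by (rule LeastI[of _ j]) (use assms in simp)
  then show "\<not> cov D (root D k)" "conn D (root D k) k"
    by simp_all
  have least: "root D k \<le> i" if "\<not> cov D i" "conn D i k" for i
    unfolding root_def by (rule Least_le) (use that in simp)
  then show "root D k \<le> j"
    using assms by simp
  show "\<not> hl D (root D k)"
    unfolding hl_def using least * conn_trans by (meson not_less)
qed

lemma root_cong: "conn D k l \<Longrightarrow> root D k = root D l"
  unfolding root_def by (metis conn_sym conn_trans)

lemma root_eq_iff: "\<not> cov D k \<Longrightarrow> \<not> cov D l \<Longrightarrow> root D k = root D l \<longleftrightarrow> conn D k l"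
  using root_props(2)[of D k k] root_props(2)[of D l l] root_cong conn_refl
  by (metis conn_sym conn_trans)

text \<open>What the stack of \<open>decode\<close> has to contain before point \<open>i\<close> is
  read: of every block that still continues, the point seen last.\<close>

definition pending :: "edge set \<Rightarrow> nat \<Rightarrow> nat set" where
  "pending D i = {j. j < i \<and> \<not> cov D j \<and> (\<exists>m. i \<le> m \<and> m < n \<and> \<not> cov D m \<and> conn D j m) \<and>
     (\<forall>m. j < m \<and> m < i \<and> \<not> cov D m \<longrightarrow> \<not> conn D j m)}"

text \<open>Since blocks do not cross, the block of a point that has a left neighbour is the one that was
  seen last among those still waiting for a point.\<close>

lemma decode_letter:
  assumes D: "D \<subseteq> pairs" "noncrossing_blocks D" and d: "\<And>k. k < n \<Longrightarrow> d k = letter D k" and "i \<le> n"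
  shows "snd (decode d i) = pending D i \<and> (\<forall>j<i. \<not> cov D j \<longrightarrow> fst (decode d i) j = root D j)"
  using \<open>i \<le> n\<close>
proof (induction i)
  case 0
  then show ?case
    by (auto simp: pending_def)
next
  case (Suc i)
  obtain blk op where dec: "decode d i = (blk, op)"
    by fastforce
  have op: "op = pending D i" and blk: "\<And>j. j < i \<Longrightarrow> \<not> cov D j \<Longrightarrow> blk j = root D j"
    using Suc dec by auto
  have "i < n"
    using Suc by simp
  have L: "linL (d i) \<longleftrightarrow> \<not> cov D i \<and> hl D i" and R: "linR (d i) \<longleftrightarrow> \<not> cov D i \<and> hr D i"
    using d[OF \<open>i < n\<close>] letter_linL letter_linR by simp_all
  have fin: "finite op"
    unfolding op pending_def by simp
  have prev: "Max op \<in> op \<and> conn D (Max op) i \<and> (\<forall>j\<in>op. conn D j i \<longrightarrow> j = Max op)" if hL: "linL (d i)"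
  proof -
    define S where "S = {j. j < i \<and> \<not> cov D j \<and> conn D j i}"
    have "finite S" "S \<noteq> {}"
      using hL L unfolding S_def hl_def by auto
    \<comment> \<open>The nearest uncovered point to the left in the block of \<open>i\<close>; it
      has to be the top of the stack.\<close>
    define p where "p = Max S"
    have p: "p \<in> S" "\<And>j. j \<in> S \<Longrightarrow> j \<le> p"
      unfolding p_def using \<open>finite S\<close> \<open>S \<noteq> {}\<close> by auto
    have pD: "p < i" "\<not> cov D p" "conn D p i" "\<not> cov D i"
      using p(1) hL L unfolding S_def by auto
    have "p \<in> op"
    proof -
      have "\<not> conn D p m" if "p < m" "m < i" "\<not> cov D m" for m
      proof
        assume "conn D p m"
        then have "m \<in> S"
          using that pD conn_sym conn_trans unfolding S_def by blast
        then show False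
          using p(2) that by force
      qed
      then show ?thesis
        unfolding op pending_def using pD \<open>i < n\<close> by blast
    qed
    \<comment> \<open>A waiting point \<open>q\<close> strictly between \<open>p\<close> and
      \<open>i\<close> belongs to another block with a point beyond \<open>i\<close>, and that block
      would cross the pair \<open>p\<close>, \<open>i\<close>.\<close>
    moreover have "q \<le> p" if "q \<in> op" for q
    proof (rule ccontr)
      assume "\<not> q \<le> p"
      then have "p < q"
        by simp
      obtain m where q: "q < i" "\<not> cov D q" "i \<le> m" "m < n" "\<not> cov D m" "conn D q m"
        using \<open>q \<in> op\<close> unfolding op pending_def by blast
      have nq: "\<not> conn D q i"
      proof
        assume "conn D q i"
        then have "q \<in> S"
          using q unfolding S_def by blast
        then show False
          using p(2) \<open>p < q\<close> by force
      qed
      then have "i < m"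
        using q by (cases "i = m") auto
      then have "conn D p q"
        using D(2) \<open>p < q\<close> q pD unfolding noncrossing_blocks_def by blast
      then show False
        using nq pD(3) conn_sym conn_trans by blast
    qed
    ultimately have "Max op = p"
      using fin by (intro Max_eqI) auto
    moreover have "j = p" if j: "j \<in> op" "conn D j i" for j
    proof -
      have "j < i" "\<not> cov D j" "\<And>m. j < m \<Longrightarrow> m < i \<Longrightarrow> \<not> cov D m \<Longrightarrow> \<not> conn D j m"
        using j(1) unfolding op pending_def by blast+
      then have "j \<le> p" "\<not> j < p"
        using p(2) j(2) pD conn_sym conn_trans unfolding S_def by blast+
      then show ?thesis
        by simp
    qed
    ultimately show ?thesis
      using \<open>p \<in> op\<close> pD by blast
  qed
  define op' where "op' = (if linL (d i) \<and> op \<noteq> {} then op - {Max op} else op)"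
  \<comment> \<open>At most the top entry belongs to the block of \<open>i\<close>, so popping it
    removes exactly the entries whose block is continued by \<open>i\<close>.\<close>
  have op': "j \<in> op' \<longleftrightarrow> j \<in> op \<and> (cov D i \<or> \<not> conn D j i)" for j
  proof (cases "linL (d i)")
    case True
    then show ?thesis
      using prev[OF True] L unfolding op'_def by auto
  next
    case False
    have "cov D i \<or> \<not> conn D j i" if "j \<in> op"
      using that False L unfolding op pending_def hl_def by blast
    then show ?thesis
      using False unfolding op'_def by auto
  qed
  have new: "j \<in> pending D (Suc i) \<longleftrightarrow> j \<in> op' \<or> j = i \<and> linR (d i)" for j
  proof (cases "j = i")
    case True
    have "i \<notin> op'"
      unfolding op' op pending_def by simp
    moreover have "i \<in> pending D (Suc i) \<longleftrightarrow> linR (d i)"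
      unfolding R pending_def hr_def using conn_commute[of D i] by (auto simp: Suc_le_eq)
    ultimately show ?thesis
      using True by simp
  next
    case False
    have "(\<exists>m. Suc i \<le> m \<and> m < n \<and> \<not> cov D m \<and> conn D j m) \<longleftrightarrow>
        (\<exists>m. i \<le> m \<and> m < n \<and> \<not> cov D m \<and> conn D j m)" if "cov D i \<or> \<not> conn D j i"
      using that by (metis Suc_leD Suc_leI le_neq_implies_less)
    then show ?thesis
      using False unfolding op' op pending_def by (auto simp: less_Suc_eq)
  qed
  have "snd (decode d (Suc i)) = pending D (Suc i)"
    using new by (auto simp: dec Let_def op'_def[symmetric])
  moreover have "fst (decode d (Suc i)) j = root D j" if "j < Suc i" "\<not> cov D j" for j
  proof (cases "j = i")
    case True
    show ?thesis
    proof (cases "linL (d i)")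
      case hL: True
      then have "Max op < i" "\<not> cov D (Max op)"
        using prev[OF hL] unfolding op pending_def by blast+
      then have "fst (decode d (Suc i)) i = root D (Max op)"
        using hL prev[OF hL] blk by (auto simp: dec Let_def)
      then show ?thesis
        using True prev[OF hL] root_cong by simp
    next
      case False
      then have "\<not> hl D i"
        using L that True by simp
      then have "root D i = i"
        using root_props[of D i i] that True unfolding hl_def by (metis conn_refl le_neq_implies_less)
      then show ?thesis
        using True False by (simp add: dec Let_def)
    qed
  next
    case False
    then show ?thesis
      using that blk by (simp add: dec Let_def)
  qed
  ultimately show ?case
    by blast
qed

section \<open>One transition, computed from letters and block labels\<close>

definition below :: "nat \<Rightarrow> nat \<Rightarrow> nat \<Rightarrow> bool" where
  "below a b k \<longleftrightarrow> (Y k - Y a) * (X b - X a) < (X k - X a) * (Y b - Y a)"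

definition newcov :: "(nat \<Rightarrow> nat) \<Rightarrow> nat \<Rightarrow> nat \<Rightarrow> nat \<Rightarrow> bool" where
  "newcov d a b k \<longleftrightarrow> d k = 5 \<or> a < k \<and> k < b \<and> below a b k"

definition newblk :: "(nat \<Rightarrow> nat) \<Rightarrow> nat \<Rightarrow> nat \<Rightarrow> nat \<Rightarrow> nat" where
  "newblk f a b k = (if f k = f b then f a else f k)"

text \<open>Labels mean something only at points uncovered before the step; \<open>newcov\<close>
  discards the other points \<open>j\<close>, since it also holds where the old letter is 5.\<close>

definition nlink :: "(nat \<Rightarrow> nat) \<Rightarrow> (nat \<Rightarrow> nat) \<Rightarrow> nat \<Rightarrow> nat \<Rightarrow> nat \<Rightarrow> nat \<Rightarrow> bool" where
  "nlink d f a b k j \<longleftrightarrow> \<not> newcov d a b j \<and> newblk f a b j = newblk f a b k"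

definition newletter :: "(nat \<Rightarrow> nat) \<Rightarrow> (nat \<Rightarrow> nat) \<Rightarrow> nat \<Rightarrow> nat \<Rightarrow> nat \<Rightarrow> nat" where
  "newletter d f a b k = (if newcov d a b k then 5 else if d k = 0 \<and> k \<noteq> a \<and> k \<noteq> b then 0
     else 1 + of_bool (\<exists>j<n. k < j \<and> nlink d f a b k j) + 2 * of_bool (\<exists>j<n. j < k \<and> nlink d f a b k j))"

text \<open>Word-level form of \<open>extends\<close>. Letter 0 above the segment means neither
  touched nor covered, as in \<open>over_allI\<close> and \<open>over_allD\<close>. The last line is
  the dead-end test: only a block that loses a point to the new segment can die.\<close>

definition step_ok :: "(nat \<Rightarrow> nat) \<Rightarrow> (nat \<Rightarrow> nat) \<Rightarrow> nat \<Rightarrow> nat \<Rightarrow> bool" where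
  "step_ok d f a b \<longleftrightarrow> a < b \<and> d a \<noteq> 5 \<and> d b \<noteq> 5 \<and> f a \<noteq> f b \<and>
     (\<forall>k<n. a < k \<and> k < b \<and> \<not> below a b k \<longrightarrow> d k = 0) \<and>
     (\<forall>k<n. newcov d a b k \<and> d k \<noteq> 5 \<longrightarrow> (\<exists>j<n. j \<noteq> k \<and> nlink d f a b k j))"

definition extends :: "edge set \<Rightarrow> edge \<Rightarrow> bool" where
  "extends D s \<longleftrightarrow> s \<in> pairs \<and> (\<forall>t\<in>D. over t s) \<and> \<not> conn D (fst s) (snd s) \<and> alive (insert s D)"

context
  fixes D d f a b
  assumes D: "D \<subseteq> pairs" "noncrossing_blocks D" "alive D" and ab: "a < n" "b < n"
    and d: "\<And>k. k < n \<Longrightarrow> d k = letter D k"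
    and f: "\<And>k. k < n \<Longrightarrow> \<not> cov D k \<Longrightarrow> f k = root D k"
begin

lemma newcov_cov: "a < b \<Longrightarrow> k < n \<Longrightarrow> newcov d a b k \<longleftrightarrow> cov (insert (a, b) D) k"
  unfolding newcov_def below_def cov_insert
  using below_ht_iff[of a b k] d[of k] letter_covered ab pairs_iff by simp

text \<open>At uncovered points labels are roots, so equal labels mean connected, and renaming the
  block of \<open>b\<close> mirrors \<open>conn_insert\<close>.\<close>

lemma newblk_eq_iff:
  assumes "k < n" "l < n" "\<not> cov D k" "\<not> cov D l" "\<not> cov D a" "\<not> cov D b"
  shows "newblk f a b k = newblk f a b l \<longleftrightarrow> conn (insert (a, b) D) k l"
proof -
  have "f k = f b \<longleftrightarrow> conn D k b" "f l = f b \<longleftrightarrow> conn D l b" "f k = f a \<longleftrightarrow> conn D k a"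
    "f l = f a \<longleftrightarrow> conn D l a" "f k = f l \<longleftrightarrow> conn D k l"
    using f assms ab root_eq_iff by simp_all
  then show ?thesis
    unfolding newblk_def conn_insert by (metis conn_commute conn_trans)
qed

text \<open>Labels say nothing about covered points, so the elementary conditions on the endpoints
  are settled first. Then the test above the segment becomes \<open>over\<close> by
  \<open>over_allI\<close> and \<open>over_allD\<close>, and the test of newly covered points
  becomes \<open>alive\<close>.\<close>

lemma step_ok_iff: "step_ok d f a b \<longleftrightarrow> extends D (a, b)"
proof (cases "a < b \<and> \<not> cov D a \<and> \<not> cov D b \<and> \<not> conn D a b")
  case False
  have "\<not> step_ok d f a b"
    using False ab d[of a] d[of b] f[of a] f[of b] letter_covered root_cong[of D a b]
    unfolding step_ok_def by auto
  moreover have "\<not> extends D (a, b)"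
    using False over_allD(2,3)[OF D(1), of "(a, b)"] unfolding extends_def
    by (auto simp: pairs_iff)
  ultimately show ?thesis
    by simp
next
  case True
  let ?D = "insert (a, b) D"
  have p: "(a, b) \<in> pairs"
    using True ab by (simp add: pairs_iff)
  have "(a, b) \<notin> D"
    using True conn_edge by blast
  have one: "(\<forall>k<n. a < k \<and> k < b \<and> \<not> below a b k \<longrightarrow> d k = 0) \<longleftrightarrow> (\<forall>t\<in>D. over t (a, b))"
  proof
    assume L: "\<forall>k<n. a < k \<and> k < b \<and> \<not> below a b k \<longrightarrow> d k = 0"
    have "\<not> tch D k" if "a < k" "k < b" "ht (a, b) (X k) < Y k" for k
    proof -
      have "k < n" "\<not> below a b k"
        using that ab below_ht_iff[OF p, of k] unfolding below_def by auto
      then show ?thesis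
        using L that d[of k] letter_untouched by auto
    qed
    then show "\<forall>t\<in>D. over t (a, b)"
      using over_allI[OF D(1) p \<open>(a, b) \<notin> D\<close>] True by simp
  next
    assume R: "\<forall>t\<in>D. over t (a, b)"
    show "\<forall>k<n. a < k \<and> k < b \<and> \<not> below a b k \<longrightarrow> d k = 0"
    proof (intro allI impI)
      fix k
      assume k: "k < n" "a < k \<and> k < b \<and> \<not> below a b k"
      then have "ht (a, b) (X k) < Y k"
        using below_ht_iff[OF p, of k] ht_neq[OF p, of k] unfolding below_def by simp
      then show "d k = 0"
        using over_allD(4)[OF D(1) p R, of k] k d[of k] letter_untouched by simp
    qed
  qed
  \<comment> \<open>By \<open>alive D\<close> every component had an uncovered point. If the new
    segment covers it, the test supplies another one in the merged component.\<close>
  have two: "(\<forall>k<n. newcov d a b k \<and> d k \<noteq> 5 \<longrightarrow> (\<exists>j<n. j \<noteq> k \<and> nlink d f a b k j)) \<longleftrightarrow> alive ?D"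
  proof
    assume L: "\<forall>k<n. newcov d a b k \<and> d k \<noteq> 5 \<longrightarrow> (\<exists>j<n. j \<noteq> k \<and> nlink d f a b k j)"
    show "alive ?D"
      unfolding alive_def
    proof (intro allI impI)
      fix k
      assume "k < n"
      then obtain l where l: "l < n" "\<not> cov D l" "conn D k l"
        using D(3) unfolding alive_def by blast
      have kl: "conn ?D k l"
        using l(3) by (rule conn_mono[rotated]) auto
      show "\<exists>j<n. \<not> cov ?D j \<and> conn ?D k j"
      proof (cases "cov ?D l")
        case True
        then have "newcov d a b l \<and> d l \<noteq> 5"
          using newcov_cov[of l] l d letter_covered \<open>a < b \<and> _\<close> by simp
        then obtain j where j: "j < n" "nlink d f a b l j"
          using L l(1) by blast
        then have "\<not> cov ?D j" "newblk f a b j = newblk f a b l"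
          using newcov_cov[of j] \<open>a < b \<and> _\<close> unfolding nlink_def by auto
        then have "conn ?D j l"
          using newblk_eq_iff[of j l] j(1) l \<open>a < b \<and> _\<close> cov_insert by blast
        then show ?thesis
          using j(1) \<open>\<not> cov ?D j\<close> kl conn_sym conn_trans by blast
      qed (use l kl in blast)
    qed
  next
    assume R: "alive ?D"
    show "\<forall>k<n. newcov d a b k \<and> d k \<noteq> 5 \<longrightarrow> (\<exists>j<n. j \<noteq> k \<and> nlink d f a b k j)"
    proof (intro allI impI)
      fix k
      assume k: "k < n" "newcov d a b k \<and> d k \<noteq> 5"
      then obtain j where j: "j < n" "\<not> cov ?D j" "conn ?D k j"
        using R unfolding alive_def by blast
      have "cov ?D k" "\<not> cov D k"
        using k newcov_cov[of k] d letter_covered True by simp_all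
      then have "j \<noteq> k" "newblk f a b j = newblk f a b k"
        using j newblk_eq_iff[of j k] k(1) True cov_insert conn_sym by blast+
      then show "\<exists>j<n. j \<noteq> k \<and> nlink d f a b k j"
        using j newcov_cov[of j] True unfolding nlink_def by blast
    qed
  qed
  have "f a \<noteq> f b"
    using f ab root_eq_iff True by simp
  then show ?thesis
    using one two True p d ab letter_covered unfolding step_ok_def extends_def by simp
qed

lemma newletter_eq:
  assumes ok: "extends D (a, b)" and "k < n"
  shows "newletter d f a b k = letter (insert (a, b) D) k"
proof -
  let ?D = "insert (a, b) D"
  have p: "(a, b) \<in> pairs" "a < b"
    using ok by (auto simp: extends_def pairs_iff)
  have unc: "\<not> cov D a" "\<not> cov D b"
    using over_allD(2,3)[OF D(1) p(1)] ok by (simp_all add: extends_def)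
  show ?thesis
  proof (cases "cov ?D k")
    case True
    then show ?thesis
      using newcov_cov[of k] p \<open>k < n\<close> by (simp add: newletter_def letter_def)
  next
    case False
    then have kD: "\<not> cov D k"
      by (simp add: cov_insert)
    have link: "nlink d f a b k j \<longleftrightarrow> \<not> cov ?D j \<and> conn ?D j k" if "j < n" for j
      using newcov_cov[of j] newblk_eq_iff[of j k] that p kD unc \<open>k < n\<close> unfolding nlink_def
      by (metis cov_insert)
    have "(\<exists>j<n. k < j \<and> nlink d f a b k j) \<longleftrightarrow> hr ?D k"
      unfolding hr_def using link by blast
    moreover have "(\<exists>j<n. j < k \<and> nlink d f a b k j) \<longleftrightarrow> hl ?D k"
      unfolding hl_def using link \<open>k < n\<close> by (meson less_trans)
    moreover have "d k = 0 \<and> k \<noteq> a \<and> k \<noteq> b \<longleftrightarrow> \<not> tch ?D k"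
      using d[OF \<open>k < n\<close>] letter_untouched kD unfolding tch_insert by simp
    moreover have "\<not> newcov d a b k"
      using newcov_cov[of k] p \<open>k < n\<close> False by simp
    ultimately show ?thesis
      using False unfolding newletter_def letter_def by simp
  qed
qed

end

section \<open>Counting blocks\<close>

lemma pot_letter: "pot n (letter D) + card {k. k < n \<and> \<not> cov D k \<and> \<not> hl D k} = n"
  using pot_compl[of n "letter D"] by (simp add: letter_le_2)

text \<open>Sending the leftmost point of each new block to its old root is injective but not onto:
  the old blocks of \<open>a\<close> and \<open>b\<close> have different roots, yet belong to one
  new component. So there are strictly fewer blocks.\<close>

lemma pot_increases:
  assumes D: "D \<subseteq> pairs" and ok: "extends D (a, b)"
  shows "pot n (letter D) < pot n (letter (insert (a, b) D))"
proof -
  let ?D = "insert (a, b) D"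
  define N where "N E = {k. k < n \<and> \<not> cov E k \<and> \<not> hl E k}" for E
  have p: "(a, b) \<in> pairs" "a < n" "b < n" "\<not> conn D a b"
    using ok by (auto simp: extends_def pairs_iff)
  have unc: "\<not> cov D a" "\<not> cov D b"
    using over_allD(2,3)[OF D p(1)] ok by (simp_all add: extends_def)
  have mono: "conn D u v \<Longrightarrow> conn ?D u v" for u v
    by (rule conn_mono) auto
  have same: "k = l" if "k \<in> N ?D" "l \<in> N ?D" "conn ?D k l" for k l
    using that unfolding N_def hl_def by (metis (mono_tags, lifting) conn_sym linorder_neqE_nat mem_Collect_eq)
  have rt: "root D k \<in> N D \<and> conn D (root D k) k" if "k < n" "\<not> cov D k" for k
    using root_props[of D k k] that unfolding N_def by (auto intro: le_less_trans)
  have unc': "k < n \<and> \<not> cov D k" if "k \<in> N ?D" for k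
    using that unfolding N_def cov_insert by simp
  have inj: "inj_on (root D) (N ?D)"
  proof (rule inj_onI)
    fix k l
    assume kl: "k \<in> N ?D" "l \<in> N ?D" "root D k = root D l"
    then have "conn D k l"
      using rt unc' conn_sym conn_trans by metis
    then show "k = l"
      using same kl mono by blast
  qed
  \<comment> \<open>If both old roots were hit, their preimages would lie in the merged component
    and hence coincide.\<close>
  have "\<exists>r\<in>N D. r \<notin> root D ` N ?D"
  proof (rule ccontr)
    assume "\<not> ?thesis"
    then obtain k l where kl: "k \<in> N ?D" "root D a = root D k" "l \<in> N ?D" "root D b = root D l"
      using rt[OF p(2) unc(1)] rt[OF p(3) unc(2)] by blast
    have "conn D k a" "conn D l b"
      using root_eq_iff[of D k a] root_eq_iff[of D l b] unc unc'[OF kl(1)] unc'[OF kl(3)] kl(2,4)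
      by simp_all
    then have "conn ?D k a" "conn ?D l b"
      using mono by blast+
    moreover have "conn ?D a b"
      by (rule conn_edge) simp
    ultimately have "conn ?D k l"
      using conn_sym conn_trans by blast
    then have "k = l"
      using same kl by blast
    then have "root D a = root D b"
      using kl by simp
    then show False
      using root_eq_iff unc p by blast
  qed
  moreover have "root D ` N ?D \<subseteq> N D"
    using rt unc' by blast
  ultimately have "root D ` N ?D \<subset> N D"
    by blast
  moreover have "finite (N D)"
    unfolding N_def by simp
  ultimately have "card (N ?D) < card (N D)"
    using card_image[OF inj] psubset_card_mono by metis
  then show ?thesis
    using pot_letter[of D] pot_letter[of ?D] unfolding N_def by linarith
qed

lemma not_cov_0: "\<not> cov D 0"
  by (simp add: cov_def)

text \<open>Under \<open>alive\<close> every component contains the leftmost point of a block, so at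
  most one block means one component. That block starts at point 0, which cannot be covered.\<close>

lemma pot_final:
  assumes "alive D" "n > 0"
  shows "n \<le> pot n (letter D) + 1 \<longleftrightarrow> (\<forall>x<n. \<forall>y<n. conn D x y)"
proof -
  define N where "N = {k. k < n \<and> \<not> cov D k \<and> \<not> hl D k}"
  have fin: "finite N"
    unfolding N_def by simp
  have "0 \<in> N"
    using assms not_cov_0 by (simp add: N_def hl_def)
  have "card N \<le> 1 \<longleftrightarrow> (\<forall>x<n. \<forall>y<n. conn D x y)"
  proof
    assume "card N \<le> 1"
    then have N: "N = {0}"
      using \<open>0 \<in> N\<close> fin by (metis One_nat_def card_le_Suc0_iff_eq is_singletonI' is_singleton_the_elem the_elem_eq singletonD empty_iff)
    have "conn D 0 x" if x: "x < n" for x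
    proof -
      obtain j where j: "j < n" "\<not> cov D j" "conn D x j"
        using assms(1) x unfolding alive_def by blast
      then have "root D j \<in> N"
        using root_props[of D j j] unfolding N_def by (auto intro: le_less_trans)
      then have "conn D 0 j"
        using N root_props(2)[of D j j] j by simp
      then show ?thesis
        using j(3) conn_sym conn_trans by blast
    qed
    then show "\<forall>x<n. \<forall>y<n. conn D x y"
      using conn_sym conn_trans by blast
  next
    assume R: "\<forall>x<n. \<forall>y<n. conn D x y"
    \<comment> \<open>Any other point has the uncovered point 0 to its left in its
      component.\<close>
    have "k = 0" if "k \<in> N" for k
      using that R not_cov_0 unfolding N_def hl_def by (metis (mono_tags, lifting) assms(2) gr0I mem_Collect_eq)
    then have "N = {0}"
      using \<open>0 \<in> N\<close> by blast
    then show "card N \<le> 1"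
      by simp
  qed
  moreover have "pot n (letter D) + card N = n"
    unfolding N_def by (rule pot_letter)
  then have "n \<le> pot n (letter D) + 1 \<longleftrightarrow> card N \<le> 1"
    by (intro iffI) linarith+
  ultimately show ?thesis
    by simp
qed

text \<open>Planarity enters only through one fact: an uncovered point strictly between
  \<open>a\<close> and \<open>b\<close> lies above the new segment, hence is isolated. Members of
  crossing blocks would thus all lie outside that interval, and noncrossing of the old blocks rules
  out the rest.\<close>

lemma noncrossing_blocks_insert:
  assumes D: "D \<subseteq> pairs" "noncrossing_blocks D" and ok: "extends D (a, b)"
  shows "noncrossing_blocks (insert (a, b) D)"
proof -
  let ?D = "insert (a, b) D"
  have p: "(a, b) \<in> pairs" "a < b" "b < n"
    using ok by (auto simp: extends_def pairs_iff)
  have unc: "\<not> cov D a" "\<not> cov D b"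
    using over_allD(2,3)[OF D(1) p(1)] ok by (simp_all add: extends_def)
  have unc': "\<not> cov D u" if "\<not> cov ?D u" for u
    using that by (simp add: cov_insert)
  have outside: "\<not> (a < u \<and> u < b)" if "\<not> cov ?D u" "conn ?D u v" "u \<noteq> v" for u v
  proof
    assume u: "a < u \<and> u < b"
    then have "ht (a, b) (X u) < Y u"
      using that(1) ht_neq[OF p(1), of u] by (simp add: cov_insert)
    then have "\<not> tch D u"
      using over_allD(4)[OF D(1) p(1), of u] ok u by (simp add: extends_def)
    then have "\<not> tch ?D u"
      using u by (simp add: tch_insert)
    then show False
      using conn_untouched that by blast
  qed
  have NC: "conn D x y" if "x < y" "y < z" "z < w" "w < n" "\<not> cov D x" "\<not> cov D y" "\<not> cov D z" "\<not> cov D w"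
    "conn D x z" "conn D y w" for x y z w
    using D(2) that unfolding noncrossing_blocks_def by blast
  have mono: "conn D u v \<Longrightarrow> conn ?D u v" for u v
    by (rule conn_mono) auto
  have eab: "conn ?D a b"
    by (rule conn_edge) simp
  show ?thesis
    unfolding noncrossing_blocks_def
  proof (intro allI impI, rule ccontr)
    fix x y z w
    assume xyzw: "x < y \<and> y < z \<and> z < w \<and> w < n"
      and c: "\<not> cov ?D x" "\<not> cov ?D y" "\<not> cov ?D z" "\<not> cov ?D w"
      and xz: "conn ?D x z" and yw: "conn ?D y w" and n: "\<not> conn ?D x y"
    have lt: "x < y" "y < z" "z < w" "w < n"
      using xyzw by auto
    have cD: "\<not> cov D x" "\<not> cov D y" "\<not> cov D z" "\<not> cov D w"
      using c unc' by auto
    have out: "\<not> (a < x \<and> x < b)" "\<not> (a < y \<and> y < b)" "\<not> (a < z \<and> z < b)" "\<not> (a < w \<and> w < b)"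
      using outside[OF c(1) xz] outside[OF c(2) yw] outside[OF c(3) conn_sym[OF xz]]
        outside[OF c(4) conn_sym[OF yw]] lt by auto
    have n4: "\<not> conn D x y" "\<not> conn D x w" "\<not> conn D z y" "\<not> conn D z w"
      using n xz yw mono conn_sym conn_trans by meson+
    \<comment> \<open>Here the new edge joins \<open>x\<close> to \<open>z\<close>. Noncrossing of
      the old blocks forces \<open>v\<close> between \<open>y\<close> and \<open>w\<close> and
      \<open>u\<close> outside, so \<open>y\<close> or \<open>w\<close> lies strictly between
      \<open>a\<close> and \<open>b\<close>.\<close>
    have side: False if uv: "(u = a \<and> v = b) \<or> (u = b \<and> v = a)" "conn D x u" "conn D v z" "conn D y w" for u v
    proof -
      have un: "\<not> cov D u" "\<not> cov D v" "u < n" "v < n"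
        using uv(1) unc p by auto
      have ne: "u \<noteq> y" "u \<noteq> w" "v \<noteq> y" "v \<noteq> w"
        using uv n4 conn_sym by blast+
      have "\<not> (y < u \<and> u < w)"
        using NC[of x y u w] lt cD un uv n4 by blast
      moreover have "\<not> v < y"
        using NC[of v y z w] lt cD un uv n4 conn_sym conn_trans by meson
      moreover have "\<not> w < v"
        using NC[of y z w v] lt cD un uv n4 conn_sym conn_trans by meson
      ultimately have "y < v" "v < w" "u < y \<or> w < u"
        using ne by auto
      then show False
        using uv(1) out p(2) by auto
    qed
    have side': False if uv: "(u = a \<and> v = b) \<or> (u = b \<and> v = a)" "conn D y u" "conn D v w" "conn D x z" for u v
    proof -
      have un: "\<not> cov D u" "\<not> cov D v" "u < n" "v < n"
        using uv(1) unc p by auto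
      have ne: "u \<noteq> x" "u \<noteq> z" "v \<noteq> x" "v \<noteq> z"
        using uv n4 conn_sym by blast+
      have "\<not> (x < v \<and> v < z)"
      proof
        assume "x < v \<and> v < z"
        then have "conn D x v"
          using NC[of x v z w] lt cD un uv(3,4) by simp
        then show False
          using n4(2) conn_trans[OF _ uv(3)] by blast
      qed
      moreover have "\<not> u < x"
      proof
        assume "u < x"
        then have "conn D u x"
          using NC[of u x y z] lt cD un uv(4) conn_sym[OF uv(2)] by simp
        then show False
          using n4(1) conn_trans[OF uv(2)] conn_sym by blast
      qed
      moreover have "\<not> z < u"
        using NC[of x y z u] lt cD un uv(2,4) n4(1) by auto
      ultimately have "x < u" "u < z" "v < x \<or> z < v"
        using ne by auto
      then show False
        using uv(1) out p(2) by auto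
    qed
    \<comment> \<open>Each connection is old or passes the new edge. If both pass it,
      \<open>x\<close> and \<open>y\<close> are already in the merged component.\<close>
    consider "conn D x z" "conn D y w"
      | "conn D x z" "conn D y a" "conn D b w" | "conn D x z" "conn D y b" "conn D a w"
      | "conn D y w" "conn D x a" "conn D b z" | "conn D y w" "conn D x b" "conn D a z"
      | u v where "u \<in> {a, b}" "v \<in> {a, b}" "conn D x u" "conn D y v"
      using xz yw unfolding conn_insert by blast
    then show False
    proof cases
      case 1
      then show False
        using NC[of x y z w] lt cD n4 by blast
    next
      case (6 u v)
      then have "conn ?D u v"
        using eab conn_sym by auto
      then show False
        using 6 n mono conn_sym conn_trans by meson
    qed (use side side' in blast)+
  qed
qed

end

section \<open>Building sequences of trees\<close>

lemma conn_invariant: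
  assumes "conn D x y" "\<And>u v. (u, v) \<in> D \<Longrightarrow> P u \<longleftrightarrow> P v"
  shows "P x \<longleftrightarrow> P y"
  using assms(1) unfolding conn_def
proof (induction rule: rtrancl_induct)
  case (step y z)
  then show ?case
    using assms(2)[of y z] assms(2)[of z y] by auto
qed simp

text \<open>Acyclicity without cycles: every edge is a bridge.\<close>

definition acyc :: "edge set \<Rightarrow> bool" where
  "acyc D \<longleftrightarrow> (\<forall>a b. (a, b) \<in> D \<longrightarrow> \<not> conn (D - {(a, b)}) a b)"

text \<open>An old edge could stop being a bridge only by a detour through the new one; together
  with the old edge that detour would already connect \<open>a\<close> and \<open>b\<close>.\<close>

lemma acyc_insert:
  assumes D: "acyc D" "\<not> conn D a b"
  shows "acyc (insert (a, b) D)"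
  unfolding acyc_def
proof (intro allI impI)
  fix c d
  assume cd: "(c, d) \<in> insert (a, b) D"
  show "\<not> conn (insert (a, b) D - {(c, d)}) c d"
  proof (cases "(c, d) = (a, b)")
    case True
    then show ?thesis
      using D(2) conn_mono[of "insert (a, b) D - {(a, b)}" D a b] by auto
  next
    case False
    let ?E = "D - {(c, d)}"
    have cdD: "(c, d) \<in> D" and eq: "insert (a, b) D - {(c, d)} = insert (a, b) ?E"
      using False cd by auto
    have mono: "conn D x y" if "conn ?E x y" for x y
      by (rule conn_mono[OF _ that]) auto
    have "\<not> conn ?E c d"
      using D(1) cdD by (simp add: acyc_def)
    moreover have "\<not> (conn ?E c a \<and> conn ?E b d)"
      using D(2) mono[of c a] mono[of b d] conn_edge[OF cdD] conn_sym conn_trans by meson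
    moreover have "\<not> (conn ?E c b \<and> conn ?E a d)"
      using D(2) mono[of c b] mono[of a d] conn_edge[OF cdD] conn_sym conn_trans by meson
    ultimately show ?thesis
      unfolding eq conn_insert by blast
  qed
qed

lemma pot_cong: "(\<And>k. k < n \<Longrightarrow> d k = e k) \<Longrightarrow> pot n d = pot n e"
  unfolding pot_def by (metis (no_types, lifting))

definition digit :: "nat \<Rightarrow> nat \<Rightarrow> nat" where
  "digit w k = w div 6 ^ k mod 6"

context sorted_points
begin

definition all_conn :: "edge set \<Rightarrow> bool" where
  "all_conn D \<longleftrightarrow> (\<forall>x<n. \<forall>y<n. conn D x y)"

definition tree_set :: "edge set \<Rightarrow> bool" where
  "tree_set D \<longleftrightarrow> D \<subseteq> pairs \<and> (\<forall>s\<in>D. \<forall>t\<in>D. s \<noteq> t \<longrightarrow> nc s t) \<and> acyc D \<and> all_conn D"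

definition good :: "edge set \<Rightarrow> bool" where
  "good D \<longleftrightarrow> D \<subseteq> pairs \<and> noncrossing_blocks D \<and> alive D"

lemma conn_empty: "conn {} x y \<longleftrightarrow> x = y"
  by (auto simp: conn_def)

lemma good_empty: "good {}"
  unfolding good_def noncrossing_blocks_def alive_def by (auto simp: conn_empty cov_def)

lemma good_insert: "good D \<Longrightarrow> extends D s \<Longrightarrow> good (insert s D)"
  using noncrossing_blocks_insert[of D "fst s" "snd s"] unfolding good_def
  by (simp add: extends_def)

primrec ext :: "edge set \<Rightarrow> edge list \<Rightarrow> bool" where
  "ext D [] \<longleftrightarrow> True"
| "ext D (s # ss) \<longleftrightarrow> extends D s \<and> ext (insert s D) ss"

text \<open>The mark \<open>c\<close> is the left endpoint of the previous segment.\<close>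

primrec marks :: "nat \<Rightarrow> edge list \<Rightarrow> bool" where
  "marks c [] \<longleftrightarrow> True"
| "marks c (s # ss) \<longleftrightarrow> c < snd s \<and> marks (fst s) ss"

lemma marks_iff:
  "marks c ss \<longleftrightarrow> (ss = [] \<or> c < snd (hd ss)) \<and> successively (\<lambda>s t. fst s < snd t) ss"
proof (induction ss arbitrary: c)
  case (Cons s ss)
  then show ?case
    by (cases ss) auto
qed simp

lemma ext_props:
  assumes "ext D ss"
  shows "set ss \<subseteq> pairs \<and> sorted_wrt over ss \<and> (\<forall>t\<in>D. \<forall>s\<in>set ss. over t s) \<and>
    (acyc D \<longrightarrow> acyc (D \<union> set ss))"
  using assms
proof (induction ss arbitrary: D)
  case (Cons s ss)
  then have e: "extends D s" and ih: "set ss \<subseteq> pairs \<and> sorted_wrt over ss \<and>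
      (\<forall>t\<in>insert s D. \<forall>u\<in>set ss. over t u) \<and>
      (acyc (insert s D) \<longrightarrow> acyc (insert s D \<union> set ss))"
    using Cons.IH[of "insert s D"] by simp_all
  have "acyc (insert s D)" if "acyc D"
    using acyc_insert[OF that, of "fst s" "snd s"] e by (simp add: extends_def)
  then show ?case
    using ih e by (simp add: extends_def)
qed simp

lemma ext_canonical: "ext {} ss \<Longrightarrow> marks 0 ss \<Longrightarrow> canonical ss"
  using ext_props[of "{}" ss] by (simp add: canonical_def marks_iff)

text \<open>A component all of whose points are covered can never be joined to point 0.\<close>

lemma alive_prefix:
  assumes E: "E \<subseteq> pairs" and F: "F \<subseteq> pairs" "\<And>s t. s \<in> F \<Longrightarrow> t \<in> E \<Longrightarrow> over t s"
    and con: "all_conn (E \<union> F)" and "0 < n"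
  shows "alive E"
  unfolding alive_def
proof (intro allI impI, rule ccontr)
  fix k
  assume "k < n" "\<not> (\<exists>j<n. \<not> cov E j \<and> conn E k j)"
  then have cv: "cov E j" if "conn E k j" for j
    using conn_less[OF E that] that by blast
  \<comment> \<open>Membership in the hidden component is invariant under all edges: edges of
    \<open>E\<close> stay inside components, and edges of \<open>F\<close> end at uncovered points,
    hence outside it.\<close>
  have "conn E k u \<longleftrightarrow> conn E k v" if "(u, v) \<in> E \<union> F" for u v
  proof (cases "(u, v) \<in> E")
    case True
    then show ?thesis
      using conn_edge conn_sym conn_trans by meson
  next
    case False
    then have uv: "(u, v) \<in> F"
      using that by blast
    then have "\<not> cov E u" "\<not> cov E v"
      using over_allD(2,3)[OF E, of "(u, v)"] F by auto
    then show ?thesis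
      using cv by blast
  qed
  moreover have "conn (E \<union> F) k 0"
    using con \<open>k < n\<close> \<open>0 < n\<close> by (simp add: all_conn_def)
  ultimately have "conn E k k \<longleftrightarrow> conn E k 0"
    by (rule conn_invariant[rotated])
  then show False
    using cv[of 0] not_cov_0 by simp
qed

text \<open>In a tree the next segment joins two components, and \<open>alive_prefix\<close> applies
  because the remaining segments lie above the prefix and complete it to a connected graph.\<close>

lemma canonical_ext:
  assumes "sorted_wrt over (us @ vs)" "tree_set (set (us @ vs))" "0 < n"
  shows "ext (set us) vs"
  using assms
proof (induction vs arbitrary: us)
  case (Cons v vs)
  have sub: "set us \<subseteq> pairs" "v \<in> pairs" "set vs \<subseteq> pairs"
    and ac: "acyc (set (us @ v # vs))" and con: "all_conn (set (us @ v # vs))"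
    using Cons.prems(2) by (auto simp: tree_set_def)
  have ov: "over t v" if "t \<in> set us" for t
    using Cons.prems(1) that by (simp add: sorted_wrt_append)
  have "v \<notin> set us"
    using ov over_irrefl sub(2) by blast
  have "\<not> conn (set us) (fst v) (snd v)"
  proof
    assume "conn (set us) (fst v) (snd v)"
    then have "conn (set (us @ v # vs) - {v}) (fst v) (snd v)"
      by (rule conn_mono[rotated]) (use \<open>v \<notin> set us\<close> in auto)
    then show False
      using ac unfolding acyc_def by (metis in_set_conv_decomp prod.collapse)
  qed
  moreover have "alive (insert v (set us))"
  proof (rule alive_prefix)
    show "all_conn (insert v (set us) \<union> set vs)"
      using con by simp
    show "over t s" if "s \<in> set vs" "t \<in> insert v (set us)" for s t
      using Cons.prems(1) that by (auto simp: sorted_wrt_append)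
  qed (use sub Cons.prems(3) in auto)
  ultimately have "extends (set us) v"
    using sub ov by (simp add: extends_def)
  moreover have "ext (set (us @ [v])) vs"
    using Cons.prems by (intro Cons.IH) simp_all
  ultimately show ?case
    by simp
qed simp

text \<open>Existence of the canonical order gives surjectivity, its uniqueness injectivity.\<close>

lemma bij_ext_trees:
  assumes "0 < n"
  shows "bij_betw set {ss. ext {} ss \<and> marks 0 ss \<and> all_conn (set ss)} {D. tree_set D}"
  unfolding bij_betw_def
proof
  show "inj_on set {ss. ext {} ss \<and> marks 0 ss \<and> all_conn (set ss)}"
  proof (rule inj_onI)
    fix ss ts
    assume "ss \<in> {ss. ext {} ss \<and> marks 0 ss \<and> all_conn (set ss)}"
      "ts \<in> {ss. ext {} ss \<and> marks 0 ss \<and> all_conn (set ss)}" "set ss = set ts"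
    then show "ss = ts"
      using canonical_unique[of ss ts] ext_canonical[of ss] ext_canonical[of ts] ext_props[of "{}" ss]
      by auto
  qed
  have into: "tree_set (set ss)" if ss: "ext {} ss" "all_conn (set ss)" for ss
  proof -
    have props: "set ss \<subseteq> pairs" "sorted_wrt over ss" "acyc (set ss)"
      using ext_props[OF ss(1)] by (auto simp: acyc_def)
    have "nc s t" if st: "s \<in> set ss" "t \<in> set ss" "s \<noteq> t" for s t
    proof -
      obtain i j where ij: "i < length ss" "s = ss ! i" "j < length ss" "t = ss ! j"
        using st(1,2) unfolding in_set_conv_nth by blast
      then have "i \<noteq> j"
        using st(3) by blast
      then consider "i < j" | "j < i"
        by linarith
      then show ?thesis
        unfolding nc_def using ij props(2) by cases (simp_all add: sorted_wrt_iff_nth_less)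
    qed
    then show ?thesis
      using props ss(2) by (simp add: tree_set_def)
  qed
  have onto: "\<exists>ss. ext {} ss \<and> marks 0 ss \<and> set ss = D" if D: "tree_set D" for D
  proof -
    have "D \<subseteq> pairs" and ncD: "\<And>s t. s \<in> D \<Longrightarrow> t \<in> D \<Longrightarrow> s \<noteq> t \<Longrightarrow> nc s t"
      using D unfolding tree_set_def by blast+
    obtain ss where ss: "canonical ss" "set ss = D"
      using canonical_exists[OF \<open>D \<subseteq> pairs\<close> ncD] by blast
    have "ext (set []) ss"
      using canonical_ext[of "[]" ss] ss D assms by (simp add: canonical_def)
    moreover have "marks 0 ss"
    proof -
      \<comment> \<open>The initial mark 0 imposes nothing, since no right endpoint is point
        0.\<close>
      have "0 < snd (hd ss)" if "ss \<noteq> []"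
        using pairsD(1)[of "hd ss"] hd_in_set[OF that] ss(2) \<open>D \<subseteq> pairs\<close> by force
      then show ?thesis
        using ss(1) unfolding marks_iff canonical_def by (cases "ss = []") simp_all
    qed
    ultimately show ?thesis
      using ss(2) by auto
  qed
  show "set ` {ss. ext {} ss \<and> marks 0 ss \<and> all_conn (set ss)} = {D. tree_set D}"
  proof (intro equalityI subsetI)
    fix D
    assume "D \<in> {D. tree_set D}"
    then have D: "tree_set D" "all_conn D"
      by (simp_all add: tree_set_def)
    obtain ss where "ext {} ss \<and> marks 0 ss \<and> set ss = D"
      using onto[OF D(1)] by blast
    then show "D \<in> set ` {ss. ext {} ss \<and> marks 0 ss \<and> all_conn (set ss)}"
      using D(2) by (intro image_eqI[of _ _ ss]) simp_all
  qed (use into in auto)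
qed

section \<open>The automaton on words and marks\<close>

definition labels :: "nat \<Rightarrow> nat \<Rightarrow> nat" where
  "labels w = fst (decode (digit w) n)"

definition valid :: "nat \<Rightarrow> nat \<Rightarrow> nat \<Rightarrow> bool" where
  "valid w a b \<longleftrightarrow> step_ok (digit w) (labels w) a b \<and>
     pot n (digit w) < pot n (newletter (digit w) (labels w) a b)"

definition succ :: "nat \<Rightarrow> nat \<Rightarrow> nat \<Rightarrow> nat" where
  "succ w a b = (\<Sum>k<n. newletter (digit w) (labels w) a b k * 6 ^ k)"

text \<open>At most one block is left; the additive form avoids truncated subtraction.\<close>

definition final :: "nat \<Rightarrow> bool" where
  "final w \<longleftrightarrow> n \<le> pot n (digit w) + 1"

lemma newletter_less: "newletter d f a b k < 6"
  by (simp add: newletter_def)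

lemma succ_less: "succ w a b < 6 ^ n"
  unfolding succ_def by (rule digit_sum_less) (rule newletter_less)

lemma digit_succ: "k < n \<Longrightarrow> digit (succ w a b) k = newletter (digit w) (labels w) a b k"
  unfolding succ_def digit_def by (rule digit_of_sum) (simp_all add: newletter_less)

lemma pot_succ: "valid w a b \<Longrightarrow> pot n (digit w) < pot n (digit (succ w a b))"
  using pot_cong[of n "digit (succ w a b)" "newletter (digit w) (labels w) a b"] digit_succ
  by (simp add: valid_def)

lemma digit_code': "k < n \<Longrightarrow> digit (code D) k = letter D k"
  unfolding digit_def by (rule digit_code)

lemma labels_code: "good D \<Longrightarrow> k < n \<Longrightarrow> \<not> cov D k \<Longrightarrow> labels (code D) k = root D k"
  using decode_letter[of D "digit (code D)" n] digit_code' unfolding labels_def good_def by blast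

text \<open>On the word of a state the potential test of \<open>valid\<close> is automatic by
  \<open>pot_increases\<close>, so only the geometric condition remains.\<close>

lemma code_step:
  assumes D: "good D" and ab: "a < n" "b < n"
  shows "valid (code D) a b \<longleftrightarrow> extends D (a, b)"
    and "extends D (a, b) \<Longrightarrow> succ (code D) a b = code (insert (a, b) D)"
proof -
  have D': "D \<subseteq> pairs" "noncrossing_blocks D" "alive D"
    using D by (auto simp: good_def)
  note facts = D' ab digit_code'[of _ D] labels_code[OF D]
  have ok: "step_ok (digit (code D)) (labels (code D)) a b \<longleftrightarrow> extends D (a, b)"
    by (rule step_ok_iff) (use facts in auto)
  have nl: "newletter (digit (code D)) (labels (code D)) a b k = letter (insert (a, b) D) k"
    if "extends D (a, b)" "k < n" for k
    by (rule newletter_eq[OF _ _ _ _ _ _ _ that]) (use facts in auto)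
  show "succ (code D) a b = code (insert (a, b) D)" if "extends D (a, b)"
    unfolding succ_def code_def[of "insert (a, b) D"] using nl[OF that] by simp
  have "pot n (digit (code D)) < pot n (newletter (digit (code D)) (labels (code D)) a b)"
    if "extends D (a, b)"
    using pot_increases[OF D'(1) that] pot_cong[of n "digit (code D)" "letter D"]
      pot_cong[of n "newletter (digit (code D)) (labels (code D)) a b" "letter (insert (a, b) D)"]
      nl[OF that] digit_code' by simp
  then show "valid (code D) a b \<longleftrightarrow> extends D (a, b)"
    using ok unfolding valid_def by blast
qed

lemma final_code: "good D \<Longrightarrow> 0 < n \<Longrightarrow> final (code D) \<longleftrightarrow> all_conn D"
  using pot_final[of D] pot_cong[of n "digit (code D)" "letter D"] digit_code'
  by (simp add: final_def all_conn_def good_def)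

lemma code_empty: "code {} = 0"
  by (simp add: code_def letter_def cov_def tch_def)

primrec accepts :: "nat \<Rightarrow> nat \<Rightarrow> edge list \<Rightarrow> bool" where
  "accepts w c [] \<longleftrightarrow> final w"
| "accepts w c (s # ss) \<longleftrightarrow> fst s < n \<and> snd s < n \<and> valid w (fst s) (snd s) \<and> c < snd s \<and>
     accepts (succ w (fst s) (snd s)) (fst s) ss"

text \<open>Transitions from the word of a state lead to words of states again, so meaningless words
  never matter for acceptance.\<close>

lemma accepts_code:
  assumes "good D" "0 < n"
  shows "accepts (code D) c ss \<longleftrightarrow> ext D ss \<and> marks c ss \<and> all_conn (D \<union> set ss)"
  using assms(1)
proof (induction ss arbitrary: D c)
  case Nil
  then show ?case
    using final_code assms(2) by simp
next
  case (Cons s ss)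
  have less: "extends D s \<Longrightarrow> fst s < n \<and> snd s < n"
    using pairsD[of s] by (simp add: extends_def)
  have "valid (code D) (fst s) (snd s) \<longleftrightarrow> extends D s" if "fst s < n" "snd s < n"
    using code_step(1)[OF Cons.prems that] by simp
  moreover have "accepts (succ (code D) (fst s) (snd s)) (fst s) ss \<longleftrightarrow>
      ext (insert s D) ss \<and> marks (fst s) ss \<and> all_conn (insert s D \<union> set ss)" if "extends D s"
    using code_step(2)[OF Cons.prems, of "fst s" "snd s"] less[OF that] that
      Cons.IH[OF good_insert[OF Cons.prems that]] by simp
  ultimately show ?case
    using less by auto
qed

lemma bij_accepts_trees: "0 < n \<Longrightarrow> bij_betw set {ss. accepts 0 0 ss} {D. tree_set D}"
  using bij_ext_trees accepts_code[OF good_empty] by (simp add: code_empty)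

end

section \<open>Geometric graphs\<close>

lemma pcas_rtrancl: "pcas u p v \<Longrightarrow> set p \<subseteq> S \<Longrightarrow> (u, v) \<in> S\<^sup>*"
proof (induction p arbitrary: u)
  case (Cons e p)
  then have "(u, snd e) \<in> S"
    by (metis list.set_intros(1) pcas.simps(2) prod.collapse subsetD)
  moreover have "(snd e, v) \<in> S\<^sup>*"
    using Cons by simp
  ultimately show ?case
    by (rule converse_rtrancl_into_rtrancl)
qed simp

lemma pawalk_verts_nonempty [simp]: "pawalk_verts u p \<noteq> []"
  by (cases p) auto

lemma last_pawalk_verts: "pcas u p v \<Longrightarrow> last (pawalk_verts u p) = v"
  by (induction p arbitrary: u) auto

lemma fst_in_pawalk_verts: "e \<in> set p \<Longrightarrow> fst e \<in> set (butlast (pawalk_verts u p))"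
  by (induction p arbitrary: u) auto

text \<open>\<open>u\<close> is the last vertex of a walk without repeated vertices, and arcs start
  only at earlier ones.\<close>

lemma pawalk_no_return:
  assumes "pcas v p u" "distinct (pawalk_verts v p)" "e \<in> set p"
  shows "fst e \<noteq> u"
proof -
  have "pawalk_verts v p = butlast (pawalk_verts v p) @ [u]"
    using last_pawalk_verts[OF assms(1)] append_butlast_last_id[OF pawalk_verts_nonempty[of v p]] by simp
  then have "u \<notin> set (butlast (pawalk_verts v p))"
    using assms(2) by (metis distinct_butlast not_distinct_conv_prefix)
  then show ?thesis
    using fst_in_pawalk_verts[OF assms(3)] by metis
qed

text \<open>An edge lies on a cycle iff its ends stay connected without it. Both orientations have
  to be deleted, since each of them alone is an arc between the ends.\<close>

lemma cycle_free_iff: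
  fixes R :: "('a \<times> 'a) set"
  assumes R: "sym R" "irrefl R" "R \<subseteq> P \<times> P"
  defines "G \<equiv> with_proj \<lparr>pverts = P, parcs = R\<rparr>"
  shows "cycle_free G \<longleftrightarrow> (\<forall>u v. (u, v) \<in> R \<longrightarrow> (u, v) \<notin> (R - {(u, v), (v, u)})\<^sup>*)"
proof -
  have cyc: "pre_digraph.cycle G p \<longleftrightarrow> (\<exists>u\<in>P. set p \<subseteq> R \<and> pcas u p u \<and>
      distinct (tl (pawalk_verts u p)) \<and> p \<noteq> [])" for p
    unfolding G_def pre_digraph.cycle_def pre_digraph.awalk_def cas_with_proj_eq awalk_verts_with_proj_eq
    by auto
  show ?thesis
  proof (intro iffI allI impI notI)
    fix u v
    assume cf: "cycle_free G" and uv: "(u, v) \<in> R" and con: "(u, v) \<in> (R - {(u, v), (v, u)})\<^sup>*"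
    define S where "S = R - {(u, v), (v, u)}"
    have "sym S"
      using R(1) unfolding S_def sym_def by auto
    then have "(v, u) \<in> S\<^sup>*"
      using con sym_rtrancl unfolding S_def[symmetric] by (meson symD)
    interpret H: pair_wf_digraph "\<lparr>pverts = P, parcs = S\<rparr>"
      by unfold_locales (use R(3) in \<open>auto simp: S_def\<close>)
    have "v \<in> P" "u \<in> P"
      using uv R(3) by auto
    moreover have "S \<subseteq> P \<times> P"
      using R(3) by (auto simp: S_def)
    ultimately have "(v, u) \<in> rtrancl_on P S"
      using rtrancl_consistent_rtrancl_on[OF \<open>(v, u) \<in> S\<^sup>*\<close>, of P] by blast
    then have "v \<rightarrow>\<^sup>*\<^bsub>with_proj \<lparr>pverts = P, parcs = S\<rparr>\<^esub> u"
      by (simp add: reachable_def)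
    then obtain p where "H.apath v p u"
      using H.reachable_apath by blast
    then have p: "set p \<subseteq> S" "pcas v p u" "distinct (pawalk_verts v p)"
      unfolding H.apath_def H.awalk_def by auto
    have "u \<noteq> v"
      using uv R(2) by (auto simp: irrefl_def)
    \<comment> \<open>The only one-arc path back is the deleted reverse arc. So the path has at
      least two arcs, and closing it with \<open>(u, v)\<close> gives length at least 3.\<close>
    moreover have "p \<noteq> [(v, u)]"
      using p(1) by (auto simp: S_def)
    ultimately have "2 \<le> length p"
      using p(2) by (cases p rule: list.exhaust) (auto simp: Suc_le_eq)
    moreover have "pre_digraph.cycle G ((u, v) # p)"
      unfolding cyc using p uv \<open>u \<in> P\<close> by (intro bexI[of _ u]) (auto simp: S_def)
    ultimately show False
      using cf unfolding cycle_free_def by (metis Suc_le_mono length_Cons numeral_3_eq_3 numeral_2_eq_2)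
  next
    assume A: "\<forall>u v. (u, v) \<in> R \<longrightarrow> (u, v) \<notin> (R - {(u, v), (v, u)})\<^sup>*"
    show "cycle_free G"
      unfolding cycle_free_def
    proof
      assume "\<exists>p. pre_digraph.cycle G p \<and> 3 \<le> length p"
      then obtain c u where c: "set c \<subseteq> R" "pcas u c u" "distinct (tl (pawalk_verts u c))" "3 \<le> length c"
        unfolding cyc by blast
      then obtain v p where p: "c = (u, v) # p" "2 \<le> length p"
        by (cases c) auto
      have path: "pcas v p u" "distinct (pawalk_verts v p)" "set p \<subseteq> R" "(u, v) \<in> R"
        using c p by auto
      have ret: "fst e \<noteq> u" if "e \<in> set p" for e
        using pawalk_no_return[OF path(1,2) that] .
      obtain e f p' where ef: "p = e # f # p'"
        using p(2) by (metis Suc_le_length_iff numeral_2_eq_2)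
      have "(u, v) \<notin> set p"
        using ret by fastforce
      \<comment> \<open>Here length 3 matters: there is an arc \<open>f\<close> after
        \<open>e\<close>, and it would start at \<open>u\<close>.\<close>
      moreover have "e \<noteq> (v, u)"
      proof
        assume "e = (v, u)"
        then have "fst f = u"
          using path(1) ef by simp
        then show False
          using ret[of f] ef by simp
      qed
      \<comment> \<open>A later arc starting at \<open>v\<close> would visit \<open>v\<close> a
        second time.\<close>
      moreover have "(v, u) \<notin> set (f # p')"
      proof
        assume "(v, u) \<in> set (f # p')"
        then have "v \<in> set (butlast (pawalk_verts (snd e) (f # p')))"
          using fst_in_pawalk_verts by fastforce
        then have "v \<in> set (pawalk_verts (snd e) (f # p'))"
          by (rule in_set_butlastD)
        moreover have "fst e = v"
          using path(1) ef by simp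
        ultimately show False
          using path(2) unfolding ef by simp
      qed
      ultimately have "set p \<subseteq> R - {(u, v), (v, u)}"
        using path(3) ef by auto
      then have "(v, u) \<in> (R - {(u, v), (v, u)})\<^sup>*"
        by (rule pcas_rtrancl[OF path(1)])
      moreover have "sym (R - {(u, v), (v, u)})"
        using R(1) unfolding sym_def by auto
      ultimately have "(u, v) \<in> (R - {(u, v), (v, u)})\<^sup>*"
        using sym_rtrancl by (meson symD)
      then show False
        using A path(4) by blast
    qed
  qed
qed

text \<open>The library defines connectedness through the symmetric closure, which leaves a
  symmetric arc set unchanged.\<close>

lemma connected_iff:
  fixes R :: "('a \<times> 'a) set"
  assumes R: "sym R" "R \<subseteq> P \<times> P"
  shows "Digraph_Component.connected (with_proj \<lparr>pverts = P, parcs = R\<rparr>) \<longleftrightarrow>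
    P \<noteq> {} \<and> (\<forall>u\<in>P. \<forall>v\<in>P. (u, v) \<in> R\<^sup>*)"
proof -
  let ?G = "with_proj \<lparr>pverts = P, parcs = R\<rparr>"
  have "parcs (mk_symmetric ?G) = R"
    using R(1) by (auto simp: parcs_mk_symmetric dest: symD)
  then have arcs: "arcs_ends (with_proj (mk_symmetric ?G)) = R"
    by simp
  have "(u, v) \<in> rtrancl_on P R \<longleftrightarrow> (u, v) \<in> R\<^sup>*" if "u \<in> P" "v \<in> P" for u v
  proof
    show "(u, v) \<in> rtrancl_on P R" if "(u, v) \<in> R\<^sup>*"
      by (rule rtrancl_consistent_rtrancl_on[OF that \<open>u \<in> P\<close> \<open>v \<in> P\<close>]) (use R(2) in blast)
  qed (rule rtrancl_on_rtranclI)
  then show ?thesis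
    unfolding connected_def strongly_connected_def reachable_def arcs by simp
qed

lemma rtrancl_inj_image:
  assumes f: "inj_on f A" and S: "S \<subseteq> A \<times> A" and "a \<in> A" "b \<in> A"
  shows "(f a, f b) \<in> (map_prod f f ` S)\<^sup>* \<longleftrightarrow> (a, b) \<in> S\<^sup>*"
proof
  assume "(f a, f b) \<in> (map_prod f f ` S)\<^sup>*"
  moreover have "\<exists>c\<in>A. y = f c \<and> (a, c) \<in> S\<^sup>*" if "(f a, y) \<in> (map_prod f f ` S)\<^sup>*" for y
    using that
  proof (induction rule: rtrancl_induct)
    case base
    then show ?case
      using \<open>a \<in> A\<close> by blast
  next
    case (step y z)
    then obtain c where c: "c \<in> A" "y = f c" "(a, c) \<in> S\<^sup>*"
      by blast
    obtain d e where de: "(d, e) \<in> S" "y = f d" "z = f e"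
      using step by auto
    then have "d \<in> A" "e \<in> A"
      using S by blast+
    then have "d = c"
      using inj_onD[OF f, of d c] c de by simp
    then have "(a, e) \<in> S\<^sup>*"
      using c(3) de(1) by (simp add: rtrancl.rtrancl_into_rtrancl)
    then show ?case
      using \<open>e \<in> A\<close> de(3) by blast
  qed
  ultimately show "(a, b) \<in> S\<^sup>*"
    using f \<open>b \<in> A\<close> by (metis inj_onD)
next
  assume "(a, b) \<in> S\<^sup>*"
  then show "(f a, f b) \<in> (map_prod f f ` S)\<^sup>*"
  proof (induction rule: rtrancl_induct)
    case (step y z)
    then have "(f y, f z) \<in> map_prod f f ` S"
      by force
    then show ?case
      using step by (meson rtrancl.rtrancl_into_rtrancl)
  qed simp
qed

locale sorted_point_set =
  fixes P :: "point set" and n :: nat and q :: "nat \<Rightarrow> point"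
  assumes bij_q: "bij_betw q {..<n} P" and gp: "general_position P"
    and fst_less: "i < j \<Longrightarrow> j < n \<Longrightarrow> fst (q i) < fst (q j)" and n_pos: "0 < n"
begin

lemma q_in: "i < n \<Longrightarrow> q i \<in> P"
  using bij_q by (auto simp: bij_betw_def)

lemma inj_q: "inj_on q {..<n}"
  using bij_q by (simp add: bij_betw_def)

end

sublocale sorted_point_set \<subseteq> sorted_points n "\<lambda>i. fst (q i)" "\<lambda>i. snd (q i)"
proof
  fix i j
  assume "i < j" "j < n"
  then show "fst (q i) < fst (q j)"
    by (rule fst_less)
next
  fix i j k
  assume ijk: "i < j" "j < k" "k < n"
  let ?X = "\<lambda>i. fst (q i)" and ?Y = "\<lambda>i. snd (q i)"
  have less: "?X i < ?X j" "?X j < ?X k"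
    using fst_less ijk by simp_all
  show "(?Y j - ?Y i) * (?X k - ?X i) \<noteq> (?X j - ?X i) * (?Y k - ?Y i)"
  proof
    assume eq: "(?Y j - ?Y i) * (?X k - ?X i) = (?X j - ?X i) * (?Y k - ?Y i)"
    \<comment> \<open>The weight is read off the x-coordinates; the vanishing determinant makes the
      same weight work for the y-coordinates.\<close>
    define u where "u = (?X k - ?X j) / (?X k - ?X i)"
    have pos: "?X k - ?X i \<noteq> 0"
      using less by simp
    have u: "u * (?X k - ?X i) = ?X k - ?X j"
      using pos unfolding u_def by simp
    have "u * ?X i + (1 - u) * ?X k = ?X k - u * (?X k - ?X i)"
      by (simp add: algebra_simps)
    also have "\<dots> = ?X j"
      unfolding u by simp
    finally have "u * ?X i + (1 - u) * ?X k = ?X j" .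
    moreover have "u * ?Y i + (1 - u) * ?Y k = ?Y j"
    proof -
      have "(u * ?Y i + (1 - u) * ?Y k) * (?X k - ?X i) =
          u * (?X k - ?X i) * (?Y i - ?Y k) + ?Y k * (?X k - ?X i)"
        by (simp add: algebra_simps)
      also have "\<dots> = ?Y j * (?X k - ?X i)"
        unfolding u using eq by (simp add: algebra_simps)
      finally show ?thesis
        using pos by simp
    qed
    ultimately have "q j = u *\<^sub>R q i + (1 - u) *\<^sub>R q k"
      by (simp add: prod_eq_iff)
    then have "collinear {q i, q j, q k}"
      unfolding collinear_3_expand by blast
    moreover have "q i \<noteq> q j" "q j \<noteq> q k" "q i \<noteq> q k"
      using less by auto
    ultimately show False
      using gp q_in ijk unfolding general_position_def
      by (meson less_trans)
  qed
qed

context sorted_point_set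
begin

section \<open>Segments as point sets and their combinatorial counterparts\<close>

definition seg :: "edge \<Rightarrow> segment" where
  "seg s = closed_segment (q (fst s)) (q (snd s))"

lemma fst_seg:
  assumes "s \<in> pairs"
  shows "fst ` seg s = {fst (q (fst s))..fst (q (snd s))}"
proof -
  have "fst ` seg s = closed_segment (fst (q (fst s))) (fst (q (snd s)))"
    unfolding seg_def by (rule closed_segment_linear_image[symmetric]) (rule linear_fst)
  then show ?thesis
    using X_less[OF pairsD(1,2)[OF assms]] by (simp add: closed_segment_eq_real_ivl)
qed

text \<open>The projection to the x-axis determines both endpoints, because the x-coordinates are
  distinct.\<close>

lemma inj_seg: "inj_on seg pairs"
proof (rule inj_onI)
  fix s t
  assume st: "s \<in> pairs" "t \<in> pairs" "seg s = seg t"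
  then have "{fst (q (fst s))..fst (q (snd s))} = {fst (q (fst t))..fst (q (snd t))}"
    using fst_seg by metis
  moreover have "fst (q (fst s)) < fst (q (snd s))"
    using X_less[OF pairsD(1,2)[OF st(1)]] .
  ultimately have "fst (q (fst s)) = fst (q (fst t))" "fst (q (snd s)) = fst (q (snd t))"
    by (auto simp: Icc_eq_Icc)
  then have "fst s = fst t" "snd s = snd t"
    using X_less_iff pairsD st(1,2) by (metis less_irrefl linorder_neqE_nat)+
  then show "s = t"
    by (simp add: prod_eq_iff)
qed

text \<open>No segment is vertical, so its relative interior is the graph of \<open>ht\<close> over
  an open interval; disjointness of segments becomes a statement about heights.\<close>

lemma rel_interior_seg:
  assumes "s \<in> pairs"
  shows "rel_interior (seg s) = {z. fst (q (fst s)) < fst z \<and> fst z < fst (q (snd s)) \<and> snd z = ht s (fst z)}"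
proof -
  let ?a = "q (fst s)" and ?b = "q (snd s)"
  have less: "fst ?a < fst ?b"
    using X_less[OF pairsD(1,2)[OF assms]] .
  then have "?a \<noteq> ?b"
    by auto
  then have "rel_interior (seg s) = open_segment ?a ?b"
    by (simp add: seg_def rel_interior_closed_segment)
  moreover have "z \<in> open_segment ?a ?b \<longleftrightarrow>
      fst ?a < fst z \<and> fst z < fst ?b \<and> snd z = ht s (fst z)" for z
  proof
    assume "z \<in> open_segment ?a ?b"
    then obtain u where u: "0 < u" "u < 1" "z = (1 - u) *\<^sub>R ?a + u *\<^sub>R ?b"
      by (auto simp: in_segment)
    have z: "fst z = (1 - u) * fst ?a + u * fst ?b" "snd z = (1 - u) * snd ?a + u * snd ?b"
      using u(3) by simp_all
    have f: "fst z - fst ?a = u * (fst ?b - fst ?a)" "fst ?b - fst z = (1 - u) * (fst ?b - fst ?a)"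
      unfolding z by (simp_all add: algebra_simps)
    have "0 < fst z - fst ?a" "0 < fst ?b - fst z"
      unfolding f using u(1,2) less by simp_all
    moreover have "ht s (fst z) = snd z"
    proof -
      have "u * (fst ?b - fst ?a) * ((snd ?b - snd ?a) / (fst ?b - fst ?a)) = u * (snd ?b - snd ?a)"
        using less by simp
      then show ?thesis
        unfolding ht_def slope_def f(1) z(2) by (simp add: algebra_simps)
    qed
    ultimately show "fst ?a < fst z \<and> fst z < fst ?b \<and> snd z = ht s (fst z)"
      by simp
  next
    assume z: "fst ?a < fst z \<and> fst z < fst ?b \<and> snd z = ht s (fst z)"
    define u where "u = (fst z - fst ?a) / (fst ?b - fst ?a)"
    have u: "0 < u" "u < 1"
      using z by (simp_all add: u_def)
    have "fst z = fst ?a + u * (fst ?b - fst ?a)"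
      using less by (simp add: u_def)
    moreover have "snd z = snd ?a + u * (snd ?b - snd ?a)"
      using z by (simp add: u_def ht_def slope_def)
    ultimately have "z = (1 - u) *\<^sub>R ?a + u *\<^sub>R ?b"
      by (simp add: prod_eq_iff algebra_simps)
    then show "z \<in> open_segment ?a ?b"
      using u \<open>?a \<noteq> ?b\<close> by (auto simp: in_segment)
  qed
  ultimately show ?thesis
    by blast
qed

lemma disjoint_seg_iff:
  assumes "s \<in> pairs" "t \<in> pairs"
  shows "rel_interior (seg s) \<inter> rel_interior (seg t) = {} \<longleftrightarrow> nc s t"
proof -
  have "rel_interior (seg s) \<inter> rel_interior (seg t) = {} \<longleftrightarrow>
    (\<forall>x y. \<not> ((fst (q (fst s)) < x \<and> x < fst (q (snd s)) \<and> y = ht s x) \<and>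
      (fst (q (fst t)) < x \<and> x < fst (q (snd t)) \<and> y = ht t x)))"
    unfolding rel_interior_seg[OF assms(1)] rel_interior_seg[OF assms(2)] disjoint_iff
    by (simp add: split_paired_All) blast
  then show ?thesis
    unfolding nc_iff[OF assms] by auto
qed

lemma segments_eq: "segments P = seg ` pairs"
proof (intro equalityI subsetI)
  fix c
  assume "c \<in> segments P"
  then obtain u v where uv: "u \<in> P" "v \<in> P" "u \<noteq> v" "c = closed_segment u v"
    by (auto simp: segments_def)
  then obtain i j where ij: "i < n" "j < n" "u = q i" "v = q j"
    using bij_q by (auto simp: bij_betw_def)
  then consider "(i, j) \<in> pairs" | "(j, i) \<in> pairs"
    using uv(3) by (cases i j rule: linorder_cases) (auto simp: pairs_iff)
  then show "c \<in> seg ` pairs"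
    using ij uv(4) by cases (auto simp: seg_def closed_segment_commute intro!: rev_image_eqI)
next
  fix c
  assume "c \<in> seg ` pairs"
  then obtain a b where ab: "a < b" "b < n" "c = closed_segment (q a) (q b)"
    by (auto simp: seg_def pairs_def)
  moreover have "q a \<noteq> q b"
    using fst_less[OF ab(1,2)] by auto
  ultimately show "c \<in> segments P"
    unfolding segments_def using q_in less_trans by blast
qed

lemma crossing_free_iff:
  assumes "D \<subseteq> pairs"
  shows "crossing_free (seg ` D) \<longleftrightarrow> (\<forall>s\<in>D. \<forall>t\<in>D. s \<noteq> t \<longrightarrow> nc s t)"
proof -
  have "seg s \<noteq> seg t \<longleftrightarrow> s \<noteq> t" if "s \<in> D" "t \<in> D" for s t
    using inj_seg that assms by (meson inj_onD subsetD)
  moreover have "rel_interior (seg s) \<inter> rel_interior (seg t) = {} \<longleftrightarrow> nc s t" if "s \<in> D" "t \<in> D" for s t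
    using disjoint_seg_iff that assms by blast
  ultimately show ?thesis
    unfolding crossing_free_def by simp
qed

lemma geometric_graph_eq:
  assumes "D \<subseteq> pairs"
  shows "geometric_graph P (seg ` D) = \<lparr>pverts = P, parcs = map_prod q q ` (D \<union> D\<inverse>)\<rparr>"
proof -
  have "(u, v) \<in> map_prod q q ` (D \<union> D\<inverse>)"
    if uv: "u \<in> P" "v \<in> P" "u \<noteq> v" "closed_segment u v \<in> seg ` D" for u v
  proof -
    obtain i j where ij: "i < n" "j < n" "u = q i" "v = q j"
      using uv(1,2) bij_q by (auto simp: bij_betw_def)
    obtain s where s: "s \<in> D" "closed_segment u v = seg s"
      using uv(4) by blast
    consider "i < j" | "j < i"
      using uv(3) ij by (cases i j rule: linorder_cases) auto
    then show ?thesis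
    proof cases
      case 1
      then have "(i, j) \<in> pairs" "seg (i, j) = seg s"
        using ij s by (auto simp: pairs_iff seg_def)
      then have "(i, j) = s"
        using inj_seg s(1) assms by (meson inj_onD subsetD)
      then show ?thesis
        using s(1) ij by force
    next
      case 2
      then have "(j, i) \<in> pairs" "seg (j, i) = seg s"
        using ij s by (auto simp: pairs_iff seg_def closed_segment_commute)
      then have "(j, i) = s"
        using inj_seg s(1) assms by (meson inj_onD subsetD)
      then show ?thesis
        using s(1) ij by force
    qed
  qed
  note into = this
  have from_arc: "q a \<in> P \<and> q b \<in> P \<and> q a \<noteq> q b \<and> closed_segment (q a) (q b) \<in> seg ` D \<and>
      closed_segment (q b) (q a) \<in> seg ` D" if "(a, b) \<in> D" for a b
  proof -
    have "a < b" "b < n"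
      using that assms by (auto simp: pairs_iff)
    moreover have "closed_segment (q a) (q b) \<in> seg ` D"
      using that by (force simp: seg_def)
    ultimately show ?thesis
      using q_in fst_less[of a b] by (auto simp: closed_segment_commute)
  qed
  have "{(u, v). u \<in> P \<and> v \<in> P \<and> u \<noteq> v \<and> closed_segment u v \<in> seg ` D} =
      map_prod q q ` (D \<union> D\<inverse>)"
  proof (intro equalityI subsetI)
    fix e
    assume "e \<in> map_prod q q ` (D \<union> D\<inverse>)"
    then obtain a b where "(a, b) \<in> D" "e = (q a, q b) \<or> e = (q b, q a)"
      by auto
    then show "e \<in> {(u, v). u \<in> P \<and> v \<in> P \<and> u \<noteq> v \<and> closed_segment u v \<in> seg ` D}"
      using from_arc[of a b] by auto
  qed (use into in blast)
  then show ?thesis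
    unfolding geometric_graph_def by simp
qed

lemma arcs_props:
  assumes "D \<subseteq> pairs"
  shows "sym (map_prod q q ` (D \<union> D\<inverse>))" "irrefl (map_prod q q ` (D \<union> D\<inverse>))"
    "map_prod q q ` (D \<union> D\<inverse>) \<subseteq> P \<times> P" "D \<union> D\<inverse> \<subseteq> {..<n} \<times> {..<n}"
proof -
  show sub: "D \<union> D\<inverse> \<subseteq> {..<n} \<times> {..<n}"
    using assms by (auto simp: pairs_def)
  show "sym (map_prod q q ` (D \<union> D\<inverse>))"
    unfolding sym_def by force
  show "map_prod q q ` (D \<union> D\<inverse>) \<subseteq> P \<times> P"
    using sub q_in by auto
  have "q a \<noteq> q b" if "(a, b) \<in> D" for a b
    using fst_less[of a b] that assms by (auto simp: pairs_iff)
  then show "irrefl (map_prod q q ` (D \<union> D\<inverse>))"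
    unfolding irrefl_def by fastforce
qed

lemma rtrancl_arcs_iff:
  assumes "D \<subseteq> pairs" "a < n" "b < n"
  shows "(q a, q b) \<in> (map_prod q q ` (D \<union> D\<inverse>))\<^sup>* \<longleftrightarrow> conn D a b"
  unfolding conn_def using arcs_props(4)[OF assms(1)] assms by (intro rtrancl_inj_image[OF inj_q]) auto

lemma cycle_free_seg_iff:
  assumes D: "D \<subseteq> pairs"
  shows "cycle_free (with_proj (geometric_graph P (seg ` D))) \<longleftrightarrow> acyc D"
proof -
  let ?R = "map_prod q q ` (D \<union> D\<inverse>)"
  have del: "?R - {(q a, q b), (q b, q a)} = map_prod q q ` ((D - {(a, b)}) \<union> (D - {(a, b)})\<inverse>)"
    if "(a, b) \<in> D" for a b
  proof -
    \<comment> \<open>Pairs are increasing, so \<open>D\<close> never contains both orientations,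
      and deleting one pair from \<open>D\<close> deletes exactly the two arcs of the edge.\<close>
    have "a < b" "b < n" "(b, a) \<notin> D"
      using that D pairs_iff by (meson less_asym subsetD)+
    then have sub: "D \<union> D\<inverse> \<subseteq> {..<n} \<times> {..<n}" "(b, a) \<notin> D" "a < n" "b < n"
      using arcs_props(4)[OF D] by auto
    have "inj_on (map_prod q q) ({..<n} \<times> {..<n})"
      by (rule map_prod_inj_on[OF inj_q inj_q])
    then have "map_prod q q ` ((D \<union> D\<inverse>) - {(a, b), (b, a)}) = ?R - map_prod q q ` {(a, b), (b, a)}"
      using sub by (intro inj_on_image_set_diff[of _ "{..<n} \<times> {..<n}"]) auto
    moreover have "(D \<union> D\<inverse>) - {(a, b), (b, a)} = (D - {(a, b)}) \<union> (D - {(a, b)})\<inverse>"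
      using sub(2) that by auto
    ultimately show ?thesis
      by simp
  qed
  have step: "(q a, q b) \<in> (?R - {(q a, q b), (q b, q a)})\<^sup>* \<longleftrightarrow> conn (D - {(a, b)}) a b"
    if "(a, b) \<in> D" for a b
    unfolding del[OF that] using that D by (intro rtrancl_arcs_iff) (auto simp: pairs_iff)
  have sym: "(q b, q a) \<in> (?R - {(q b, q a), (q a, q b)})\<^sup>* \<longleftrightarrow> conn (D - {(a, b)}) a b"
    if "(a, b) \<in> D" for a b
    unfolding insert_commute[of "(q b, q a)"] del[OF that] using that D conn_commute
    by (subst rtrancl_arcs_iff) (auto simp: pairs_iff)
  have "(\<forall>u v. (u, v) \<in> ?R \<longrightarrow> (u, v) \<notin> (?R - {(u, v), (v, u)})\<^sup>*) \<longleftrightarrow> acyc D"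
  proof
    assume L: "\<forall>u v. (u, v) \<in> ?R \<longrightarrow> (u, v) \<notin> (?R - {(u, v), (v, u)})\<^sup>*"
    show "acyc D"
      unfolding acyc_def
    proof (intro allI impI)
      fix a b
      assume ab: "(a, b) \<in> D"
      then have "(q a, q b) \<in> ?R"
        by force
      then show "\<not> conn (D - {(a, b)}) a b"
        using L[rule_format, of "q a" "q b"] step[OF ab] by simp
    qed
  next
    assume A: "acyc D"
    show "\<forall>u v. (u, v) \<in> ?R \<longrightarrow> (u, v) \<notin> (?R - {(u, v), (v, u)})\<^sup>*"
    proof (intro allI impI)
      fix u v
      assume "(u, v) \<in> ?R"
      then obtain e where e: "(u, v) = map_prod q q e" "e \<in> D \<union> D\<inverse>"
        by (rule imageE)
      obtain a b where ab: "e = (a, b)"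
        by (rule prod.exhaust)
      then have uv: "u = q a" "v = q b"
        using e(1) by simp_all
      consider "(a, b) \<in> D" | "(b, a) \<in> D"
        using e(2) ab by auto
      then show "(u, v) \<notin> (?R - {(u, v), (v, u)})\<^sup>*"
      proof cases
        case 1
        then show ?thesis
          using A step[OF 1] unfolding acyc_def uv by simp
      next
        case 2
        then show ?thesis
          using A sym[OF 2] unfolding acyc_def uv by simp
      qed
    qed
  qed
  then show ?thesis
    unfolding geometric_graph_eq[OF D] by (subst cycle_free_iff[OF arcs_props(1-3)[OF D]])
qed

lemma connected_seg_iff:
  assumes D: "D \<subseteq> pairs"
  shows "Digraph_Component.connected (with_proj (geometric_graph P (seg ` D))) \<longleftrightarrow> all_conn D"
proof -
  have P: "P = q ` {..<n}" "P \<noteq> {}"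
    using bij_q n_pos by (auto simp: bij_betw_def)
  show ?thesis
    unfolding geometric_graph_eq[OF D] connected_iff[OF arcs_props(1,3)[OF D]] all_conn_def
    using P(2) rtrancl_arcs_iff[OF D] unfolding P(1) by auto
qed

lemma trees_eq: "crossing_free_spanning_trees P = (`) seg ` {D. tree_set D}"
proof (intro equalityI subsetI)
  fix C
  assume "C \<in> crossing_free_spanning_trees P"
  then have C: "C \<subseteq> seg ` pairs" "crossing_free C" "cycle_free (with_proj (geometric_graph P C))"
    "Digraph_Component.connected (with_proj (geometric_graph P C))"
    by (auto simp: crossing_free_spanning_trees_def segments_eq)
  then obtain D where D: "D \<subseteq> pairs" "C = seg ` D"
    by (metis subset_image_iff)
  then have "tree_set D"
    using C crossing_free_iff cycle_free_seg_iff connected_seg_iff by (simp add: tree_set_def)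
  then show "C \<in> (`) seg ` {D. tree_set D}"
    using D by blast
next
  fix C
  assume "C \<in> (`) seg ` {D. tree_set D}"
  then obtain D where D: "tree_set D" "C = seg ` D"
    by blast
  then have "D \<subseteq> pairs"
    by (simp add: tree_set_def)
  then show "C \<in> crossing_free_spanning_trees P"
    using D crossing_free_iff cycle_free_seg_iff connected_seg_iff
    by (auto simp: tree_set_def crossing_free_spanning_trees_def segments_eq)
qed

lemma bij_accepts:
  "bij_betw (\<lambda>ss. seg ` set ss) {ss. accepts 0 0 ss} (crossing_free_spanning_trees P)"
proof -
  have "inj_on ((`) seg) {D. tree_set D}"
    by (rule inj_on_subset[OF inj_on_image_Pow[OF inj_seg]]) (auto simp: tree_set_def)
  then have "bij_betw ((`) seg) {D. tree_set D} (crossing_free_spanning_trees P)"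
    unfolding trees_eq by (rule inj_on_imp_bij_betw)
  from bij_betw_trans[OF bij_accepts_trees[OF n_pos] this] show ?thesis
    by (simp add: comp_def)
qed

end

section \<open>The combination graph\<close>

text \<open>Mixed-radix numbering with the mark as lowest digit: nested loops over \<open>w\<close>,
  \<open>a\<close>, \<open>b\<close>, \<open>c\<close> meet the indices in increasing order, and the
  end of an inner loop is the next value of the outer one with lower digits 0.\<close>

definition arc_id :: "nat \<Rightarrow> nat \<Rightarrow> nat \<Rightarrow> nat \<Rightarrow> nat \<Rightarrow> nat" where
  "arc_id n w a b c = ((w * n + a) * n + b) * n + c"

lemma pair_less:
  fixes n :: nat
  assumes "w < N" "c < n"
  shows "w * n + c < N * n"
proof -
  have "w * n + c < Suc w * n"
    using assms(2) by simp
  also have "\<dots> \<le> N * n"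
    using assms(1) by (intro mult_right_mono) simp_all
  finally show ?thesis .
qed

lemma pair_eq_iff:
  fixes n :: nat
  assumes "c < n" "c' < n"
  shows "w * n + c = w' * n + c' \<longleftrightarrow> w = w' \<and> c = c'"
proof
  assume eq: "w * n + c = w' * n + c'"
  have "(w * n + c) div n = w" "(w' * n + c') div n = w'"
    using assms by simp_all
  then show "w = w' \<and> c = c'"
    using eq by simp
qed simp

lemma arc_id_less: "w < N \<Longrightarrow> a < n \<Longrightarrow> b < n \<Longrightarrow> c < n \<Longrightarrow> arc_id n w a b c < N * n * n * n"
  unfolding arc_id_def by (intro pair_less)

lemma arc_id_cases:
  assumes "e < N * n * n * n"
  obtains w a b c where "w < N" "a < n" "b < n" "c < n" "e = arc_id n w a b c"
proof -
  have "0 < n"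
    using assms by (cases n) auto
  have less: "x div n < m" if "x < m * n" for x m
    using that by (simp add: less_mult_imp_div_less)
  have "e = arc_id n (e div n div n div n) (e div n div n mod n) (e div n mod n) (e mod n)"
    by (simp add: arc_id_def)
  moreover have "e div n div n div n < N"
    using assms by (intro less)
  ultimately show thesis
    using \<open>0 < n\<close> by (intro that) simp_all
qed

text \<open>A vertex \<open>w * n + c\<close> is a word with a mark, and \<open>6 ^ n * n\<close> is the sink. Every index
  \<open>arc_id n w a b c\<close> denotes an arc: since segments need \<open>a < b\<close>, the arcs into the sink use
  \<open>a = b = 0\<close>, and all indices without a transition become parallel arcs into the sink from a
  vertex \<open>6 ^ n * n + 1\<close> that no path from the source reaches.\<close>

locale output_graph_spec = sorted_point_set +
  fixes p :: "nat \<Rightarrow> point" and tl hd lf rg :: "nat \<Rightarrow> nat"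
  assumes valid_arc: "\<And>w a b c e. w < 6 ^ n \<Longrightarrow> a < n \<Longrightarrow> b < n \<Longrightarrow> c < n \<Longrightarrow> e = arc_id n w a b c \<Longrightarrow>
      valid w a b \<and> c < b \<Longrightarrow>
      tl e = w * n + c \<and> hd e = succ w a b * n + a \<and> p (lf e) = q a \<and> p (rg e) = q b"
    and other_arc: "\<And>w a b c e. w < 6 ^ n \<Longrightarrow> a < n \<Longrightarrow> b < n \<Longrightarrow> c < n \<Longrightarrow> e = arc_id n w a b c \<Longrightarrow>
      \<not> (valid w a b \<and> c < b) \<Longrightarrow>
      tl e = (if a = 0 \<and> b = 0 \<and> final w then w * n + c else 6 ^ n * n + 1) \<and> hd e = 6 ^ n * n"
begin

definition G :: "(nat, nat) pre_digraph" where
  "G = \<lparr>verts = {..<6 ^ n * n + 2}, arcs = {..<6 ^ n * n * n * n}, tail = tl, head = hd\<rparr>"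

definition \<Gamma> :: "(nat, nat) comb_graph" where
  "\<Gamma> = \<lparr>dgraph = G, source = 0, sink = 6 ^ n * n,
     label = (\<lambda>e. if hd e = 6 ^ n * n then None else Some (closed_segment (p (lf e)) (p (rg e))))\<rparr>"

lemma G_simps [simp]: "verts G = {..<6 ^ n * n + 2}" "arcs G = {..<6 ^ n * n * n * n}"
  "tail G = tl" "head G = hd"
  by (simp_all add: G_def)

lemma valid_less: "valid w a b \<Longrightarrow> a < b"
  by (simp add: valid_def step_ok_def)

lemma arc_cases:
  assumes "e \<in> arcs G"
  obtains (step) w a b c where "w < 6 ^ n" "a < n" "b < n" "c < n" "e = arc_id n w a b c"
      "valid w a b" "c < b" "tl e = w * n + c" "hd e = succ w a b * n + a" "p (lf e) = q a" "p (rg e) = q b"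
  | (final) w c where "w < 6 ^ n" "c < n" "e = arc_id n w 0 0 c" "final w" "tl e = w * n + c" "hd e = 6 ^ n * n"
  | (idle) "tl e = 6 ^ n * n + 1" "hd e = 6 ^ n * n"
proof -
  obtain w a b c where e: "w < 6 ^ n" "a < n" "b < n" "c < n" "e = arc_id n w a b c"
    using assms by (auto elim: arc_id_cases)
  consider "valid w a b \<and> c < b" | "\<not> (valid w a b \<and> c < b)" "a = 0 \<and> b = 0 \<and> final w"
    | "\<not> (valid w a b \<and> c < b)" "\<not> (a = 0 \<and> b = 0 \<and> final w)"
    by blast
  then show thesis
  proof cases
    case 1
    then show ?thesis
      using e valid_arc[OF e] by (intro step) simp_all
  next
    case 2
    then show ?thesis
      using e other_arc[OF e 2(1)] by (intro final) simp_all
  next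
    case 3
    then show ?thesis
      using other_arc[OF e 3(1)] by (intro idle) (simp_all only: if_False)
  qed
qed

text \<open>A topological rank: the idle vertex is lowest, and words stay below the sink because the
  potential is at most \<open>n\<close>.\<close>

definition rank :: "nat \<Rightarrow> nat" where
  "rank v = (if v < 6 ^ n * n then Suc (pot n (digit (v div n))) else if v = 6 ^ n * n then n + 2 else 0)"

lemma rank_state: "w < 6 ^ n \<Longrightarrow> c < n \<Longrightarrow> rank (w * n + c) = Suc (pot n (digit w))"
  by (simp add: rank_def pair_less)

lemma arc_increases:
  assumes "e \<in> arcs G"
  shows "rank (tl e) < rank (hd e)"
  using assms
proof (cases rule: arc_cases)
  case (step w a b c)
  then show ?thesis
    using rank_state[of w c] rank_state[OF succ_less[of w a b], of a] pot_succ[of w a b] by simp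
next
  case (final w c)
  have "pot n (digit w) \<le> n"
    using pot_compl[of n "digit w"] by linarith
  then show ?thesis
    using final rank_state[of w c] by (simp add: rank_def)
next
  case idle
  then show ?thesis
    by (simp add: rank_def)
qed

lemma arc_ends:
  assumes "e \<in> arcs G"
  shows "tl e \<in> verts G" "hd e \<in> verts G" "tl e \<noteq> 6 ^ n * n"
proof -
  have less: "w * n + c < 6 ^ n * n" if "w < 6 ^ n" "c < n" for w c
    using that by (rule pair_less)
  have "tl e < 6 ^ n * n + 2 \<and> hd e < 6 ^ n * n + 2 \<and> tl e \<noteq> 6 ^ n * n"
    using assms
  proof (cases rule: arc_cases)
    case (step w a b c)
    then show ?thesis
      using less[of w c] less[OF succ_less[of w a b], of a] by simp
  next
    case (final w c)
    then show ?thesis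
      using less[of w c] by simp
  qed simp
  then show "tl e \<in> verts G" "hd e \<in> verts G" "tl e \<noteq> 6 ^ n * n"
    by simp_all
qed

interpretation fin_digraph G
  by unfold_locales (use arc_ends in auto)

lemma cas_increasing:
  "cas u es v \<Longrightarrow> set es \<subseteq> arcs G \<Longrightarrow> sorted_wrt (\<lambda>x y. rank x < rank y) (awalk_verts u es)"
proof (induction es arbitrary: u)
  case (Cons e es)
  then have srt: "sorted_wrt (\<lambda>x y. rank x < rank y) (awalk_verts (hd e) es)"
    and "e \<in> arcs G" and cas: "cas (hd e) es v"
    by auto
  obtain ys where ys: "awalk_verts (hd e) es = hd e # ys"
    using cas by (cases es) auto
  have "rank (tl e) < rank y" if "y \<in> set (awalk_verts (hd e) es)" for y
    using that srt arc_increases[OF \<open>e \<in> arcs G\<close>] unfolding ys by auto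
  then show ?case
    using srt by simp
qed simp

text \<open>Ranks rise along every walk, so walks from source to sink are automatically
  simple.\<close>

lemma cas_distinct: "cas u es v \<Longrightarrow> set es \<subseteq> arcs G \<Longrightarrow> distinct (awalk_verts u es)"
proof -
  have "distinct xs" if "sorted_wrt (\<lambda>x y. rank x < rank y) xs" for xs
    using that by (induction xs) auto
  then show "cas u es v \<Longrightarrow> set es \<subseteq> arcs G \<Longrightarrow> distinct (awalk_verts u es)"
    using cas_increasing by blast
qed

lemma no_cycle: "\<not> cycle es"
proof
  assume "cycle es"
  then obtain u where u: "awalk u es u" "es \<noteq> []"
    by (auto simp: cycle_def)
  then obtain e fs where es: "es = e # fs"
    by (cases es) auto
  have cas: "cas u es u" "set es \<subseteq> arcs G"
    using u(1) by (auto simp: awalk_def)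
  have "tl e \<notin> set (awalk_verts (hd e) fs)"
    using cas_distinct[OF cas] by (simp add: es)
  moreover have "tl e = u" "cas (hd e) fs u"
    using cas(1) by (simp_all add: es)
  moreover have "u \<in> set (awalk_verts (hd e) fs)"
    using last_in_set[OF awalk_verts_non_Nil, of "hd e" fs] awlast_if_cas[OF calculation(3)] by simp
  ultimately show False
    by simp
qed

primrec arcs_of :: "nat \<Rightarrow> nat \<Rightarrow> edge list \<Rightarrow> nat list" where
  "arcs_of w c [] = [arc_id n w 0 0 c]"
| "arcs_of w c (s # ss) = arc_id n w (fst s) (snd s) c # arcs_of (succ w (fst s) (snd s)) (fst s) ss"

lemma state_not_sink: "w < 6 ^ n \<Longrightarrow> c < n \<Longrightarrow> w * n + c < 6 ^ n * n"
  by (rule pair_less)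

text \<open>Transition arcs lead to states again, idle arcs start outside the states, and nothing
  leaves the sink; so a walk from a state consists of transitions and one final arc.\<close>

lemma cas_accepts:
  assumes "w < 6 ^ n" "c < n" "cas (w * n + c) es (6 ^ n * n)" "set es \<subseteq> arcs G"
  shows "\<exists>ss. accepts w c ss \<and> es = arcs_of w c ss"
  using assms
proof (induction es arbitrary: w c)
  case Nil
  then show ?case
    using state_not_sink[of w c] by simp
next
  case (Cons e es)
  have e: "e \<in> arcs G" "tl e = w * n + c" and es: "cas (hd e) es (6 ^ n * n)" "set es \<subseteq> arcs G"
    using Cons.prems by auto
  show ?case
    using e(1)
  proof (cases rule: arc_cases)
    case (step w' a b c')
    then have "w' = w" "c' = c"
      using e(2) Cons.prems pair_eq_iff[of c' n c w' w] by auto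
    moreover obtain ss where "accepts (succ w a b) a ss" "es = arcs_of (succ w a b) a ss"
      using Cons.IH[OF succ_less[of w a b] step(2)] es step calculation by auto
    ultimately have "accepts w c ((a, b) # ss) \<and> e # es = arcs_of w c ((a, b) # ss)"
      using step by simp
    then show ?thesis
      by blast
  next
    case (final w' c')
    then have "w' = w" "c' = c"
      using e(2) Cons.prems pair_eq_iff[of c' n c w' w] by auto
    moreover have "es = []"
      using es final(6) arc_ends(3) by (cases es) auto
    ultimately have "accepts w c [] \<and> e # es = arcs_of w c []"
      using final by simp
    then show ?thesis
      by blast
  next
    case idle
    then show ?thesis
      using e(2) state_not_sink[OF Cons.prems(1,2)] by simp
  qed
qed

lemma accepts_cas:
  assumes "w < 6 ^ n" "c < n" "accepts w c ss"
  shows "cas (w * n + c) (arcs_of w c ss) (6 ^ n * n) \<and> set (arcs_of w c ss) \<subseteq> arcs G \<and>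
    {l. \<exists>e\<in>set (arcs_of w c ss). label \<Gamma> e = Some l} = seg ` set ss"
  using assms
proof (induction ss arbitrary: w c)
  case Nil
  \<comment> \<open>Index \<open>a = b = 0\<close> is free for the arc into the sink, as no mark is
    below 0.\<close>
  have "\<not> (valid w 0 0 \<and> c < 0)"
    by simp
  then have "tl (arc_id n w 0 0 c) = w * n + c" "hd (arc_id n w 0 0 c) = 6 ^ n * n"
    using other_arc[of w 0 0 c] Nil n_pos by auto
  moreover have "arc_id n w 0 0 c \<in> arcs G"
    using arc_id_less[of w "6 ^ n" 0 n 0 c] Nil n_pos by simp
  ultimately show ?case
    by (simp add: \<Gamma>_def)
next
  case (Cons s ss)
  let ?a = "fst s" and ?b = "snd s"
  let ?e = "arc_id n w ?a ?b c"
  have acc: "?a < n" "?b < n" "valid w ?a ?b" "c < ?b" "accepts (succ w ?a ?b) ?a ss"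
    using Cons.prems(3) by simp_all
  have e: "tl ?e = w * n + c" "hd ?e = succ w ?a ?b * n + ?a" "p (lf ?e) = q ?a" "p (rg ?e) = q ?b"
    using valid_arc[of w ?a ?b c] Cons.prems acc by simp_all
  have "?e \<in> arcs G"
    using arc_id_less[of w "6 ^ n" ?a n ?b c] Cons.prems acc by simp
  moreover have "label \<Gamma> ?e = Some (seg s)"
    using e state_not_sink[OF succ_less acc(1), of w ?a ?b] by (simp add: \<Gamma>_def seg_def)
  moreover have "{l. \<exists>x\<in>set (arcs_of w c (s # ss)). label \<Gamma> x = Some l} =
      insert (seg s) {l. \<exists>x\<in>set (arcs_of (succ w ?a ?b) ?a ss). label \<Gamma> x = Some l}"
    using calculation(2) by auto
  moreover note ih = Cons.IH[OF succ_less acc(1,5)]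
  have "{l. \<exists>x\<in>set (arcs_of w c (s # ss)). label \<Gamma> x = Some l} = seg ` set (s # ss)"
    unfolding calculation(3) conjunct2[OF conjunct2[OF ih]] by simp
  moreover have "cas (w * n + c) (arcs_of w c (s # ss)) (6 ^ n * n)"
    using conjunct1[OF ih] e(1,2) unfolding arcs_of.simps cas.simps G_simps by (simp only:)
  moreover have "set (arcs_of w c (s # ss)) \<subseteq> arcs G"
    using conjunct1[OF conjunct2[OF ih]] calculation(1) unfolding arcs_of.simps by simp
  ultimately show ?case
    by blast
qed

lemma combination_graph_\<Gamma>: "combination_graph P \<Gamma>"
proof -
  have "fin_digraph G"
    by unfold_locales
  moreover have "out_arcs G (6 ^ n * n) = {}"
    using arc_ends(3) by (auto simp: out_arcs_def)
  moreover have "closed_segment (p (lf e)) (p (rg e)) \<in> segments P"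
    if "e \<in> arcs G" "hd e \<noteq> 6 ^ n * n" for e
    using that(1)
  proof (cases rule: arc_cases)
    case (step w a b c)
    then have "seg (a, b) \<in> segments P"
      using valid_less[of w a b] by (simp add: segments_eq pairs_iff)
    then show ?thesis
      using step by (simp add: seg_def)
  qed (use that(2) in simp_all)
  ultimately show ?thesis
    using no_cycle n_pos unfolding combination_graph_def by (simp add: \<Gamma>_def)
qed

lemma represents_\<Gamma>: "represents \<Gamma> (crossing_free_spanning_trees P)"
proof -
  have "awalk u es v \<longleftrightarrow> u \<in> verts G \<and> set es \<subseteq> arcs G \<and> cas u es v" for u es v
    by (simp only: awalk_def)
  then have "apath 0 es (6 ^ n * n) \<longleftrightarrow> set es \<subseteq> arcs G \<and> cas 0 es (6 ^ n * n)" for es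
    using cas_distinct unfolding apath_def by auto
  then have paths: "source_sink_paths \<Gamma> = arcs_of 0 0 ` {ss. accepts 0 0 ss}"
    unfolding source_sink_paths_def
    using cas_accepts[of 0 0] accepts_cas[of 0 0] n_pos by (auto simp: \<Gamma>_def image_iff)
  have lab: "path_combination \<Gamma> (arcs_of 0 0 ss) = seg ` set ss" if "accepts 0 0 ss" for ss
    using accepts_cas[of 0 0 ss] that n_pos by (simp add: path_combination_def)
  have bij: "bij_betw (\<lambda>ss. path_combination \<Gamma> (arcs_of 0 0 ss)) {ss. accepts 0 0 ss} (crossing_free_spanning_trees P)"
    using bij_accepts by (subst bij_betw_cong[of _ _ "\<lambda>ss. seg ` set ss"]) (simp_all add: lab)
  \<comment> \<open>Injectivity of \<open>arcs_of\<close> is inherited from the composition, so arc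
    indices need not be decoded.\<close>
  then have "inj_on (path_combination \<Gamma> \<circ> arcs_of 0 0) {ss. accepts 0 0 ss}"
    by (simp add: bij_betw_def comp_def)
  then have "inj_on (arcs_of 0 0) {ss. accepts 0 0 ss}"
    by (rule inj_on_imageI2)
  from bij_betw_comp_iff[OF inj_on_imp_bij_betw[OF this], of "path_combination \<Gamma>"] bij
  show ?thesis
    unfolding represents_def paths by (simp add: comp_def)
qed

lemma graph_size_\<Gamma>: "graph_size \<Gamma> \<le> 4 * (6 ^ n * n ^ 3)"
proof -
  define N where "N = 6 ^ n * n ^ 3"
  have "n \<le> n ^ 3"
    using n_pos by (simp add: self_le_power)
  then have "6 ^ n * n \<le> N"
    unfolding N_def by simp
  moreover have "1 \<le> N"
    using n_pos unfolding N_def by simp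
  moreover have "graph_size \<Gamma> = 6 ^ n * n + 2 + N"
    by (simp add: graph_size_def \<Gamma>_def N_def power3_eq_cube)
  ultimately show ?thesis
    unfolding N_def[symmetric] by linarith
qed

end

section \<open>Timed Hoare logic\<close>

lemma nmem_nupdate [simp]:
  "nmem (nupdate a i v \<sigma>) b = (if b = a then (nmem \<sigma> a)(i := v) else nmem \<sigma> b)"
  by (simp add: nupdate_def)

lemma rmem_nupdate [simp]: "rmem (nupdate a i v \<sigma>) = rmem \<sigma>"
  by (simp add: nupdate_def)

text \<open>Only word arrays are listed: \<open>keeps\<close> demands unchanged real memory
  outright, and the programs below store no reals.\<close>

primrec writes :: "com \<Rightarrow> string set" where
  "writes Skip = {}"
| "writes (NStore a i e) = {a}"
| "writes (RStore a i e) = {}"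
| "writes (Seq c d) = writes c \<union> writes d"
| "writes (Ite b c d) = writes c \<union> writes d"
| "writes (While b c) = writes c"

definition keeps :: "string set \<Rightarrow> state \<Rightarrow> state \<Rightarrow> bool" where
  "keeps A \<sigma> \<tau> \<longleftrightarrow> rmem \<tau> = rmem \<sigma> \<and> (\<forall>a. a \<notin> A \<longrightarrow> nmem \<tau> a = nmem \<sigma> a)"

lemma keepsD: "keeps A \<sigma> \<tau> \<Longrightarrow> rmem \<tau> = rmem \<sigma>" "keeps A \<sigma> \<tau> \<Longrightarrow> a \<notin> A \<Longrightarrow> nmem \<tau> a = nmem \<sigma> a"
  by (simp_all add: keeps_def)

lemma keeps_refl: "keeps A \<sigma> \<sigma>"
  by (simp add: keeps_def)

lemma keeps_trans: "keeps A \<sigma> \<rho> \<Longrightarrow> keeps B \<rho> \<tau> \<Longrightarrow> A \<subseteq> C \<Longrightarrow> B \<subseteq> C \<Longrightarrow> keeps C \<sigma> \<tau>"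
  unfolding keeps_def by (metis subsetD)

lemma keeps_mono: "keeps A \<sigma> \<tau> \<Longrightarrow> A \<subseteq> C \<Longrightarrow> keeps C \<sigma> \<tau>"
  unfolding keeps_def by blast

lemma keeps_nupdate: "a \<in> A \<Longrightarrow> keeps A \<sigma> (nupdate a i v \<sigma>)"
  by (auto simp: keeps_def)

text \<open>The frame condition is built into the judgement, so specifications need not list
  variables that a program leaves alone.\<close>

definition runs :: "nat \<Rightarrow> com \<Rightarrow> state \<Rightarrow> nat \<Rightarrow> (state \<Rightarrow> bool) \<Rightarrow> bool" where
  "runs B c \<sigma> T Q \<longleftrightarrow> (\<exists>t \<tau>. exec B c \<sigma> t \<tau> \<and> t \<le> T \<and> keeps (writes c) \<sigma> \<tau> \<and> Q \<tau>)"

lemma runs_weaken: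
  assumes "runs B c \<sigma> T P" "T \<le> U" "\<And>\<tau>. keeps (writes c) \<sigma> \<tau> \<Longrightarrow> P \<tau> \<Longrightarrow> Q \<tau>"
  shows "runs B c \<sigma> U Q"
  using assms unfolding runs_def by (meson le_trans)

lemma runs_Skip: "Q \<sigma> \<Longrightarrow> runs B Skip \<sigma> 1 Q"
  unfolding runs_def using exec.Skip keeps_refl by blast

lemma runs_NStore:
  assumes "nval i \<sigma> < B" "nval e \<sigma> < B" "Q (nupdate a (nval i \<sigma>) (nval e \<sigma>) \<sigma>)"
  shows "runs B (NStore a i e) \<sigma> 1 Q"
  unfolding runs_def using exec.NStore[OF assms(1,2)] assms(3) keeps_nupdate[of a "{a}"] by fastforce

lemma runs_Seq:
  assumes "runs B c \<sigma> T P" "\<And>\<tau>. keeps (writes c) \<sigma> \<tau> \<Longrightarrow> P \<tau> \<Longrightarrow> runs B d \<tau> U Q"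
  shows "runs B (Seq c d) \<sigma> (T + U) Q"
proof -
  obtain t \<rho> where c: "exec B c \<sigma> t \<rho>" "t \<le> T" "keeps (writes c) \<sigma> \<rho>" "P \<rho>"
    using assms(1) unfolding runs_def by blast
  then obtain u \<tau> where d: "exec B d \<rho> u \<tau>" "u \<le> U" "keeps (writes d) \<rho> \<tau>" "Q \<tau>"
    using assms(2) unfolding runs_def by blast
  have "keeps (writes (Seq c d)) \<sigma> \<tau>"
    using c(3) d(3) by (rule keeps_trans) auto
  then show ?thesis
    unfolding runs_def using exec.Seq[OF c(1) d(1)] c d add_mono by blast
qed

lemma runs_NStore_Seq:
  assumes "nval i \<sigma> < B" "nval e \<sigma> < B" "runs B c (nupdate a (nval i \<sigma>) (nval e \<sigma>) \<sigma>) T Q"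
  shows "runs B (Seq (NStore a i e) c) \<sigma> (1 + T) Q"
  by (rule runs_Seq[OF runs_NStore[OF assms(1,2), of "\<lambda>\<tau>. \<tau> = nupdate a (nval i \<sigma>) (nval e \<sigma>) \<sigma>"]])
    (use assms(3) in auto)

lemma runs_Ite:
  assumes "bval b \<sigma> \<Longrightarrow> runs B c \<sigma> T Q" "\<not> bval b \<sigma> \<Longrightarrow> runs B d \<sigma> U Q"
  shows "runs B (Ite b c d) \<sigma> (1 + max T U) Q"
proof (cases "bval b \<sigma>")
  case True
  then obtain t \<tau> where c: "exec B c \<sigma> t \<tau>" "t \<le> T" "keeps (writes c) \<sigma> \<tau>" "Q \<tau>"
    using assms(1) unfolding runs_def by blast
  then have "keeps (writes (Ite b c d)) \<sigma> \<tau>"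
    by (auto elim: keeps_mono)
  then show ?thesis
    unfolding runs_def using exec.IteTrue[OF True c(1)] c
    by (meson add_left_mono le_trans max.cobounded1)
next
  case False
  then obtain t \<tau> where c: "exec B d \<sigma> t \<tau>" "t \<le> U" "keeps (writes d) \<sigma> \<tau>" "Q \<tau>"
    using assms(2) unfolding runs_def by blast
  then have "keeps (writes (Ite b c d)) \<sigma> \<tau>"
    by (auto elim: keeps_mono)
  then show ?thesis
    unfolding runs_def using exec.IteFalse[OF False c(1)] c
    by (meson add_left_mono le_trans max.cobounded2)
qed

abbreviation V :: "string \<Rightarrow> nexp" where "V a \<equiv> NCell a (NConst 0)"
abbreviation Assign :: "string \<Rightarrow> nexp \<Rightarrow> com" where "Assign a e \<equiv> NStore a (NConst 0) e"
abbreviation Semi :: "com \<Rightarrow> com \<Rightarrow> com" (infixr ";;" 60) where "c ;; d \<equiv> Seq c d"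

definition For :: "string \<Rightarrow> string \<Rightarrow> com \<Rightarrow> com" where
  "For v m c = Assign v (NConst 0) ;;
     While (NLess (V v) (V m)) (c ;; Assign v (NAdd (V v) (NConst 1)))"

lemma writes_For [simp]: "writes (For v m c) = insert v (writes c)"
  by (auto simp: For_def)

text \<open>Each round adds a test and an increment to the cost \<open>T\<close> of the body; the
  initial assignment and the failing test give the final 2. The invariant is asserted after the
  counter update because the counter is an ordinary variable.\<close>

lemma runs_For:
  assumes fresh: "v \<notin> writes c" "m \<notin> writes c" "m \<noteq> v" and N: "nmem \<sigma> m 0 = N" "N < B"
    and base: "I 0 (nupdate v 0 0 \<sigma>)"
    and step: "\<And>i \<tau>. i < N \<Longrightarrow> keeps (insert v (writes c)) \<sigma> \<tau> \<Longrightarrow> nmem \<tau> v 0 = i \<Longrightarrow> I i \<tau> \<Longrightarrow>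
      runs B c \<tau> T (\<lambda>\<tau>'. I (Suc i) (nupdate v 0 (Suc i) \<tau>'))"
  shows "runs B (For v m c) \<sigma> (N * (T + 2) + 2) (I N)"
proof -
  let ?W = "insert v (writes c)"
  let ?loop = "While (NLess (V v) (V m)) (c ;; Assign v (NAdd (V v) (NConst 1)))"
  have loop: "\<exists>t \<rho>. exec B ?loop \<tau> t \<rho> \<and> t \<le> (N - i) * (T + 2) + 1 \<and> keeps ?W \<sigma> \<rho> \<and> I N \<rho>"
    if "i \<le> N" "keeps ?W \<sigma> \<tau>" "nmem \<tau> v 0 = i" "I i \<tau>" for i \<tau>
    using that
  proof (induction "N - i" arbitrary: i \<tau>)
    case 0
    have "nmem \<tau> m 0 = N"
      using 0 fresh N keepsD(2)[of ?W \<sigma> \<tau> m] by simp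
    then have "exec B ?loop \<tau> 1 \<tau>"
      using 0 by (intro exec.WhileFalse) simp
    then show ?case
      using 0 by (metis diff_is_0_eq' le_antisym le_add2 le_numeral_extra(4) add_diff_cancel_left' diff_self_eq_0 le_add_diff_inverse mult_0 add_0)
  next
    case (Suc x)
    have m: "nmem \<tau> m 0 = N" and "i < N"
      using Suc fresh N keepsD(2)[of ?W \<sigma> \<tau> m] by simp_all
    obtain t \<rho> where c: "exec B c \<tau> t \<rho>" "t \<le> T" "keeps (writes c) \<tau> \<rho>"
      "I (Suc i) (nupdate v 0 (Suc i) \<rho>)"
      using step[OF \<open>i < N\<close> Suc.prems(2-4)] unfolding runs_def by blast
    have vi: "nmem \<rho> v 0 = i"
      using c(3) fresh Suc.prems(3) by (simp add: keepsD(2))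
    have "exec B (Assign v (NAdd (V v) (NConst 1))) \<rho> 1 (nupdate v 0 (Suc i) \<rho>)"
      using exec.NStore[of "NConst 0" \<rho> B "NAdd (V v) (NConst 1)" v] vi \<open>i < N\<close> N by simp
    then have body: "exec B (c ;; Assign v (NAdd (V v) (NConst 1))) \<tau> (t + 1) (nupdate v 0 (Suc i) \<rho>)"
      using c(1) by (rule exec.Seq[rotated])
    have "keeps ?W \<sigma> \<rho>"
      using Suc.prems(2) c(3) by (rule keeps_trans) auto
    then have "keeps ?W \<sigma> (nupdate v 0 (Suc i) \<rho>)"
      by (rule keeps_trans[OF _ keeps_nupdate[of v ?W]]) auto
    moreover have "x = N - Suc i" "Suc i \<le> N"
      using Suc.hyps(2) \<open>i < N\<close> by simp_all
    ultimately obtain u \<rho>' where u: "exec B ?loop (nupdate v 0 (Suc i) \<rho>) u \<rho>'"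
      "u \<le> (N - Suc i) * (T + 2) + 1" "keeps ?W \<sigma> \<rho>'" "I N \<rho>'"
      using Suc.hyps(1)[of "Suc i" "nupdate v 0 (Suc i) \<rho>"] c(4) by auto
    have "exec B ?loop \<tau> (1 + (t + 1) + u) \<rho>'"
      using Suc.prems(3) m \<open>i < N\<close> by (intro exec.WhileTrue[OF _ body u(1)]) simp
    moreover have "1 + (t + 1) + u \<le> (N - i) * (T + 2) + 1"
    proof -
      have "N - i = Suc (N - Suc i)"
        using \<open>i < N\<close> by simp
      then show ?thesis
        using c(2) u(2) by simp
    qed
    ultimately show ?case
      using u(3,4) by blast
  qed
  have init: "exec B (Assign v (NConst 0)) \<sigma> 1 (nupdate v 0 0 \<sigma>)"
    using exec.NStore[of "NConst 0" \<sigma> B "NConst 0" v] N by simp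
  have "keeps ?W \<sigma> (nupdate v 0 0 \<sigma>)"
    by (rule keeps_nupdate) simp
  then obtain t \<rho> where t: "exec B ?loop (nupdate v 0 0 \<sigma>) t \<rho>" "t \<le> N * (T + 2) + 1"
    "keeps ?W \<sigma> \<rho>" "I N \<rho>"
    using loop[of 0 "nupdate v 0 0 \<sigma>"] base by auto
  have "exec B (For v m c) \<sigma> (1 + t) \<rho>"
    unfolding For_def using init t(1) by (rule exec.Seq)
  then show ?thesis
    unfolding runs_def using t by (intro exI[of _ "1 + t"] exI[of _ \<rho>]) simp
qed

section \<open>The program\<close>

lemma runs_Store_Seq:
  assumes "nval i \<sigma> = j" "nval e \<sigma> = v" "j < B" "v < B" "runs B c (nupdate a j v \<sigma>) T Q"
  shows "runs B (Seq (NStore a i e) c) \<sigma> (1 + T) Q"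
  using runs_NStore_Seq[of i \<sigma> B e c a T Q] assms by simp

lemma card_less_Suc_if:
  "card {j. j < Suc i \<and> P j} = card {j. j < i \<and> P j} + of_bool (P i)"
proof -
  have "{j. j < Suc i \<and> P j} = (if P i then insert i {j. j < i \<and> P j} else {j. j < i \<and> P j})"
    by (auto simp: less_Suc_eq)
  then show ?thesis
    by simp
qed

lemma card_less_le: "card {j. j < i \<and> P j} \<le> (i::nat)"
  using card_mono[of "{..<i}" "{j. j < i \<and> P j}"] by auto

abbreviation C :: "nat \<Rightarrow> nexp" where "C \<equiv> NConst"
abbreviation At :: "string \<Rightarrow> string \<Rightarrow> nexp" where "At a i \<equiv> NCell a (V i)"
abbreviation Inc :: "string \<Rightarrow> com" where "Inc a \<equiv> Assign a (NAdd (V a) (C 1))"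

text \<open>Sorting by counting smaller x-coordinates; its quadratic time is negligible.
  \<open>''ord''\<close> becomes the inverse of the rank permutation.\<close>

definition rank_prog :: com where
  "rank_prog = For ''i'' ''n'' (Assign ''r'' (C 0) ;;
     For ''j'' ''n'' (Ite (RLess (RCell ''x'' (V ''j'')) (RCell ''x'' (V ''i''))) (Inc ''r'') Skip) ;;
     NStore ''ord'' (V ''r'') (V ''i''))"

lemma runs_rank:
  fixes x :: "nat \<Rightarrow> real" and n :: nat
  defines "rk \<equiv> \<lambda>i. card {j. j < n \<and> x j < x i}"
  assumes n: "nmem \<sigma> ''n'' 0 = n" "n < B" and x: "\<And>i. rmem \<sigma> ''x'' i = x i" and inj: "inj_on rk {..<n}"
  shows "runs B rank_prog \<sigma> (n * (1 + ((n * (1 + max 1 1 + 2) + 2) + 1) + 2) + 2)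
    (\<lambda>\<tau>. \<forall>i<n. nmem \<tau> ''ord'' (rk i) = i)"
  unfolding rank_prog_def
proof (rule runs_For[where I = "\<lambda>i \<tau>. \<forall>k<i. nmem \<tau> ''ord'' (rk k) = k"])
  let ?cmp = "Ite (RLess (RCell ''x'' (V ''j'')) (RCell ''x'' (V ''i''))) (Inc ''r'') Skip"
  let ?count = "For ''j'' ''n'' ?cmp"
  fix i \<tau>
  assume i: "i < n" "nmem \<tau> ''i'' 0 = i" "\<forall>k<i. nmem \<tau> ''ord'' (rk k) = k"
    and keep: "keeps (insert ''i'' (writes (Assign ''r'' (C 0) ;;
      ?count ;;
      NStore ''ord'' (V ''r'') (V ''i'')))) \<sigma> \<tau>"
  have fr: "nmem \<tau> ''n'' 0 = n" "rmem \<tau> = rmem \<sigma>"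
    using keepsD(2)[OF keep, of "''n''"] keepsD(1)[OF keep] n by simp_all
  let ?\<rho> = "nupdate ''r'' 0 0 \<tau>"
  have inner: "runs B ?count
      ?\<rho> (n * (1 + max 1 1 + 2) + 2) (\<lambda>\<tau>. nmem \<tau> ''r'' 0 = card {k. k < n \<and> x k < x i})"
  proof (rule runs_For[where I = "\<lambda>j \<tau>. nmem \<tau> ''r'' 0 = card {k. k < j \<and> x k < x i}"])
    fix j \<rho>
    assume j: "j < n" "nmem \<rho> ''j'' 0 = j" "nmem \<rho> ''r'' 0 = card {k. k < j \<and> x k < x i}"
      and keep': "keeps (insert ''j'' (writes ?cmp)) ?\<rho> \<rho>"
    have "nmem \<rho> ''i'' 0 = i" "rmem \<rho> = rmem \<sigma>"
      using keepsD(2)[OF keep', of "''i''"] keepsD(1)[OF keep'] fr i by simp_all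
    moreover have "card {k. k < j \<and> x k < x i} \<le> j"
      by (rule card_less_le)
    ultimately show "runs B ?cmp \<rho>
        (1 + max 1 1) (\<lambda>\<tau>. nmem (nupdate ''j'' 0 (Suc j) \<tau>) ''r'' 0 = card {k. k < Suc j \<and> x k < x i})"
      using j x n(2) by (intro runs_Ite runs_NStore runs_Skip) (simp_all add: card_less_Suc_if)
  qed (use fr n(2) in simp_all)
  have "card {k. k < n \<and> x k < x i} < B"
    using card_less_le[of n "\<lambda>k. x k < x i"] n(2) by simp
  \<comment> \<open>Ranks are distinct, so the new store does not overwrite an earlier one.\<close>
  have "rk k \<noteq> rk i" if "k < i" for k
    using inj_onD[OF inj, of k i] that i(1) by auto
  note facts = this \<open>card _ < B\<close>
  show "runs B (Assign ''r'' (C 0) ;;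
      ?count ;;
      NStore ''ord'' (V ''r'') (V ''i'')) \<tau> (1 + ((n * (1 + max 1 1 + 2) + 2) + 1))
      (\<lambda>\<tau>'. \<forall>k<Suc i. nmem (nupdate ''i'' 0 (Suc i) \<tau>') ''ord'' (rk k) = k)"
  proof (rule runs_Store_Seq[where j = 0 and v = 0])
    show "runs B (?count ;;
        NStore ''ord'' (V ''r'') (V ''i'')) ?\<rho> ((n * (1 + max 1 1 + 2) + 2) + 1)
        (\<lambda>\<tau>'. \<forall>k<Suc i. nmem (nupdate ''i'' 0 (Suc i) \<tau>') ''ord'' (rk k) = k)"
    proof (rule runs_Seq[OF inner])
      fix \<tau>' :: state
      assume kp: "keeps (writes ?count) ?\<rho> \<tau>'"
        and r: "nmem \<tau>' ''r'' 0 = card {k. k < n \<and> x k < x i}"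
      have f: "nmem \<tau>' ''i'' 0 = i" "nmem \<tau>' ''ord'' = nmem \<tau> ''ord''"
        using keepsD(2)[OF kp, of "''i''"] keepsD(2)[OF kp, of "''ord''"] i by simp_all
      have rk: "nmem \<tau>' ''r'' 0 = rk i" "rk i < B"
        using r facts(2) by (simp_all add: rk_def)
      show "runs B (NStore ''ord'' (V ''r'') (V ''i'')) \<tau>' 1
          (\<lambda>\<tau>'. \<forall>k<Suc i. nmem (nupdate ''i'' 0 (Suc i) \<tau>') ''ord'' (rk k) = k)"
        using f rk i(1,3) facts(1) n(2) by (intro runs_NStore) (simp_all add: All_less_Suc)
    qed
  qed (use n(2) in simp_all)
qed (use n in simp_all)

definition digits_prog :: com where
  "digits_prog = Assign ''v'' (V ''w'') ;; Assign ''cnt'' (C 0) ;;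
     For ''i'' ''n'' (NStore ''dig'' (V ''i'') (NMod (V ''v'') (C 6)) ;;
       Assign ''v'' (NDiv (V ''v'') (C 6)) ;;
       Ite (NLess (C 2) (At ''dig'' ''i'')) (Inc ''cnt'') Skip)"

lemma runs_digits:
  assumes n: "nmem \<sigma> ''n'' 0 = n" "n < B" and w: "nmem \<sigma> ''w'' 0 = w" "w < B" and "6 < B"
  shows "runs B digits_prog \<sigma> (1 + (1 + (n * (1 + (1 + (1 + max 1 1)) + 2) + 2)))
    (\<lambda>\<tau>. (\<forall>k<n. nmem \<tau> ''dig'' k = digit w k) \<and> nmem \<tau> ''cnt'' 0 = pot n (digit w))"
proof -
  let ?\<rho> = "nupdate ''v'' 0 w \<sigma>"
  let ?I = "\<lambda>i (\<tau>::state). nmem \<tau> ''v'' 0 = w div 6 ^ i \<and> (\<forall>k<i. nmem \<tau> ''dig'' k = digit w k) \<and>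
    nmem \<tau> ''cnt'' 0 = card {k. k < i \<and> 2 < digit w k}"
  let ?body = "NStore ''dig'' (V ''i'') (NMod (V ''v'') (C 6)) ;;
       Assign ''v'' (NDiv (V ''v'') (C 6)) ;;
       Ite (NLess (C 2) (At ''dig'' ''i'')) (Inc ''cnt'') Skip"
  have "runs B (For ''i'' ''n'' ?body) (nupdate ''cnt'' 0 0 ?\<rho>) (n * (1 + (1 + (1 + max 1 1)) + 2) + 2) (?I n)"
  proof (rule runs_For)
    fix i \<tau>
    assume i: "i < n" "nmem \<tau> ''i'' 0 = i" "?I i \<tau>"
    have "digit w i < B" "w div 6 ^ i div 6 < B" "w div 6 ^ Suc i = w div 6 ^ i div 6"
      "card {k. k < i \<and> 2 < digit w k} \<le> i"
      using assms(5) w(2) by (auto simp: digit_def div_mult2_eq[symmetric] mult.commute card_less_le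
          intro: le_less_trans[OF div_le_dividend] less_trans[of _ 6])
    moreover have "w div 6 ^ i mod 6 = digit w i"
      by (simp add: digit_def)
    ultimately show "runs B ?body \<tau> (1 + (1 + (1 + max 1 1))) (\<lambda>\<tau>'. ?I (Suc i) (nupdate ''i'' 0 (Suc i) \<tau>'))"
      using i n(2) by (intro runs_NStore_Seq runs_Ite runs_NStore runs_Skip)
        (simp_all add: All_less_Suc card_less_Suc_if)
  qed (use n in simp_all)
  then have "runs B (For ''i'' ''n'' ?body) (nupdate ''cnt'' 0 0 ?\<rho>) (n * (1 + (1 + (1 + max 1 1)) + 2) + 2)
      (\<lambda>\<tau>. (\<forall>k<n. nmem \<tau> ''dig'' k = digit w k) \<and> nmem \<tau> ''cnt'' 0 = pot n (digit w))"
    by (rule runs_weaken) (simp_all add: pot_def)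
  then have "runs B (Assign ''cnt'' (C 0) ;; For ''i'' ''n'' ?body) ?\<rho>
      (1 + (n * (1 + (1 + (1 + max 1 1)) + 2) + 2))
      (\<lambda>\<tau>. (\<forall>k<n. nmem \<tau> ''dig'' k = digit w k) \<and> nmem \<tau> ''cnt'' 0 = pot n (digit w))"
    by (rule runs_Store_Seq[where j = 0 and v = 0, rotated -1]) (use assms in simp_all)
  then show ?thesis
    unfolding digits_prog_def by (rule runs_Store_Seq[where j = 0 and v = w, rotated -1]) (use assms in simp_all)
qed

text \<open>\<open>''f''\<close> is one plus the top of the stack, so that 0 can mean empty. The
  stack is an array of flags scanned up to \<open>i\<close>, at quadratic cost once per word. Both
  branches of the last test write the flag of \<open>i\<close>, since the array still holds flags
  from the previous word.\<close>

definition decode_prog :: com where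
  "decode_prog = For ''i'' ''n'' (
     NStore ''blk'' (V ''i'') (V ''i'') ;;
     Assign ''f'' (C 0) ;;
     For ''j'' ''i'' (Ite (NEq (At ''open'' ''j'') (C 0)) Skip (Assign ''f'' (NAdd (V ''j'') (C 1)))) ;;
     Ite (Conj (Conj (NLess (C 2) (At ''dig'' ''i'')) (NLess (At ''dig'' ''i'') (C 5))) (NLess (C 0) (V ''f'')))
       (NStore ''blk'' (V ''i'') (NCell ''blk'' (NSub (V ''f'') (C 1))) ;;
        NStore ''open'' (NSub (V ''f'') (C 1)) (C 0))
       Skip ;;
     Ite (Conj (NLess (C 0) (At ''dig'' ''i'')) (NEq (NMod (At ''dig'' ''i'') (C 2)) (C 0)))
       (NStore ''open'' (V ''i'') (C 1)) (NStore ''open'' (V ''i'') (C 0)))"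

text \<open>Valid for arbitrary words; it keeps labels below the word bound and the top of the stack
  well defined.\<close>

lemma decode_bounds:
  "finite (snd (decode d i)) \<and> snd (decode d i) \<subseteq> {..<i} \<and> (\<forall>j<i. fst (decode d i) j \<le> j)"
proof (induction i)
  case (Suc i)
  obtain blk op where dec: "decode d i = (blk, op)"
    by fastforce
  then have ih: "finite op" "op \<subseteq> {..<i}" "\<forall>j<i. blk j \<le> j"
    using Suc by simp_all
  have "blk (Max op) \<le> i" if "op \<noteq> {}"
  proof -
    have "Max op < i"
      using Max_in[OF ih(1) that] ih(2) by blast
    then show ?thesis
      using ih(3) by (meson le_trans less_imp_le)
  qed
  then show ?case
    using ih by (auto simp: dec Let_def less_Suc_eq)
qed simp

lemma runs_last_open:
  assumes i: "nmem \<sigma> ''i'' 0 = i" "i < B" "nmem \<sigma> ''f'' 0 = 0"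
    and op: "op \<subseteq> {..<i}" "\<And>j. j < i \<Longrightarrow> nmem \<sigma> ''open'' j \<noteq> 0 \<longleftrightarrow> j \<in> op"
  shows "runs B (For ''j'' ''i'' (Ite (NEq (At ''open'' ''j'') (C 0)) Skip (Assign ''f'' (NAdd (V ''j'') (C 1)))))
    \<sigma> (i * (1 + max 1 1 + 2) + 2) (\<lambda>\<tau>. nmem \<tau> ''f'' 0 = (if op = {} then 0 else Suc (Max op)))"
proof -
  let ?body = "Ite (NEq (At ''open'' ''j'') (C 0)) Skip (Assign ''f'' (NAdd (V ''j'') (C 1)))"
  let ?I = "\<lambda>j (\<tau>::state). nmem \<tau> ''f'' 0 = (if op \<inter> {..<j} = {} then 0 else Suc (Max (op \<inter> {..<j})))"
  have "runs B (For ''j'' ''i'' ?body) \<sigma> (i * (1 + max 1 1 + 2) + 2) (?I i)"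
  proof (rule runs_For)
    fix j \<tau>
    assume j: "j < i" "nmem \<tau> ''j'' 0 = j" "?I j \<tau>"
      and keep: "keeps (insert ''j'' (writes ?body)) \<sigma> \<tau>"
    have "nmem \<tau> ''open'' j = nmem \<sigma> ''open'' j"
      using keepsD(2)[OF keep, of "''open''"] by simp
    then have iff: "nmem \<tau> ''open'' j = 0 \<longleftrightarrow> j \<notin> op"
      using op(2)[OF j(1)] by auto
    have "?I (Suc j) (nupdate ''j'' 0 (Suc j) \<tau>)" if "j \<notin> op"
    proof -
      have "op \<inter> {..<Suc j} = op \<inter> {..<j}"
        using that by (auto simp: less_Suc_eq)
      then show ?thesis
        using j(3) by simp
    qed
    moreover have "?I (Suc j) (nupdate ''j'' 0 (Suc j) (nupdate ''f'' 0 (Suc j) \<tau>))" if "j \<in> op"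
    proof -
      have "Max (op \<inter> {..<Suc j}) = j"
        using that by (intro Max_eqI) auto
      then show ?thesis
        using that by auto
    qed
    ultimately show "runs B ?body \<tau> (1 + max 1 1) (\<lambda>\<tau>'. ?I (Suc j) (nupdate ''j'' 0 (Suc j) \<tau>'))"
      using j(1,2) i(2) iff by (intro runs_Ite runs_NStore runs_Skip) simp_all
  qed (use i in simp_all)
  moreover have "op \<inter> {..<i} = op"
    using op(1) by blast
  ultimately show ?thesis
    by (simp only:)
qed

lemma runs_decode:
  assumes n: "nmem \<sigma> ''n'' 0 = n" "n < B" "1 < B" and dig: "\<And>k. k < n \<Longrightarrow> nmem \<sigma> ''dig'' k = d k"
  shows "runs B decode_prog \<sigma>
    (n * (1 + (1 + ((n * (1 + max 1 1 + 2) + 2) + ((1 + max (1 + 1) 1) + (1 + max 1 1)))) + 2) + 2)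
    (\<lambda>\<tau>. \<forall>k<n. nmem \<tau> ''blk'' k = fst (decode d n) k)"
proof -
  let ?I = "\<lambda>i (\<tau>::state). \<forall>j<i. nmem \<tau> ''blk'' j = fst (decode d i) j \<and>
    (nmem \<tau> ''open'' j \<noteq> 0 \<longleftrightarrow> j \<in> snd (decode d i))"
  have "runs B decode_prog \<sigma>
    (n * (1 + (1 + ((n * (1 + max 1 1 + 2) + 2) + ((1 + max (1 + 1) 1) + (1 + max 1 1)))) + 2) + 2) (?I n)"
    unfolding decode_prog_def
  proof (rule runs_For)
    fix i \<tau>
    assume i: "i < n" "nmem \<tau> ''i'' 0 = i" "?I i \<tau>"
    let ?find = "For ''j'' ''i'' (Ite (NEq (At ''open'' ''j'') (C 0)) Skip (Assign ''f'' (NAdd (V ''j'') (C 1))))"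
    let ?cond = "Conj (Conj (NLess (C 2) (At ''dig'' ''i'')) (NLess (At ''dig'' ''i'') (C 5))) (NLess (C 0) (V ''f''))"
    let ?link = "Ite ?cond
       (NStore ''blk'' (V ''i'') (NCell ''blk'' (NSub (V ''f'') (C 1))) ;;
        NStore ''open'' (NSub (V ''f'') (C 1)) (C 0))
       Skip"
    let ?open = "Ite (Conj (NLess (C 0) (At ''dig'' ''i'')) (NEq (NMod (At ''dig'' ''i'') (C 2)) (C 0)))
       (NStore ''open'' (V ''i'') (C 1)) (NStore ''open'' (V ''i'') (C 0))"
    assume keep: "keeps (insert ''i'' (writes (NStore ''blk'' (V ''i'') (V ''i'') ;;
      Assign ''f'' (C 0) ;; ?find ;; ?link ;; ?open))) \<sigma> \<tau>"
    obtain blk op where dec: "decode d i = (blk, op)"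
      by fastforce
    have bnd: "finite op" "op \<subseteq> {..<i}" "\<And>j. j < i \<Longrightarrow> blk j \<le> j"
      using decode_bounds[of d i] unfolding dec by simp_all
    have di: "nmem \<tau> ''dig'' i = d i"
      using keepsD(2)[OF keep, of "''dig''"] dig[OF i(1)] by simp
    let ?\<rho> = "nupdate ''f'' 0 0 (nupdate ''blk'' i i \<tau>)"
    have find: "runs B ?find ?\<rho> (i * (1 + max 1 1 + 2) + 2)
        (\<lambda>\<tau>. nmem \<tau> ''f'' 0 = (if op = {} then 0 else Suc (Max op)))"
      by (rule runs_last_open) (use i n bnd dec in auto)
    have "i * (1 + max 1 1 + 2) + 2 \<le> n * (1 + max 1 1 + 2) + 2"
      using i(1) by simp
    then have find': "runs B ?find ?\<rho> (n * (1 + max 1 1 + 2) + 2)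
        (\<lambda>\<tau>. nmem \<tau> ''f'' 0 = (if op = {} then 0 else Suc (Max op)))"
      by (rule runs_weaken[OF find])
    let ?hit = "linL (d i) \<and> op \<noteq> {}"
    let ?M = "\<lambda>\<tau>'::state. nmem \<tau>' ''i'' 0 = i \<and> nmem \<tau>' ''dig'' i = d i \<and>
      (\<forall>j<Suc i. nmem \<tau>' ''blk'' j = (blk(i := if ?hit then blk (Max op) else i)) j) \<and>
      (\<forall>j<i. nmem \<tau>' ''open'' j \<noteq> 0 \<longleftrightarrow> j \<in> (if ?hit then op - {Max op} else op))"
    have rest: "runs B (?link ;; ?open) \<rho> ((1 + max (1 + 1) 1) + (1 + max 1 1))
        (\<lambda>\<tau>'. ?I (Suc i) (nupdate ''i'' 0 (Suc i) \<tau>'))"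
      if kp: "keeps (writes ?find) ?\<rho> \<rho>" and f: "nmem \<rho> ''f'' 0 = (if op = {} then 0 else Suc (Max op))" for \<rho>
    proof -
      have fr: "nmem \<rho> ''i'' 0 = i" "nmem \<rho> ''dig'' i = d i" "nmem \<rho> ''blk'' = (nmem \<tau> ''blk'')(i := i)"
        "nmem \<rho> ''open'' = nmem \<tau> ''open''"
        using keepsD(2)[OF kp, of "''i''"] keepsD(2)[OF kp, of "''dig''"] keepsD(2)[OF kp, of "''blk''"]
          keepsD(2)[OF kp, of "''open''"] i di by simp_all
      have mx: "Max op < i" if "op \<noteq> {}"
        using Max_in[OF bnd(1) that] bnd(2) by blast
      have hit: "bval ?cond \<rho>
          \<longleftrightarrow> ?hit"
        using fr f by (simp add: linL_def)
      have "i < B"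
        using i(1) n(2) by simp
      have blkB: "blk (Max op) < B" if "op \<noteq> {}"
        using bnd(3)[OF mx[OF that]] mx[OF that] \<open>i < B\<close> by linarith
      have link: "runs B ?link \<rho> (1 + max (1 + 1) 1) ?M"
      proof (rule runs_Ite)
        assume "bval ?cond \<rho>"
        then have h: "?hit"
          using hit by blast
        then show "runs B (NStore ''blk'' (V ''i'') (NCell ''blk'' (NSub (V ''f'') (C 1))) ;;
            NStore ''open'' (NSub (V ''f'') (C 1)) (C 0)) \<rho> (1 + 1) ?M"
          using fr f mx blkB \<open>i < B\<close> i(3) dec
          by (intro runs_NStore_Seq runs_NStore) (auto simp: less_Suc_eq)
      next
        assume "\<not> bval ?cond \<rho>"
        then have h: "\<not> ?hit"
          using hit by blast
        then show "runs B Skip \<rho> 1 ?M"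
          using fr i(3) dec by (intro runs_Skip) (auto simp: less_Suc_eq)
      qed
      show ?thesis
      proof (rule runs_Seq[OF link])
        fix \<tau>' :: state
        assume a: "?M \<tau>'"
        have R: "0 < d i \<and> d i mod 2 = 0 \<longleftrightarrow> linR (d i)"
          by (simp add: linR_def)
        have "i \<notin> op"
          using bnd(2) by blast
        then show "runs B ?open \<tau>' (1 + max 1 1) (\<lambda>\<tau>'. ?I (Suc i) (nupdate ''i'' 0 (Suc i) \<tau>'))"
          using a R \<open>i < B\<close> n(3) by (intro runs_Ite runs_NStore) (auto simp: dec Let_def All_less_Suc)
      qed
    qed
    show "runs B (NStore ''blk'' (V ''i'') (V ''i'') ;; Assign ''f'' (C 0) ;; ?find ;; ?link ;; ?open) \<tau>
       (1 + (1 + ((n * (1 + max 1 1 + 2) + 2) + ((1 + max (1 + 1) 1) + (1 + max 1 1)))))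
       (\<lambda>\<tau>'. ?I (Suc i) (nupdate ''i'' 0 (Suc i) \<tau>'))"
    proof (rule runs_Store_Seq[where j = i and v = i])
      show "runs B (Assign ''f'' (C 0) ;; ?find ;; ?link ;; ?open) (nupdate ''blk'' i i \<tau>)
          (1 + ((n * (1 + max 1 1 + 2) + 2) + ((1 + max (1 + 1) 1) + (1 + max 1 1))))
          (\<lambda>\<tau>'. ?I (Suc i) (nupdate ''i'' 0 (Suc i) \<tau>'))"
        by (rule runs_Store_Seq[where j = 0 and v = 0, OF _ _ _ _ runs_Seq[OF find' rest]])
          (use n in simp_all)
    qed (use i n in simp_all)
  qed (use n in simp_all)
  then show ?thesis
    by (rule runs_weaken) auto
qed

lemma runs_Store:
  assumes "nval i \<sigma> = j" "nval e \<sigma> = v" "j < B" "v < B" "Q (nupdate a j v \<sigma>)"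
  shows "runs B (NStore a i e) \<sigma> 1 Q"
  using runs_NStore[of i \<sigma> B e Q a] assms by simp

text \<open>The bound keeps the cost of the other branch, so that proofs by cases end with the same
  time as \<open>runs_Ite\<close>.\<close>

lemma runs_Ite_True: "bval b \<sigma> \<Longrightarrow> runs B c \<sigma> T Q \<Longrightarrow> runs B (Ite b c d) \<sigma> (1 + max T U) Q"
  using runs_weaken[OF runs_Ite[of b \<sigma> B c T Q d T], of "1 + max T U" Q] by simp

lemma runs_Ite_False: "\<not> bval b \<sigma> \<Longrightarrow> runs B d \<sigma> U Q \<Longrightarrow> runs B (Ite b c d) \<sigma> (1 + max T U) Q"
  using runs_weaken[OF runs_Ite[of b \<sigma> B c U Q d U], of "1 + max T U" Q] by simp

lemma runs_cond_Store:
  assumes "bval b \<sigma> \<longleftrightarrow> P" "nval i \<sigma> = j" "j < B" "nval e \<sigma> = u" "nval e' \<sigma> = v" "u < B" "v < B"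
    and "Q (nupdate a j (if P then u else v) \<sigma>)"
  shows "runs B (Ite b (NStore a i e) (NStore a i e')) \<sigma> 2 Q"
proof -
  have "runs B (Ite b (NStore a i e) (NStore a i e')) \<sigma> (1 + max 1 1) Q"
    using assms by (intro runs_Ite runs_NStore) simp_all
  then show ?thesis
    by (simp add: numeral_2_eq_2)
qed

lemma runs_cond_Store_Seq:
  assumes "bval b \<sigma> \<longleftrightarrow> P" "nval i \<sigma> = j" "j < B" "nval e \<sigma> = u" "nval e' \<sigma> = v" "u < B" "v < B"
    and "runs B c (nupdate a j (if P then u else v) \<sigma>) T Q"
  shows "runs B (Seq (Ite b (NStore a i e) (NStore a i e')) c) \<sigma> (2 + T) Q"
  by (rule runs_Seq[OF runs_cond_Store[OF assms(1-7), of "\<lambda>\<tau>. \<tau> = nupdate a j (if P then u else v) \<sigma>"]])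
    (use assms(8) in auto)

section \<open>Programs for one transition\<close>

definition below_exp :: bexp where
  "below_exp = (let X = (\<lambda>i. RCell ''x'' (At ''ord'' i)); Y = (\<lambda>i. RCell ''y'' (At ''ord'' i)) in
     RLess (RMul (RSub (Y ''k'') (Y ''a'')) (RSub (X ''b'') (X ''a'')))
       (RMul (RSub (X ''k'') (X ''a'')) (RSub (Y ''b'') (Y ''a''))))"

text \<open>\<open>''ok''\<close> is only ever cleared here, so failures at different points
  accumulate.\<close>

definition cover_prog :: com where
  "cover_prog = For ''k'' ''n'' (
     Ite (NEq (At ''dig'' ''k'') (C 5)) (NStore ''ncov'' (V ''k'') (C 1)) (NStore ''ncov'' (V ''k'') (C 0)) ;;
     Ite (NEq (At ''blk'' ''k'') (At ''blk'' ''b'')) (NStore ''nblk'' (V ''k'') (At ''blk'' ''a''))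
       (NStore ''nblk'' (V ''k'') (At ''blk'' ''k'')) ;;
     Ite (Conj (NLess (V ''a'') (V ''k'')) (NLess (V ''k'') (V ''b'')))
       (Ite below_exp (NStore ''ncov'' (V ''k'') (C 1))
         (Ite (NEq (At ''dig'' ''k'') (C 0)) Skip (Assign ''ok'' (C 0))))
       Skip)"

definition links_prog :: com where
  "links_prog = For ''j'' ''n'' (
     Ite (Conj (NEq (At ''ncov'' ''j'') (C 0)) (NEq (At ''nblk'' ''j'') (At ''nblk'' ''k'')))
       (Ite (NLess (V ''j'') (V ''k'')) (Assign ''hl'' (C 1))
         (Ite (NLess (V ''k'') (V ''j'')) (Assign ''hr'' (C 1)) Skip))
       Skip)"

text \<open>The dead-end test sits in the branch for letter 5: a newly covered point without a link
  on either side kills its block.\<close>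

definition letter_prog :: com where
  "letter_prog = Ite (NEq (At ''ncov'' ''k'') (C 0))
     (Ite (Conj (NEq (At ''dig'' ''k'') (C 0)) (Conj (Neg (NEq (V ''k'') (V ''a''))) (Neg (NEq (V ''k'') (V ''b'')))))
       (Assign ''nd'' (C 0))
       (Assign ''nd'' (NAdd (NAdd (C 1) (V ''hr'')) (NMul (C 2) (V ''hl'')))))
     (Assign ''nd'' (C 5) ;;
      Ite (Conj (Neg (NEq (At ''dig'' ''k'') (C 5))) (Conj (NEq (V ''hl'') (C 0)) (NEq (V ''hr'') (C 0))))
        (Assign ''ok'' (C 0)) Skip)"

text \<open>\<open>''pw''\<close> runs through the powers of 6 up to \<open>6 ^ n\<close> itself, so
  the word bound has to exceed \<open>6 ^ n\<close>.\<close>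

definition encode_prog :: com where
  "encode_prog = For ''k'' ''n'' (
     Assign ''hl'' (C 0) ;; Assign ''hr'' (C 0) ;; links_prog ;; letter_prog ;;
     Assign ''nw'' (NAdd (V ''nw'') (NMul (V ''nd'') (V ''pw''))) ;;
     Assign ''pw'' (NMul (V ''pw'') (C 6)) ;;
     Ite (NLess (C 2) (V ''nd'')) (Inc ''ncnt'') Skip)"

text \<open>The mark is not consulted, so one quadratic run serves all \<open>n\<close>
  marks.\<close>

definition step_prog :: com where
  "step_prog =
     Ite (Conj (NLess (V ''a'') (V ''b'')) (Conj (Neg (NEq (At ''dig'' ''a'') (C 5)))
       (Conj (Neg (NEq (At ''dig'' ''b'') (C 5))) (Neg (NEq (At ''blk'' ''a'') (At ''blk'' ''b''))))))
       (Assign ''ok'' (C 1)) (Assign ''ok'' (C 0)) ;;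
     cover_prog ;;
     Assign ''nw'' (C 0) ;; Assign ''ncnt'' (C 0) ;; Assign ''pw'' (C 1) ;;
     encode_prog ;;
     Ite (NLess (V ''cnt'') (V ''ncnt'')) Skip (Assign ''ok'' (C 0))"

context sorted_point_set
begin

text \<open>\<open>''ord''\<close> lists the input indices by x-coordinate. After
  \<open>rank_prog\<close> points are reached only through it, which lets the labels of arcs refer
  to the input order.\<close>

definition env :: "state \<Rightarrow> bool" where
  "env \<sigma> \<longleftrightarrow> nmem \<sigma> ''n'' 0 = n \<and> (\<forall>k<n. nmem \<sigma> ''ord'' k < n \<and> rmem \<sigma> ''x'' (nmem \<sigma> ''ord'' k) = fst (q k) \<and>
     rmem \<sigma> ''y'' (nmem \<sigma> ''ord'' k) = snd (q k))"

lemma env_n: "env \<sigma> \<Longrightarrow> nmem \<sigma> ''n'' 0 = n"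
  by (simp add: env_def)

lemma env_keeps: "env \<sigma> \<Longrightarrow> keeps A \<sigma> \<tau> \<Longrightarrow> ''n'' \<notin> A \<Longrightarrow> ''ord'' \<notin> A \<Longrightarrow> env \<tau>"
  using keepsD(1)[of A \<sigma> \<tau>] keepsD(2)[of A \<sigma> \<tau> "''n''"] keepsD(2)[of A \<sigma> \<tau> "''ord''"]
  by (simp add: env_def)

lemma env_nupdate: "env \<sigma> \<Longrightarrow> a \<noteq> ''n'' \<Longrightarrow> a \<noteq> ''ord'' \<Longrightarrow> env (nupdate a i v \<sigma>)"
  by (simp add: env_def)

lemma below_exp:
  assumes "env \<sigma>" "nmem \<sigma> ''a'' 0 = a" "nmem \<sigma> ''b'' 0 = b" "nmem \<sigma> ''k'' 0 = k" "a < n" "b < n" "k < n"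
  shows "bval below_exp \<sigma> \<longleftrightarrow> below a b k"
  using assms unfolding env_def below_exp_def below_def by simp

lemma runs_cover:
  assumes env: "env \<sigma>" and B: "n < B" "1 < B" and ab: "nmem \<sigma> ''a'' 0 = a" "nmem \<sigma> ''b'' 0 = b" "a < n" "b < n"
    and d: "\<And>k. k < n \<Longrightarrow> nmem \<sigma> ''dig'' k = d k" and f: "\<And>k. k < n \<Longrightarrow> nmem \<sigma> ''blk'' k = f k"
    and fB: "\<And>k. k < n \<Longrightarrow> f k < B"
  shows "runs B cover_prog \<sigma> (n * (2 + (2 + (1 + max (1 + max 1 (1 + max 1 1)) 1)) + 2) + 2) (\<lambda>\<tau>.
    (\<forall>k<n. (nmem \<tau> ''ncov'' k \<noteq> 0 \<longleftrightarrow> newcov d a b k) \<and> nmem \<tau> ''nblk'' k = newblk f a b k) \<and>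
    (nmem \<tau> ''ok'' 0 \<noteq> 0 \<longleftrightarrow> nmem \<sigma> ''ok'' 0 \<noteq> 0 \<and> (\<forall>k<n. a < k \<and> k < b \<and> \<not> below a b k \<longrightarrow> d k = 0)))"
  unfolding cover_prog_def
proof (rule runs_For[where I = "\<lambda>i \<tau>.
    (\<forall>k<i. (nmem \<tau> ''ncov'' k \<noteq> 0 \<longleftrightarrow> newcov d a b k) \<and> nmem \<tau> ''nblk'' k = newblk f a b k) \<and>
    (nmem \<tau> ''ok'' 0 \<noteq> 0 \<longleftrightarrow> nmem \<sigma> ''ok'' 0 \<noteq> 0 \<and> (\<forall>k<i. a < k \<and> k < b \<and> \<not> below a b k \<longrightarrow> d k = 0))"])
  fix k \<tau>
  let ?I = "\<lambda>i (\<tau>::state).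
    (\<forall>k<i. (nmem \<tau> ''ncov'' k \<noteq> 0 \<longleftrightarrow> newcov d a b k) \<and> nmem \<tau> ''nblk'' k = newblk f a b k) \<and>
    (nmem \<tau> ''ok'' 0 \<noteq> 0 \<longleftrightarrow> nmem \<sigma> ''ok'' 0 \<noteq> 0 \<and> (\<forall>k<i. a < k \<and> k < b \<and> \<not> below a b k \<longrightarrow> d k = 0))"
  let ?last = "Ite (Conj (NLess (V ''a'') (V ''k'')) (NLess (V ''k'') (V ''b'')))
       (Ite below_exp (NStore ''ncov'' (V ''k'') (C 1))
         (Ite (NEq (At ''dig'' ''k'') (C 0)) Skip (Assign ''ok'' (C 0))))
       Skip"
  let ?body = "Ite (NEq (At ''dig'' ''k'') (C 5)) (NStore ''ncov'' (V ''k'') (C 1)) (NStore ''ncov'' (V ''k'') (C 0)) ;;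
     Ite (NEq (At ''blk'' ''k'') (At ''blk'' ''b'')) (NStore ''nblk'' (V ''k'') (At ''blk'' ''a''))
       (NStore ''nblk'' (V ''k'') (At ''blk'' ''k'')) ;; ?last"
  assume k: "k < n" "nmem \<tau> ''k'' 0 = k" and I: "?I k \<tau>" and keep: "keeps (insert ''k'' (writes ?body)) \<sigma> \<tau>"
  have env': "env \<tau>"
    by (rule env_keeps[OF env keep]) simp_all
  have fr: "nmem \<tau> ''a'' 0 = a" "nmem \<tau> ''b'' 0 = b" "nmem \<tau> ''dig'' k = d k"
    "nmem \<tau> ''blk'' k = f k" "nmem \<tau> ''blk'' a = f a" "nmem \<tau> ''blk'' b = f b"
    using keepsD(2)[OF keep, of "''a''"] keepsD(2)[OF keep, of "''b''"] keepsD(2)[OF keep, of "''dig''"]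
      keepsD(2)[OF keep, of "''blk''"] ab d f k by simp_all
  have kB: "k < B"
    using k B by simp
  let ?\<rho> = "nupdate ''nblk'' k (if f k = f b then f a else f k) (nupdate ''ncov'' k (if d k = 5 then 1 else 0) \<tau>)"
  have "env ?\<rho>"
    using env' by (simp add: env_nupdate)
  then have bel: "bval below_exp ?\<rho> \<longleftrightarrow> below a b k"
    by (rule below_exp) (use fr k ab in simp_all)
  have last: "runs B ?last ?\<rho> (1 + max (1 + max 1 (1 + max 1 1)) 1)
      (\<lambda>\<tau>'. ?I (Suc k) (nupdate ''k'' 0 (Suc k) \<tau>'))"
  proof (cases "a < k \<and> k < b")
    case ak: True
    then have c: "bval (Conj (NLess (V ''a'') (V ''k'')) (NLess (V ''k'') (V ''b''))) ?\<rho>"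
      using fr k by simp
    show ?thesis
    proof (cases "below a b k")
      case True
      have "?I (Suc k) (nupdate ''k'' 0 (Suc k) (nupdate ''ncov'' k 1 ?\<rho>))"
        using I True ak by (simp add: All_less_Suc newcov_def newblk_def)
      then have "runs B (NStore ''ncov'' (V ''k'') (C 1)) ?\<rho> 1 (\<lambda>\<tau>'. ?I (Suc k) (nupdate ''k'' 0 (Suc k) \<tau>'))"
        by (rule runs_Store[rotated -1]) (use k kB B in simp_all)
      note inner = this
      have "bval below_exp ?\<rho>"
        using bel True by simp
      then show ?thesis
        by (rule runs_Ite_True[OF c runs_Ite_True[OF _ inner]])
    next
      case False
      have "runs B (Ite (NEq (At ''dig'' ''k'') (C 0)) Skip (Assign ''ok'' (C 0))) ?\<rho> (1 + max 1 1)
          (\<lambda>\<tau>'. ?I (Suc k) (nupdate ''k'' 0 (Suc k) \<tau>'))"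
      proof (cases "d k = 0")
        case True
        have "?I (Suc k) (nupdate ''k'' 0 (Suc k) ?\<rho>)"
          using I False True by (simp add: All_less_Suc newcov_def newblk_def)
        then have "runs B Skip ?\<rho> 1 (\<lambda>\<tau>'. ?I (Suc k) (nupdate ''k'' 0 (Suc k) \<tau>'))"
          by (rule runs_Skip)
        then show ?thesis
          by (rule runs_Ite_True[rotated]) (use fr k True in simp)
      next
        case d0: False
        have "?I (Suc k) (nupdate ''k'' 0 (Suc k) (nupdate ''ok'' 0 0 ?\<rho>))"
          using I False d0 ak by (simp add: All_less_Suc newcov_def newblk_def)
        then have "runs B (Assign ''ok'' (C 0)) ?\<rho> 1 (\<lambda>\<tau>'. ?I (Suc k) (nupdate ''k'' 0 (Suc k) \<tau>'))"
          by (rule runs_Store[rotated -1]) (use B in simp_all)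
        then show ?thesis
          by (rule runs_Ite_False[rotated]) (use fr k d0 in simp)
      qed
      note inner = this
      have "\<not> bval below_exp ?\<rho>"
        using bel False by simp
      then show ?thesis
        by (rule runs_Ite_True[OF c runs_Ite_False[OF _ inner]])
    qed
  next
    case False
    then have c: "\<not> bval (Conj (NLess (V ''a'') (V ''k'')) (NLess (V ''k'') (V ''b''))) ?\<rho>"
      using fr k by simp
    have "newcov d a b k \<longleftrightarrow> d k = 5"
      using False by (auto simp: newcov_def)
    then have "?I (Suc k) (nupdate ''k'' 0 (Suc k) ?\<rho>)"
      using I False by (auto simp: All_less_Suc newblk_def)
    then have "runs B Skip ?\<rho> 1 (\<lambda>\<tau>'. ?I (Suc k) (nupdate ''k'' 0 (Suc k) \<tau>'))"
      by (rule runs_Skip)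
    then show ?thesis
      by (rule runs_Ite_False[OF c])
  qed
  have "runs B (Ite (NEq (At ''blk'' ''k'') (At ''blk'' ''b'')) (NStore ''nblk'' (V ''k'') (At ''blk'' ''a''))
       (NStore ''nblk'' (V ''k'') (At ''blk'' ''k'')) ;; ?last) (nupdate ''ncov'' k (if d k = 5 then 1 else 0) \<tau>)
      (2 + (1 + max (1 + max 1 (1 + max 1 1)) 1)) (\<lambda>\<tau>'. ?I (Suc k) (nupdate ''k'' 0 (Suc k) \<tau>'))"
    by (rule runs_cond_Store_Seq[where P = "f k = f b" and j = k and u = "f a" and v = "f k"])
      (use fr k kB fB ab last in simp_all)
  then show "runs B ?body \<tau> (2 + (2 + (1 + max (1 + max 1 (1 + max 1 1)) 1)))
      (\<lambda>\<tau>'. ?I (Suc k) (nupdate ''k'' 0 (Suc k) \<tau>'))"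
    by (rule runs_cond_Store_Seq[where P = "d k = 5" and j = k and u = 1 and v = 0, rotated -1])
      (use fr k kB B in simp_all)
qed (use env_n[OF env] B in simp_all)

context
  fixes d f :: "nat \<Rightarrow> nat" and a b :: nat and B :: nat
  assumes B: "n < B" "6 ^ n < B" "8 < B" and ab: "a < n" "b < n"
begin

lemma runs_links:
  assumes n: "nmem \<sigma> ''n'' 0 = n" and k: "nmem \<sigma> ''k'' 0 = k" "k < n" and h: "nmem \<sigma> ''hl'' 0 = 0" "nmem \<sigma> ''hr'' 0 = 0"
    and cov: "\<And>j. j < n \<Longrightarrow> nmem \<sigma> ''ncov'' j \<noteq> 0 \<longleftrightarrow> newcov d a b j"
    and blk: "\<And>j. j < n \<Longrightarrow> nmem \<sigma> ''nblk'' j = newblk f a b j"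
  shows "runs B links_prog \<sigma> (n * (1 + max (1 + max 1 (1 + max 1 1)) 1 + 2) + 2) (\<lambda>\<tau>.
    nmem \<tau> ''hl'' 0 = of_bool (\<exists>j<n. j < k \<and> nlink d f a b k j) \<and>
    nmem \<tau> ''hr'' 0 = of_bool (\<exists>j<n. k < j \<and> nlink d f a b k j))"
  unfolding links_prog_def
proof (rule runs_For[where I = "\<lambda>i \<tau>. nmem \<tau> ''hl'' 0 = of_bool (\<exists>j<i. j < k \<and> nlink d f a b k j) \<and>
    nmem \<tau> ''hr'' 0 = of_bool (\<exists>j<i. k < j \<and> nlink d f a b k j)"])
  fix j \<tau>
  let ?I = "\<lambda>i (\<tau>::state). nmem \<tau> ''hl'' 0 = of_bool (\<exists>j<i. j < k \<and> nlink d f a b k j) \<and>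
    nmem \<tau> ''hr'' 0 = of_bool (\<exists>j<i. k < j \<and> nlink d f a b k j)"
  let ?c = "Conj (NEq (At ''ncov'' ''j'') (C 0)) (NEq (At ''nblk'' ''j'') (At ''nblk'' ''k''))"
  let ?body = "Ite ?c
       (Ite (NLess (V ''j'') (V ''k'')) (Assign ''hl'' (C 1))
         (Ite (NLess (V ''k'') (V ''j'')) (Assign ''hr'' (C 1)) Skip))
       Skip"
  assume j: "j < n" "nmem \<tau> ''j'' 0 = j" and I: "?I j \<tau>" and keep: "keeps (insert ''j'' (writes ?body)) \<sigma> \<tau>"
  have fr: "nmem \<tau> ''k'' 0 = k" "nmem \<tau> ''ncov'' j \<noteq> 0 \<longleftrightarrow> newcov d a b j"
    "nmem \<tau> ''nblk'' j = newblk f a b j" "nmem \<tau> ''nblk'' k = newblk f a b k"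
    using keepsD(2)[OF keep, of "''k''"] keepsD(2)[OF keep, of "''ncov''"] keepsD(2)[OF keep, of "''nblk''"]
      k cov[OF j(1)] blk[OF j(1)] blk[OF k(2)] by simp_all
  then have c: "bval ?c \<tau> \<longleftrightarrow> nlink d f a b k j"
    using j by (auto simp: nlink_def)
  show "runs B ?body \<tau> (1 + max (1 + max 1 (1 + max 1 1)) 1) (\<lambda>\<tau>'. ?I (Suc j) (nupdate ''j'' 0 (Suc j) \<tau>'))"
    using fr(1) j I B c
    by (intro runs_Ite runs_NStore runs_Skip; (simp only: c)?) (simp_all add: Ex_less_Suc)
qed (use n h B in simp_all)

lemma runs_letter:
  assumes k: "nmem \<sigma> ''k'' 0 = k" "k < n" and abm: "nmem \<sigma> ''a'' 0 = a" "nmem \<sigma> ''b'' 0 = b"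
    and d: "nmem \<sigma> ''dig'' k = d k" and cov: "nmem \<sigma> ''ncov'' k \<noteq> 0 \<longleftrightarrow> newcov d a b k"
    and hl: "nmem \<sigma> ''hl'' 0 = of_bool (\<exists>j<n. j < k \<and> nlink d f a b k j)"
    and hr: "nmem \<sigma> ''hr'' 0 = of_bool (\<exists>j<n. k < j \<and> nlink d f a b k j)"
  shows "runs B letter_prog \<sigma> (1 + max (1 + max 1 1) (1 + (1 + max 1 1))) (\<lambda>\<tau>.
    nmem \<tau> ''nd'' 0 = newletter d f a b k \<and>
    (nmem \<tau> ''ok'' 0 \<noteq> 0 \<longleftrightarrow> nmem \<sigma> ''ok'' 0 \<noteq> 0 \<and>
       (newcov d a b k \<and> d k \<noteq> 5 \<longrightarrow> (\<exists>j<n. j \<noteq> k \<and> nlink d f a b k j))))"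
proof -
  have B': "0 < B" "Suc 0 < B" "2 < B" "3 < B" "4 < B" "5 < B"
    using B by simp_all
  have ex: "(\<exists>j<n. j \<noteq> k \<and> nlink d f a b k j) \<longleftrightarrow>
      (\<exists>j<n. j < k \<and> nlink d f a b k j) \<or> (\<exists>j<n. k < j \<and> nlink d f a b k j)"
    by (auto simp: neq_iff)
  define L R where "L = (\<exists>j<n. j < k \<and> nlink d f a b k j)" and "R = (\<exists>j<n. k < j \<and> nlink d f a b k j)"
  have nl: "newletter d f a b k = (if newcov d a b k then 5 else if d k = 0 \<and> k \<noteq> a \<and> k \<noteq> b then 0
     else 1 + of_bool R + 2 * of_bool L)"
    unfolding newletter_def L_def R_def ..
  note m = hl[folded L_def] hr[folded R_def]
  show ?thesis
  proof (cases "newcov d a b k")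
    case True
    then have c: "\<not> bval (NEq (At ''ncov'' ''k'') (C 0)) \<sigma>"
      using cov k by simp
    show ?thesis
      unfolding letter_prog_def ex nl L_def[symmetric] R_def[symmetric]
      by (intro runs_Ite_False[OF c] runs_Store_Seq[where j = 0 and v = 5] runs_Ite runs_Store[where j = 0 and v = 0] runs_Skip)
        (use True k d m B' in \<open>auto\<close>)
  next
    case False
    then have c: "bval (NEq (At ''ncov'' ''k'') (C 0)) \<sigma>"
      using cov k by simp
    let ?P = "d k = 0 \<and> k \<noteq> a \<and> k \<noteq> b"
    let ?v = "1 + of_bool R + 2 * of_bool L :: nat"
    have "?v < B"
      using B' by (cases R; cases L) simp_all
    then have "runs B (Ite (Conj (NEq (At ''dig'' ''k'') (C 0)) (Conj (Neg (NEq (V ''k'') (V ''a''))) (Neg (NEq (V ''k'') (V ''b'')))))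
       (Assign ''nd'' (C 0)) (Assign ''nd'' (NAdd (NAdd (C 1) (V ''hr'')) (NMul (C 2) (V ''hl''))))) \<sigma> 2
       (\<lambda>\<tau>. \<tau> = nupdate ''nd'' 0 (if ?P then 0 else ?v) \<sigma>)"
      by (intro runs_cond_Store) (use k abm d m B' in simp_all)
    from runs_weaken[OF this, of "1 + max 1 1"] show ?thesis
      unfolding letter_prog_def ex nl L_def[symmetric] R_def[symmetric]
      by (intro runs_Ite_True[OF c]) (use False in simp_all)
  qed
qed

end

end

text \<open>Indices without a transition must be written as well: an untouched entry would have tail
  and head 0, which is a loop at the source.\<close>

definition arc_prog :: com where
  "arc_prog = For ''c'' ''n'' (
     Assign ''e'' (NAdd (NMul (NAdd (NMul (NAdd (NMul (V ''w'') (V ''n'')) (V ''a'')) (V ''n'')) (V ''b'')) (V ''n'')) (V ''c'')) ;;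
     Ite (Conj (Neg (NEq (V ''ok'') (C 0))) (NLess (V ''c'') (V ''b'')))
       (NStore ''tail'' (V ''e'') (NAdd (NMul (V ''w'') (V ''n'')) (V ''c'')) ;;
        NStore ''head'' (V ''e'') (NAdd (NMul (V ''nw'') (V ''n'')) (V ''a'')) ;;
        NStore ''left'' (V ''e'') (At ''ord'' ''a'') ;;
        NStore ''right'' (V ''e'') (At ''ord'' ''b''))
       (NStore ''head'' (V ''e'') (V ''sink'') ;;
        Ite (Conj (NEq (V ''a'') (C 0)) (Conj (NEq (V ''b'') (C 0)) (NLess (V ''n'') (NAdd (V ''cnt'') (C 2)))))
          (NStore ''tail'' (V ''e'') (NAdd (NMul (V ''w'') (V ''n'')) (V ''c'')))
          (NStore ''tail'' (V ''e'') (NAdd (V ''sink'') (C 1)))))"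

lemma writes_progs [simp]:
  "writes rank_prog = {''i'', ''r'', ''j'', ''ord''}"
  "writes digits_prog = {''v'', ''cnt'', ''i'', ''dig''}"
  "writes decode_prog = {''i'', ''blk'', ''f'', ''j'', ''open''}"
  "writes cover_prog = {''k'', ''ncov'', ''nblk'', ''ok''}"
  "writes links_prog = {''j'', ''hl'', ''hr''}"
  "writes letter_prog = {''nd'', ''ok''}"
  "writes encode_prog = {''k'', ''hl'', ''hr'', ''j'', ''nd'', ''ok'', ''nw'', ''pw'', ''ncnt''}"
  "writes step_prog = {''ok'', ''k'', ''ncov'', ''nblk'', ''nw'', ''ncnt'', ''pw'', ''hl'', ''hr'', ''j'', ''nd''}"
  "writes arc_prog = {''c'', ''e'', ''tail'', ''head'', ''left'', ''right''}"
  unfolding rank_prog_def digits_prog_def decode_prog_def cover_prog_def links_prog_def letter_prog_def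
    encode_prog_def step_prog_def arc_prog_def
  by (simp_all add: insert_commute)

context sorted_point_set
begin

context
  fixes d f :: "nat \<Rightarrow> nat" and a b :: nat and B :: nat
  assumes B: "n < B" "6 ^ n < B" "8 < B" and ab: "a < n" "b < n"
begin

lemma runs_encode:
  assumes n: "nmem \<sigma> ''n'' 0 = n" and abm: "nmem \<sigma> ''a'' 0 = a" "nmem \<sigma> ''b'' 0 = b"
    and d: "\<And>k. k < n \<Longrightarrow> nmem \<sigma> ''dig'' k = d k"
    and cov: "\<And>j. j < n \<Longrightarrow> nmem \<sigma> ''ncov'' j \<noteq> 0 \<longleftrightarrow> newcov d a b j"
    and blk: "\<And>j. j < n \<Longrightarrow> nmem \<sigma> ''nblk'' j = newblk f a b j"
    and init: "nmem \<sigma> ''nw'' 0 = 0" "nmem \<sigma> ''ncnt'' 0 = 0" "nmem \<sigma> ''pw'' 0 = 1"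
  shows "runs B encode_prog \<sigma> (n * (6 * n + 14) + 2) (\<lambda>\<tau>.
    nmem \<tau> ''nw'' 0 = (\<Sum>k<n. newletter d f a b k * 6 ^ k) \<and>
    nmem \<tau> ''ncnt'' 0 = pot n (newletter d f a b) \<and>
    (nmem \<tau> ''ok'' 0 \<noteq> 0 \<longleftrightarrow> nmem \<sigma> ''ok'' 0 \<noteq> 0 \<and>
       (\<forall>k<n. newcov d a b k \<and> d k \<noteq> 5 \<longrightarrow> (\<exists>j<n. j \<noteq> k \<and> nlink d f a b k j))))"
proof -
  let ?nl = "newletter d f a b"
  let ?I = "\<lambda>i (\<tau>::state). nmem \<tau> ''nw'' 0 = (\<Sum>k<i. ?nl k * 6 ^ k) \<and> nmem \<tau> ''pw'' 0 = 6 ^ i \<and>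
    nmem \<tau> ''ncnt'' 0 = card {k. k < i \<and> 2 < ?nl k} \<and>
    (nmem \<tau> ''ok'' 0 \<noteq> 0 \<longleftrightarrow> nmem \<sigma> ''ok'' 0 \<noteq> 0 \<and>
       (\<forall>k<i. newcov d a b k \<and> d k \<noteq> 5 \<longrightarrow> (\<exists>j<n. j \<noteq> k \<and> nlink d f a b k j)))"
  let ?rest = "Assign ''nw'' (NAdd (V ''nw'') (NMul (V ''nd'') (V ''pw''))) ;;
     Assign ''pw'' (NMul (V ''pw'') (C 6)) ;;
     Ite (NLess (C 2) (V ''nd'')) (Inc ''ncnt'') Skip"
  let ?body = "Assign ''hl'' (C 0) ;; Assign ''hr'' (C 0) ;; links_prog ;; letter_prog ;; ?rest"
  have "runs B (For ''k'' ''n'' ?body) \<sigma> (n * (6 * n + 12 + 2) + 2) (?I n)"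
  proof (rule runs_For[where I = ?I])
    fix k \<tau>
    assume k: "k < n" "nmem \<tau> ''k'' 0 = k" and I: "?I k \<tau>" and keep: "keeps (insert ''k'' (writes ?body)) \<sigma> \<tau>"
    have fr: "nmem \<tau> ''n'' 0 = n" "nmem \<tau> ''a'' 0 = a" "nmem \<tau> ''b'' 0 = b" "nmem \<tau> ''dig'' k = d k"
      "nmem \<tau> ''ncov'' = nmem \<sigma> ''ncov''" "nmem \<tau> ''nblk'' = nmem \<sigma> ''nblk''"
      using keepsD(2)[OF keep, of "''n''"] keepsD(2)[OF keep, of "''a''"] keepsD(2)[OF keep, of "''b''"]
        keepsD(2)[OF keep, of "''dig''"] keepsD(2)[OF keep, of "''ncov''"] keepsD(2)[OF keep, of "''nblk''"]
        n abm d k by simp_all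
    let ?\<rho> = "nupdate ''hr'' 0 0 (nupdate ''hl'' 0 0 \<tau>)"
    have links: "runs B links_prog ?\<rho> (n * (1 + max (1 + max 1 (1 + max 1 1)) 1 + 2) + 2) (\<lambda>\<tau>.
        nmem \<tau> ''hl'' 0 = of_bool (\<exists>j<n. j < k \<and> nlink d f a b k j) \<and>
        nmem \<tau> ''hr'' 0 = of_bool (\<exists>j<n. k < j \<and> nlink d f a b k j))"
      by (rule runs_links[OF B ab]) (use fr k cov blk in simp_all)
    have rest: "runs B ?rest \<tau>2 (1 + (1 + (1 + max 1 1))) (\<lambda>\<tau>'. ?I (Suc k) (nupdate ''k'' 0 (Suc k) \<tau>'))"
      if nd: "nmem \<tau>2 ''nd'' 0 = ?nl k" and ok: "nmem \<tau>2 ''ok'' 0 \<noteq> 0 \<longleftrightarrow> nmem \<tau> ''ok'' 0 \<noteq> 0 \<and>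
          (newcov d a b k \<and> d k \<noteq> 5 \<longrightarrow> (\<exists>j<n. j \<noteq> k \<and> nlink d f a b k j))"
        and eq: "nmem \<tau>2 ''nw'' = nmem \<tau> ''nw''" "nmem \<tau>2 ''pw'' = nmem \<tau> ''pw''" "nmem \<tau>2 ''ncnt'' = nmem \<tau> ''ncnt''" for \<tau>2
    proof -
      \<comment> \<open>The partial sum never exceeds the number of words of its length, so every
        intermediate value fits below \<open>B\<close>.\<close>
      have "(\<Sum>k<Suc k. ?nl k * 6 ^ k) < 6 ^ Suc k"
        by (rule digit_sum_less) (rule newletter_less)
      moreover have "(6::nat) ^ Suc k \<le> 6 ^ n"
        using k by (intro power_increasing) simp_all
      ultimately have less: "(\<Sum>k<Suc k. ?nl k * 6 ^ k) < B" "6 ^ Suc k < B"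
        using B by linarith+
      have cnt: "Suc (card {j. j < k \<and> 2 < ?nl j}) < B"
        using card_less_le[of k "\<lambda>j. 2 < ?nl j"] k B by linarith
      let ?\<rho>1 = "nupdate ''nw'' 0 (\<Sum>k<Suc k. ?nl k * 6 ^ k) \<tau>2"
      let ?\<rho>2 = "nupdate ''pw'' 0 (6 ^ Suc k) ?\<rho>1"
      have fin: "runs B (Ite (NLess (C 2) (V ''nd'')) (Inc ''ncnt'') Skip) ?\<rho>2 (1 + max 1 1)
          (\<lambda>\<tau>'. ?I (Suc k) (nupdate ''k'' 0 (Suc k) \<tau>'))"
      proof (cases "2 < ?nl k")
        case True
        have "?I (Suc k) (nupdate ''k'' 0 (Suc k) (nupdate ''ncnt'' 0 (Suc (card {j. j < k \<and> 2 < ?nl j})) ?\<rho>2))"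
          using I ok eq True by (simp add: All_less_Suc card_less_Suc_if) blast
        then have "runs B (Inc ''ncnt'') ?\<rho>2 1 (\<lambda>\<tau>'. ?I (Suc k) (nupdate ''k'' 0 (Suc k) \<tau>'))"
          by (rule runs_Store[rotated -1]) (use I eq cnt B in simp_all)
        then show ?thesis
          by (rule runs_Ite_True[rotated]) (use nd True in simp)
      next
        case False
        have "?I (Suc k) (nupdate ''k'' 0 (Suc k) ?\<rho>2)"
          using I ok eq False by (simp add: All_less_Suc card_less_Suc_if) blast
        then have "runs B Skip ?\<rho>2 1 (\<lambda>\<tau>'. ?I (Suc k) (nupdate ''k'' 0 (Suc k) \<tau>'))"
          by (rule runs_Skip)
        then show ?thesis
          by (rule runs_Ite_False[rotated]) (use nd False in simp)
      qed
      have "runs B (Assign ''pw'' (NMul (V ''pw'') (C 6)) ;; Ite (NLess (C 2) (V ''nd'')) (Inc ''ncnt'') Skip) ?\<rho>1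
          (1 + (1 + max 1 1)) (\<lambda>\<tau>'. ?I (Suc k) (nupdate ''k'' 0 (Suc k) \<tau>'))"
        by (rule runs_Store_Seq[OF _ _ _ _ fin]) (use I eq less B in simp_all)
      then show ?thesis
        by (rule runs_Store_Seq[rotated -1]) (use I eq nd less B in simp_all)
    qed
    have "runs B (links_prog ;; letter_prog ;; ?rest) ?\<rho> ((n * (1 + max (1 + max 1 (1 + max 1 1)) 1 + 2) + 2) +
        ((1 + max (1 + max 1 1) (1 + (1 + max 1 1))) + (1 + (1 + (1 + max 1 1)))))
        (\<lambda>\<tau>'. ?I (Suc k) (nupdate ''k'' 0 (Suc k) \<tau>'))"
    proof (rule runs_Seq[OF links])
      fix \<tau>1
      assume k1: "keeps (writes links_prog) ?\<rho> \<tau>1"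
        and h: "nmem \<tau>1 ''hl'' 0 = of_bool (\<exists>j<n. j < k \<and> nlink d f a b k j) \<and>
          nmem \<tau>1 ''hr'' 0 = of_bool (\<exists>j<n. k < j \<and> nlink d f a b k j)"
      have e1: "nmem \<tau>1 v = nmem \<tau> v" if "v \<notin> {''j'', ''hl'', ''hr''}" for v
        using keepsD(2)[OF k1, of v] that by simp
      have letter: "runs B letter_prog \<tau>1 (1 + max (1 + max 1 1) (1 + (1 + max 1 1))) (\<lambda>\<tau>.
          nmem \<tau> ''nd'' 0 = ?nl k \<and> (nmem \<tau> ''ok'' 0 \<noteq> 0 \<longleftrightarrow> nmem \<tau>1 ''ok'' 0 \<noteq> 0 \<and>
            (newcov d a b k \<and> d k \<noteq> 5 \<longrightarrow> (\<exists>j<n. j \<noteq> k \<and> nlink d f a b k j))))"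
        by (rule runs_letter[OF B ab]) (use e1 fr k cov h in simp_all)
      show "runs B (letter_prog ;; ?rest) \<tau>1 ((1 + max (1 + max 1 1) (1 + (1 + max 1 1))) + (1 + (1 + (1 + max 1 1))))
          (\<lambda>\<tau>'. ?I (Suc k) (nupdate ''k'' 0 (Suc k) \<tau>'))"
      proof (rule runs_Seq[OF letter])
        fix \<tau>2
        assume k2: "keeps (writes letter_prog) \<tau>1 \<tau>2"
          and r: "nmem \<tau>2 ''nd'' 0 = ?nl k \<and> (nmem \<tau>2 ''ok'' 0 \<noteq> 0 \<longleftrightarrow> nmem \<tau>1 ''ok'' 0 \<noteq> 0 \<and>
            (newcov d a b k \<and> d k \<noteq> 5 \<longrightarrow> (\<exists>j<n. j \<noteq> k \<and> nlink d f a b k j)))"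
        have e2: "nmem \<tau>2 v = nmem \<tau> v" if "v \<notin> {''j'', ''hl'', ''hr'', ''nd'', ''ok''}" for v
          using keepsD(2)[OF k2, of v] e1[of v] that by simp
        show "runs B ?rest \<tau>2 (1 + (1 + (1 + max 1 1))) (\<lambda>\<tau>'. ?I (Suc k) (nupdate ''k'' 0 (Suc k) \<tau>'))"
          by (rule rest) (use r e1[of "''ok''"] e2 in simp_all)
      qed
    qed
    then have "runs B (Assign ''hr'' (C 0) ;; links_prog ;; letter_prog ;; ?rest) (nupdate ''hl'' 0 0 \<tau>) (1 +
        ((n * (1 + max (1 + max 1 (1 + max 1 1)) 1 + 2) + 2) +
        ((1 + max (1 + max 1 1) (1 + (1 + max 1 1))) + (1 + (1 + (1 + max 1 1))))))
        (\<lambda>\<tau>'. ?I (Suc k) (nupdate ''k'' 0 (Suc k) \<tau>'))"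
      by (rule runs_Store_Seq[rotated -1]) (use B in simp_all)
    then have "runs B ?body \<tau> (1 + (1 +
        ((n * (1 + max (1 + max 1 (1 + max 1 1)) 1 + 2) + 2) +
        ((1 + max (1 + max 1 1) (1 + (1 + max 1 1))) + (1 + (1 + (1 + max 1 1)))))))
        (\<lambda>\<tau>'. ?I (Suc k) (nupdate ''k'' 0 (Suc k) \<tau>'))"
      by (rule runs_Store_Seq[rotated -1]) (use B in simp_all)
    then show "runs B ?body \<tau> (6 * n + 12) (\<lambda>\<tau>'. ?I (Suc k) (nupdate ''k'' 0 (Suc k) \<tau>'))"
      by (rule runs_weaken) simp_all
  qed (use n B init in simp_all)
  then show ?thesis
    unfolding encode_prog_def by (rule runs_weaken) (simp_all add: pot_def)
qed

lemma runs_step: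
  assumes env: "env \<sigma>" and abm: "nmem \<sigma> ''a'' 0 = a" "nmem \<sigma> ''b'' 0 = b"
    and d: "\<And>k. k < n \<Longrightarrow> nmem \<sigma> ''dig'' k = d k" and f: "\<And>k. k < n \<Longrightarrow> nmem \<sigma> ''blk'' k = f k"
    and fB: "\<And>k. k < n \<Longrightarrow> f k < B" and cnt: "nmem \<sigma> ''cnt'' 0 = pot n d"
  shows "runs B step_prog \<sigma> (50 * n ^ 2) (\<lambda>\<tau>.
    nmem \<tau> ''nw'' 0 = (\<Sum>k<n. newletter d f a b k * 6 ^ k) \<and>
    (nmem \<tau> ''ok'' 0 \<noteq> 0 \<longleftrightarrow> step_ok d f a b \<and> pot n d < pot n (newletter d f a b)))"
proof -
  let ?Q = "\<lambda>\<tau>::state. nmem \<tau> ''nw'' 0 = (\<Sum>k<n. newletter d f a b k * 6 ^ k) \<and>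
    (nmem \<tau> ''ok'' 0 \<noteq> 0 \<longleftrightarrow> step_ok d f a b \<and> pot n d < pot n (newletter d f a b))"
  let ?P = "a < b \<and> d a \<noteq> 5 \<and> d b \<noteq> 5 \<and> f a \<noteq> f b"
  let ?P1 = "\<forall>k<n. a < k \<and> k < b \<and> \<not> below a b k \<longrightarrow> d k = 0"
  let ?P2 = "\<forall>k<n. newcov d a b k \<and> d k \<noteq> 5 \<longrightarrow> (\<exists>j<n. j \<noteq> k \<and> nlink d f a b k j)"
  let ?last = "Ite (NLess (V ''cnt'') (V ''ncnt'')) Skip (Assign ''ok'' (C 0))"
  let ?\<sigma>1 = "nupdate ''ok'' 0 (if ?P then 1 else 0) \<sigma>"
  have cover: "runs B cover_prog ?\<sigma>1 (n * (2 + (2 + (1 + max (1 + max 1 (1 + max 1 1)) 1)) + 2) + 2) (\<lambda>\<tau>.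
      (\<forall>k<n. (nmem \<tau> ''ncov'' k \<noteq> 0 \<longleftrightarrow> newcov d a b k) \<and> nmem \<tau> ''nblk'' k = newblk f a b k) \<and>
      (nmem \<tau> ''ok'' 0 \<noteq> 0 \<longleftrightarrow> nmem ?\<sigma>1 ''ok'' 0 \<noteq> 0 \<and> ?P1))"
    by (rule runs_cover) (use env_nupdate[OF env, of "''ok''"] B ab abm d f fB in simp_all)
  have tail: "runs B (Assign ''nw'' (C 0) ;; Assign ''ncnt'' (C 0) ;; Assign ''pw'' (C 1) ;; encode_prog ;; ?last) \<tau>
      (1 + (1 + (1 + ((n * (6 * n + 14) + 2) + (1 + max 1 1))))) ?Q"
    if keep: "keeps (writes cover_prog) ?\<sigma>1 \<tau>" and
      cv: "(\<forall>k<n. (nmem \<tau> ''ncov'' k \<noteq> 0 \<longleftrightarrow> newcov d a b k) \<and> nmem \<tau> ''nblk'' k = newblk f a b k) \<and>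
      (nmem \<tau> ''ok'' 0 \<noteq> 0 \<longleftrightarrow> nmem ?\<sigma>1 ''ok'' 0 \<noteq> 0 \<and> ?P1)" for \<tau>
  proof -
    have e1: "nmem \<tau> v = nmem \<sigma> v" if "v \<notin> {''k'', ''ncov'', ''nblk'', ''ok''}" for v
      using keepsD(2)[OF keep, of v] that by simp
    let ?\<rho> = "nupdate ''pw'' 0 1 (nupdate ''ncnt'' 0 0 (nupdate ''nw'' 0 0 \<tau>))"
    have enc: "runs B encode_prog ?\<rho> (n * (6 * n + 14) + 2) (\<lambda>\<tau>'.
        nmem \<tau>' ''nw'' 0 = (\<Sum>k<n. newletter d f a b k * 6 ^ k) \<and>
        nmem \<tau>' ''ncnt'' 0 = pot n (newletter d f a b) \<and>
        (nmem \<tau>' ''ok'' 0 \<noteq> 0 \<longleftrightarrow> nmem ?\<rho> ''ok'' 0 \<noteq> 0 \<and> ?P2))"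
      by (rule runs_encode) (use e1 abm d env_n[OF env] cv in simp_all)
    have "runs B (encode_prog ;; ?last) ?\<rho> ((n * (6 * n + 14) + 2) + (1 + max 1 1)) ?Q"
    proof (rule runs_Seq[OF enc])
      fix \<tau>'
      assume k': "keeps (writes encode_prog) ?\<rho> \<tau>'"
        and r: "nmem \<tau>' ''nw'' 0 = (\<Sum>k<n. newletter d f a b k * 6 ^ k) \<and>
        nmem \<tau>' ''ncnt'' 0 = pot n (newletter d f a b) \<and>
        (nmem \<tau>' ''ok'' 0 \<noteq> 0 \<longleftrightarrow> nmem ?\<rho> ''ok'' 0 \<noteq> 0 \<and> ?P2)"
      have c: "nmem \<tau>' ''cnt'' 0 = pot n d"
        using keepsD(2)[OF k', of "''cnt''"] e1[of "''cnt''"] cnt by simp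
      have okP: "nmem \<tau>' ''ok'' 0 \<noteq> 0 \<longleftrightarrow> step_ok d f a b"
        using r cv unfolding step_ok_def by auto
      show "runs B ?last \<tau>' (1 + max 1 1) ?Q"
      proof (cases "pot n d < pot n (newletter d f a b)")
        case True
        have "?Q \<tau>'"
          using r okP True by blast
        then have "runs B Skip \<tau>' 1 ?Q"
          by (rule runs_Skip)
        then show ?thesis
          by (rule runs_Ite_True[rotated]) (use r c True in simp)
      next
        case False
        have "?Q (nupdate ''ok'' 0 0 \<tau>')"
          using r False by simp
        then have "runs B (Assign ''ok'' (C 0)) \<tau>' 1 ?Q"
          by (rule runs_Store[rotated -1]) (use B in simp_all)
        then show ?thesis
          by (rule runs_Ite_False[rotated]) (use r c False in simp)
      qed
    qed
    then have "runs B (Assign ''pw'' (C 1) ;; encode_prog ;; ?last) (nupdate ''ncnt'' 0 0 (nupdate ''nw'' 0 0 \<tau>))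
        (1 + ((n * (6 * n + 14) + 2) + (1 + max 1 1))) ?Q"
      by (rule runs_Store_Seq[rotated -1]) (use B in simp_all)
    then have "runs B (Assign ''ncnt'' (C 0) ;; Assign ''pw'' (C 1) ;; encode_prog ;; ?last) (nupdate ''nw'' 0 0 \<tau>)
        (1 + (1 + ((n * (6 * n + 14) + 2) + (1 + max 1 1)))) ?Q"
      by (rule runs_Store_Seq[rotated -1]) (use B in simp_all)
    then show ?thesis
      by (rule runs_Store_Seq[rotated -1]) (use B in simp_all)
  qed
  have "runs B step_prog \<sigma> (2 + ((n * (2 + (2 + (1 + max (1 + max 1 (1 + max 1 1)) 1)) + 2) + 2) +
      (1 + (1 + (1 + ((n * (6 * n + 14) + 2) + (1 + max 1 1))))))) ?Q"
    unfolding step_prog_def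
    by (rule runs_cond_Store_Seq[where P = ?P and j = 0 and u = 1 and v = 0, OF _ _ _ _ _ _ _ runs_Seq[OF cover tail]])
      (use abm ab d f B in simp_all)
  then show ?thesis
  proof (rule runs_weaken)
    \<comment> \<open>The exact time is \<open>6 * n ^ 2 + 24 * n + 11\<close>; lower terms are
      absorbed because \<open>n\<close> is positive.\<close>
    have "n \<le> n ^ 2" "1 \<le> n ^ 2"
      using n_pos by (simp_all add: self_le_power)
    moreover have "n * (6 * n + 14) = 6 * n ^ 2 + 14 * n"
      by (simp add: power2_eq_square algebra_simps)
    ultimately show "2 + ((n * (2 + (2 + (1 + max (1 + max 1 (1 + max 1 1)) 1)) + 2) + 2) +
      (1 + (1 + (1 + ((n * (6 * n + 14) + 2) + (1 + max 1 1)))))) \<le> 50 * n ^ 2"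
      by simp
  qed
qed

end

end

section \<open>The nested loops and the total time\<close>

lemma arc_id_inj:
  assumes "a < n" "b < n" "c < n" "a' < n" "b' < n" "c' < n" "arc_id n w a b c = arc_id n w' a' b' c'"
  shows "w = w' \<and> a = a' \<and> b = b' \<and> c = c'"
  using assms(7)[unfolded arc_id_def pair_eq_iff[OF assms(3,6)] pair_eq_iff[OF assms(2,5)]
      pair_eq_iff[OF assms(1,4)]] by blast

definition state_prog :: com where
  "state_prog = digits_prog ;; decode_prog ;; For ''a'' ''n'' (For ''b'' ''n'' (step_prog ;; arc_prog))"

context sorted_point_set
begin

definition arc_done :: "state \<Rightarrow> nat \<Rightarrow> nat \<Rightarrow> nat \<Rightarrow> nat \<Rightarrow> bool" where
  "arc_done \<sigma> w a b c \<longleftrightarrow> (let e = arc_id n w a b c in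
     if valid w a b \<and> c < b then
       nmem \<sigma> ''tail'' e = w * n + c \<and> nmem \<sigma> ''head'' e = succ w a b * n + a \<and>
       nmem \<sigma> ''left'' e = nmem \<sigma> ''ord'' a \<and> nmem \<sigma> ''right'' e = nmem \<sigma> ''ord'' b
     else nmem \<sigma> ''tail'' e = (if a = 0 \<and> b = 0 \<and> final w then w * n + c else 6 ^ n * n + 1) \<and>
       nmem \<sigma> ''head'' e = 6 ^ n * n)"

text \<open>Arcs are written in the order of their indices, so this one invariant, with a moving
  bound, serves all four nested loops.\<close>

definition arcs_done :: "state \<Rightarrow> nat \<Rightarrow> bool" where
  "arcs_done \<sigma> m \<longleftrightarrow> (\<forall>w a b c. w < 6 ^ n \<and> a < n \<and> b < n \<and> c < n \<and> arc_id n w a b c < m \<longrightarrow> arc_done \<sigma> w a b c)"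

lemma arcs_done_cong:
  assumes "\<And>v. v \<in> {''tail'', ''head'', ''left'', ''right'', ''ord''} \<Longrightarrow> nmem \<tau> v = nmem \<sigma> v"
  shows "arcs_done \<tau> m \<longleftrightarrow> arcs_done \<sigma> m"
  using assms unfolding arcs_done_def arc_done_def by simp

lemma arcs_done_keeps:
  assumes "keeps A \<sigma> \<tau>" "A \<inter> {''tail'', ''head'', ''left'', ''right'', ''ord''} = {}"
  shows "arcs_done \<tau> m \<longleftrightarrow> arcs_done \<sigma> m"
proof (rule arcs_done_cong)
  fix v
  assume "v \<in> {''tail'', ''head'', ''left'', ''right'', ''ord''}"
  then have "v \<notin> A"
    using assms(2) by blast
  then show "nmem \<tau> v = nmem \<sigma> v"
    by (rule keepsD(2)[OF assms(1)])
qed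

lemma arcs_done_Suc:
  assumes written: "arcs_done \<tau> m" and m: "m = arc_id n w a b c" and abc: "a < n" "b < n" "c < n"
    and eq: "\<And>v i. v \<in> {''tail'', ''head'', ''left'', ''right''} \<Longrightarrow> i \<noteq> m \<Longrightarrow> nmem \<tau>' v i = nmem \<tau> v i"
      "nmem \<tau>' ''ord'' = nmem \<tau> ''ord''"
    and new: "arc_done \<tau>' w a b c"
  shows "arcs_done \<tau>' (Suc m)"
  unfolding arcs_done_def
proof (intro allI impI, elim conjE)
  fix w' a' b' c'
  assume *: "w' < 6 ^ n" "a' < n" "b' < n" "c' < n" "arc_id n w' a' b' c' < Suc m"
  show "arc_done \<tau>' w' a' b' c'"
  proof (cases "arc_id n w' a' b' c' = m")
    case True
    then show ?thesis
      using arc_id_inj[of a' n b' c' a b c w' w] * abc m new by simp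
  next
    case False
    then have "arc_done \<tau> w' a' b' c'"
      using written * unfolding arcs_done_def by simp
    moreover have "nmem \<tau>' v (arc_id n w' a' b' c') = nmem \<tau> v (arc_id n w' a' b' c')"
      if "v \<in> {''tail'', ''head'', ''left'', ''right''}" for v
      using eq(1)[OF that False] .
    ultimately show ?thesis
      using eq(2) unfolding arc_done_def Let_def by (simp only: insert_iff simp_thms)
  qed
qed

lemma runs_arcs:
  assumes B: "6 ^ n * n * n * n + 6 ^ n * n + 8 < B" and env: "env \<sigma>"
    and w: "nmem \<sigma> ''w'' 0 = w" "w < 6 ^ n" and ab: "nmem \<sigma> ''a'' 0 = a" "nmem \<sigma> ''b'' 0 = b" "a < n" "b < n"
    and nw: "nmem \<sigma> ''nw'' 0 = succ w a b" and ok: "nmem \<sigma> ''ok'' 0 \<noteq> 0 \<longleftrightarrow> valid w a b"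
    and cnt: "nmem \<sigma> ''cnt'' 0 = pot n (digit w)" and sink: "nmem \<sigma> ''sink'' 0 = 6 ^ n * n"
    and written: "arcs_done \<sigma> (arc_id n w a b 0)"
  shows "runs B arc_prog \<sigma> (10 * n) (\<lambda>\<tau>. arcs_done \<tau> (arc_id n w a b n))"
proof -
  have n: "nmem \<sigma> ''n'' 0 = n"
    by (rule env_n[OF env])
  have "n \<le> 6 ^ n * n"
    by simp
  then have nB: "n < B"
    using B by linarith
  let ?e = "NAdd (NMul (NAdd (NMul (NAdd (NMul (V ''w'') (V ''n'')) (V ''a'')) (V ''n'')) (V ''b'')) (V ''n'')) (V ''c'')"
  let ?yes = "NStore ''tail'' (V ''e'') (NAdd (NMul (V ''w'') (V ''n'')) (V ''c'')) ;;
        NStore ''head'' (V ''e'') (NAdd (NMul (V ''nw'') (V ''n'')) (V ''a'')) ;;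
        NStore ''left'' (V ''e'') (At ''ord'' ''a'') ;;
        NStore ''right'' (V ''e'') (At ''ord'' ''b'')"
  let ?c = "Conj (NEq (V ''a'') (C 0)) (Conj (NEq (V ''b'') (C 0)) (NLess (V ''n'') (NAdd (V ''cnt'') (C 2))))"
  let ?no = "NStore ''head'' (V ''e'') (V ''sink'') ;;
        Ite ?c (NStore ''tail'' (V ''e'') (NAdd (NMul (V ''w'') (V ''n'')) (V ''c'')))
          (NStore ''tail'' (V ''e'') (NAdd (V ''sink'') (C 1)))"
  let ?ite = "Ite (Conj (Neg (NEq (V ''ok'') (C 0))) (NLess (V ''c'') (V ''b''))) ?yes ?no"
  let ?I = "\<lambda>c \<tau>. arcs_done \<tau> (arc_id n w a b c)"
  have "runs B (For ''c'' ''n'' (Assign ''e'' ?e ;; ?ite)) \<sigma> (n * (1 + (1 + max (1 + (1 + (1 + 1))) (1 + 2)) + 2) + 2) (?I n)"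
  proof (rule runs_For[where I = ?I])
    fix c \<tau>
    assume c: "c < n" "nmem \<tau> ''c'' 0 = c" and I: "?I c \<tau>" and keep: "keeps (insert ''c'' (writes (Assign ''e'' ?e ;; ?ite))) \<sigma> \<tau>"
    have e1: "nmem \<tau> v = nmem \<sigma> v" if "v \<notin> {''c'', ''e'', ''tail'', ''head'', ''left'', ''right''}" for v
      using keepsD(2)[OF keep, of v] that by simp
    define E where "E = arc_id n w a b c"
    have "E < 6 ^ n * n * n * n"
      unfolding E_def using arc_id_less[of w "6 ^ n" a n b c] w ab c by simp
    moreover have "w * n + c < 6 ^ n * n" "succ w a b * n + a < 6 ^ n * n"
      using pair_less[of w "6 ^ n" c n] pair_less[OF succ_less[of w a b] ab(3)] w c by simp_all
    moreover have "nmem \<tau> ''ord'' a < n" "nmem \<tau> ''ord'' b < n"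
      using env ab e1[of "''ord''"] by (simp_all add: env_def)
    ultimately have less: "E < B" "w * n + c < B" "succ w a b * n + a < B" "nmem \<tau> ''ord'' a < B" "nmem \<tau> ''ord'' b < B"
      "6 ^ n * n < B" "6 ^ n * n + 1 < B" "0 < B"
      using B nB by linarith+
    have vals: "nmem \<tau> ''w'' 0 = w" "nmem \<tau> ''n'' 0 = n" "nmem \<tau> ''a'' 0 = a" "nmem \<tau> ''b'' 0 = b"
      "nmem \<tau> ''nw'' 0 = succ w a b" "nmem \<tau> ''ok'' 0 \<noteq> 0 \<longleftrightarrow> valid w a b" "nmem \<tau> ''cnt'' 0 = pot n (digit w)"
      "nmem \<tau> ''sink'' 0 = 6 ^ n * n"
      using e1 w ab n nw ok cnt sink by simp_all
    have eE: "nval ?e \<tau> = E"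
      using vals c by (simp add: E_def arc_id_def)
    let ?\<rho> = "nupdate ''e'' 0 E \<tau>"
    let ?Q = "\<lambda>\<tau>'. ?I (Suc c) (nupdate ''c'' 0 (Suc c) \<tau>')"
    have Q: "?Q \<tau>'"
      if "\<And>v i. v \<in> {''tail'', ''head'', ''left'', ''right''} \<Longrightarrow> i \<noteq> E \<Longrightarrow> nmem \<tau>' v i = nmem \<tau> v i"
        "nmem \<tau>' ''ord'' = nmem \<tau> ''ord''" "arc_done \<tau>' w a b c" for \<tau>'
    proof -
      have "arcs_done \<tau>' (Suc E)"
        by (rule arcs_done_Suc[OF _ E_def ab(3,4) c(1)]) (use that I in \<open>simp_all add: E_def\<close>)
      then have "arcs_done \<tau>' (arc_id n w a b (Suc c))"
        by (simp add: E_def arc_id_def)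
      then show ?thesis
        by (subst arcs_done_cong[of _ \<tau>']) auto
    qed
    have "runs B ?ite ?\<rho> (1 + max (1 + (1 + (1 + 1))) (1 + 2)) ?Q"
    proof (cases "valid w a b \<and> c < b")
      case True
      let ?\<rho>1 = "nupdate ''tail'' E (w * n + c) ?\<rho>"
      let ?\<rho>2 = "nupdate ''head'' E (succ w a b * n + a) ?\<rho>1"
      let ?\<rho>3 = "nupdate ''left'' E (nmem \<tau> ''ord'' a) ?\<rho>2"
      let ?\<rho>4 = "nupdate ''right'' E (nmem \<tau> ''ord'' b) ?\<rho>3"
      have "arc_done ?\<rho>4 w a b c"
        using True by (simp add: arc_done_def E_def[symmetric])
      then have "?Q ?\<rho>4"
        by (intro Q) auto
      then have "runs B (NStore ''right'' (V ''e'') (At ''ord'' ''b'')) ?\<rho>3 1 ?Q"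
        by (rule runs_Store[rotated -1]) (use vals less in simp_all)
      then have "runs B (NStore ''left'' (V ''e'') (At ''ord'' ''a'') ;; NStore ''right'' (V ''e'') (At ''ord'' ''b'')) ?\<rho>2 (1 + 1) ?Q"
        by (rule runs_Store_Seq[rotated -1]) (use vals less in simp_all)
      then have "runs B (NStore ''head'' (V ''e'') (NAdd (NMul (V ''nw'') (V ''n'')) (V ''a'')) ;;
          NStore ''left'' (V ''e'') (At ''ord'' ''a'') ;; NStore ''right'' (V ''e'') (At ''ord'' ''b'')) ?\<rho>1 (1 + (1 + 1)) ?Q"
        by (rule runs_Store_Seq[rotated -1]) (use vals less in simp_all)
      then have "runs B ?yes ?\<rho> (1 + (1 + (1 + 1))) ?Q"
        by (rule runs_Store_Seq[rotated -1]) (use vals c less in simp_all)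
      then show ?thesis
        by (rule runs_Ite_True[rotated]) (use vals c True in simp)
    next
      case False
      let ?P = "a = 0 \<and> b = 0 \<and> final w"
      let ?\<rho>1 = "nupdate ''head'' E (6 ^ n * n) ?\<rho>"
      let ?\<rho>2 = "nupdate ''tail'' E (if ?P then w * n + c else 6 ^ n * n + 1) ?\<rho>1"
      have "arc_done ?\<rho>2 w a b c"
        using False by (auto simp: arc_done_def E_def[symmetric])
      then have "?Q ?\<rho>2"
        by (intro Q) auto
      \<comment> \<open>The strict test against \<open>cnt + 2\<close> is \<open>final\<close> with
        its weak inequality against \<open>pot + 1\<close>.\<close>
      moreover have "bval ?c ?\<rho>1 \<longleftrightarrow> ?P"
        using vals by (auto simp: final_def)
      ultimately have "runs B (Ite ?c (NStore ''tail'' (V ''e'') (NAdd (NMul (V ''w'') (V ''n'')) (V ''c'')))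
          (NStore ''tail'' (V ''e'') (NAdd (V ''sink'') (C 1)))) ?\<rho>1 2 ?Q"
        by (intro runs_cond_Store[where P = ?P and j = E and u = "w * n + c" and v = "6 ^ n * n + 1"])
          (use vals c less in simp_all)
      then have "runs B ?no ?\<rho> (1 + 2) ?Q"
        by (rule runs_Store_Seq[rotated -1]) (use vals less in simp_all)
      then show ?thesis
        by (rule runs_Ite_False[rotated]) (use vals c False in auto)
    qed
    then show "runs B (Assign ''e'' ?e ;; ?ite) \<tau> (1 + (1 + max (1 + (1 + (1 + 1))) (1 + 2))) ?Q"
      by (rule runs_Store_Seq[OF _ eE, rotated -1]) (use less in simp_all)
  next
    show "?I 0 (nupdate ''c'' 0 0 \<sigma>)"
      using written by (subst arcs_done_cong[of _ \<sigma>]) auto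
  qed (use n nB in simp_all)
  then show ?thesis
    unfolding arc_prog_def by (rule runs_weaken) (use n_pos in simp_all)
qed

lemma runs_pairs:
  assumes B: "6 ^ n * n * n * n + 6 ^ n * n + 8 < B" and env: "env \<sigma>"
    and w: "nmem \<sigma> ''w'' 0 = w" "w < 6 ^ n" and a: "nmem \<sigma> ''a'' 0 = a" "a < n"
    and d: "\<And>k. k < n \<Longrightarrow> nmem \<sigma> ''dig'' k = digit w k" and f: "\<And>k. k < n \<Longrightarrow> nmem \<sigma> ''blk'' k = labels w k"
    and cnt: "nmem \<sigma> ''cnt'' 0 = pot n (digit w)" and sink: "nmem \<sigma> ''sink'' 0 = 6 ^ n * n"
    and written: "arcs_done \<sigma> (arc_id n w a 0 0)"
  shows "runs B (For ''b'' ''n'' (step_prog ;; arc_prog)) \<sigma> (70 * n ^ 3) (\<lambda>\<tau>. arcs_done \<tau> (arc_id n w a n 0))"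
proof -
  have "n \<le> 6 ^ n * n" "6 ^ n \<le> 6 ^ n * n"
    using n_pos by simp_all
  then have nB: "n < B" "6 ^ n < B" "8 < B"
    using B by linarith+
  have fB: "labels w k < B" if "k < n" for k
    using decode_bounds[of "digit w" n] that nB(1) unfolding labels_def by (meson le_less_trans less_trans)
  let ?I = "\<lambda>b \<tau>. arcs_done \<tau> (arc_id n w a b 0)"
  have "runs B (For ''b'' ''n'' (step_prog ;; arc_prog)) \<sigma> (n * (50 * n ^ 2 + 10 * n + 2) + 2) (?I n)"
  proof (rule runs_For[where I = ?I])
    fix b \<tau>
    assume b: "b < n" "nmem \<tau> ''b'' 0 = b" and I: "?I b \<tau>" and keep: "keeps (insert ''b'' (writes (step_prog ;; arc_prog))) \<sigma> \<tau>"
    have env': "env \<tau>"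
      by (rule env_keeps[OF env keep]) simp_all
    have e1: "nmem \<tau> ''w'' 0 = w" "nmem \<tau> ''a'' 0 = a" "nmem \<tau> ''dig'' = nmem \<sigma> ''dig''" "nmem \<tau> ''blk'' = nmem \<sigma> ''blk''"
      "nmem \<tau> ''cnt'' 0 = pot n (digit w)" "nmem \<tau> ''sink'' 0 = 6 ^ n * n"
      using keepsD(2)[OF keep, of "''w''"] keepsD(2)[OF keep, of "''a''"] keepsD(2)[OF keep, of "''dig''"]
        keepsD(2)[OF keep, of "''blk''"] keepsD(2)[OF keep, of "''cnt''"] keepsD(2)[OF keep, of "''sink''"]
        w a cnt sink by simp_all
    have step: "runs B step_prog \<tau> (50 * n ^ 2) (\<lambda>\<tau>. nmem \<tau> ''nw'' 0 = succ w a b \<and> (nmem \<tau> ''ok'' 0 \<noteq> 0 \<longleftrightarrow> valid w a b))"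
      unfolding succ_def valid_def
      by (rule runs_step[OF nB a(2) b(1) env']) (use e1 b d f fB in simp_all)
    show "runs B (step_prog ;; arc_prog) \<tau> (50 * n ^ 2 + 10 * n) (\<lambda>\<tau>'. ?I (Suc b) (nupdate ''b'' 0 (Suc b) \<tau>'))"
    proof (rule runs_Seq[OF step])
      fix \<rho>
      assume k: "keeps (writes step_prog) \<tau> \<rho>" and r: "nmem \<rho> ''nw'' 0 = succ w a b \<and> (nmem \<rho> ''ok'' 0 \<noteq> 0 \<longleftrightarrow> valid w a b)"
      have e2: "nmem \<rho> ''w'' 0 = w" "nmem \<rho> ''a'' 0 = a" "nmem \<rho> ''b'' 0 = b"
        "nmem \<rho> ''cnt'' 0 = pot n (digit w)" "nmem \<rho> ''sink'' 0 = 6 ^ n * n"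
        using keepsD(2)[OF k, of "''w''"] keepsD(2)[OF k, of "''a''"] keepsD(2)[OF k, of "''b''"]
          keepsD(2)[OF k, of "''cnt''"] keepsD(2)[OF k, of "''sink''"] e1 b by simp_all
      have env2: "env \<rho>"
        by (rule env_keeps[OF env' k]) simp_all
      have "arcs_done \<rho> (arc_id n w a b 0)"
        using I by (subst arcs_done_keeps[OF k]) simp_all
      then have "runs B arc_prog \<rho> (10 * n) (\<lambda>\<tau>. arcs_done \<tau> (arc_id n w a b n))"
        by (intro runs_arcs[OF B env2 e2(1) w(2) e2(2,3) a(2) b(1) _ _ e2(4,5)]) (use r in auto)
      then show "runs B arc_prog \<rho> (10 * n) (\<lambda>\<tau>'. ?I (Suc b) (nupdate ''b'' 0 (Suc b) \<tau>'))"
      proof (rule runs_weaken)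
        fix \<tau>'
        assume "arcs_done \<tau>' (arc_id n w a b n)"
        then have "arcs_done \<tau>' (arc_id n w a (Suc b) 0)"
          by (simp add: arc_id_def algebra_simps)
        then show "?I (Suc b) (nupdate ''b'' 0 (Suc b) \<tau>')"
          by (subst arcs_done_cong[of _ \<tau>']) auto
      qed simp
    qed
  next
    show "?I 0 (nupdate ''b'' 0 0 \<sigma>)"
      using written by (subst arcs_done_cong[of _ \<sigma>]) auto
  qed (use env_n[OF env] nB in simp_all)
  then show ?thesis
  proof (rule runs_weaken)
    \<comment> \<open>The coefficients 50, 10, 2 and the constant 2 add up to at most 70.\<close>
    have "n \<le> n ^ 3" "n ^ 2 \<le> n ^ 3" "1 \<le> n ^ 3"
      using n_pos by (simp_all add: self_le_power power_increasing)
    moreover have "n * (50 * n ^ 2 + 10 * n + 2) = 50 * n ^ 3 + 10 * n ^ 2 + 2 * n"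
      by (simp add: power2_eq_square power3_eq_cube algebra_simps)
    ultimately show "n * (50 * n ^ 2 + 10 * n + 2) + 2 \<le> 70 * n ^ 3"
      by linarith
  qed
qed

lemma runs_state:
  assumes B: "6 ^ n * n * n * n + 6 ^ n * n + 8 < B" and env: "env \<sigma>"
    and w: "nmem \<sigma> ''w'' 0 = w" "w < 6 ^ n" and sink: "nmem \<sigma> ''sink'' 0 = 6 ^ n * n"
    and written: "arcs_done \<sigma> (arc_id n w 0 0 0)"
  shows "runs B state_prog \<sigma> (110 * n ^ 4) (\<lambda>\<tau>. arcs_done \<tau> (arc_id n (Suc w) 0 0 0))"
proof -
  have "n \<le> 6 ^ n * n" "6 ^ n \<le> 6 ^ n * n"
    using n_pos by simp_all
  then have nB: "n < B" "6 ^ n < B" "8 < B"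
    using B by linarith+
  let ?Td = "1 + (1 + (n * (1 + (1 + (1 + max 1 1)) + 2) + 2))"
  let ?Tl = "n * (1 + (1 + ((n * (1 + max 1 1 + 2) + 2) + ((1 + max (1 + 1) 1) + (1 + max 1 1)))) + 2) + 2"
  have digits: "runs B digits_prog \<sigma> ?Td (\<lambda>\<tau>. (\<forall>k<n. nmem \<tau> ''dig'' k = digit w k) \<and> nmem \<tau> ''cnt'' 0 = pot n (digit w))"
    by (rule runs_digits) (use env_n[OF env] nB w in simp_all)
  have "runs B state_prog \<sigma> (?Td + (?Tl + (n * (70 * n ^ 3 + 2) + 2))) (\<lambda>\<tau>. arcs_done \<tau> (arc_id n (Suc w) 0 0 0))"
    unfolding state_prog_def
  proof (rule runs_Seq[OF digits])
    fix \<tau>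
    assume k1: "keeps (writes digits_prog) \<sigma> \<tau>"
      and r1: "(\<forall>k<n. nmem \<tau> ''dig'' k = digit w k) \<and> nmem \<tau> ''cnt'' 0 = pot n (digit w)"
    have env1: "env \<tau>"
      by (rule env_keeps[OF env k1]) simp_all
    have dec: "runs B decode_prog \<tau> ?Tl (\<lambda>\<tau>. \<forall>k<n. nmem \<tau> ''blk'' k = fst (decode (digit w) n) k)"
      by (rule runs_decode) (use env_n[OF env1] nB r1 in simp_all)
    show "runs B (decode_prog ;; For ''a'' ''n'' (For ''b'' ''n'' (step_prog ;; arc_prog))) \<tau> (?Tl + (n * (70 * n ^ 3 + 2) + 2))
        (\<lambda>\<tau>. arcs_done \<tau> (arc_id n (Suc w) 0 0 0))"
    proof (rule runs_Seq[OF dec])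
      fix \<rho>
      assume k2: "keeps (writes decode_prog) \<tau> \<rho>"
        and r2: "\<forall>k<n. nmem \<rho> ''blk'' k = fst (decode (digit w) n) k"
      have env2: "env \<rho>"
        by (rule env_keeps[OF env1 k2]) simp_all
      have e2: "nmem \<rho> ''w'' 0 = w" "nmem \<rho> ''sink'' 0 = 6 ^ n * n" "nmem \<rho> ''dig'' = nmem \<tau> ''dig''" "nmem \<rho> ''cnt'' = nmem \<tau> ''cnt''"
        using keepsD(2)[OF k2, of "''w''"] keepsD(2)[OF k1, of "''w''"] keepsD(2)[OF k2, of "''sink''"]
          keepsD(2)[OF k1, of "''sink''"] keepsD(2)[OF k2, of "''dig''"] keepsD(2)[OF k2, of "''cnt''"] w sink by simp_all
      have written2: "arcs_done \<rho> (arc_id n w 0 0 0)"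
        using written arcs_done_keeps[OF k1] arcs_done_keeps[OF k2] by simp
      let ?I = "\<lambda>a \<tau>. arcs_done \<tau> (arc_id n w a 0 0)"
      have "runs B (For ''a'' ''n'' (For ''b'' ''n'' (step_prog ;; arc_prog))) \<rho> (n * (70 * n ^ 3 + 2) + 2) (?I n)"
      proof (rule runs_For[where I = ?I])
        fix a \<tau>'
        assume a: "a < n" "nmem \<tau>' ''a'' 0 = a" and I: "?I a \<tau>'"
          and k3: "keeps (insert ''a'' (writes (For ''b'' ''n'' (step_prog ;; arc_prog)))) \<rho> \<tau>'"
        have env3: "env \<tau>'"
          by (rule env_keeps[OF env2 k3]) simp_all
        have e3: "nmem \<tau>' ''w'' 0 = w" "nmem \<tau>' ''sink'' 0 = 6 ^ n * n" "nmem \<tau>' ''dig'' = nmem \<tau> ''dig''"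
          "nmem \<tau>' ''cnt'' 0 = pot n (digit w)" "nmem \<tau>' ''blk'' = nmem \<rho> ''blk''"
          using keepsD(2)[OF k3, of "''w''"] keepsD(2)[OF k3, of "''sink''"] keepsD(2)[OF k3, of "''dig''"]
            keepsD(2)[OF k3, of "''cnt''"] keepsD(2)[OF k3, of "''blk''"] e2 r1 by simp_all
        have "runs B (For ''b'' ''n'' (step_prog ;; arc_prog)) \<tau>' (70 * n ^ 3) (\<lambda>\<tau>. arcs_done \<tau> (arc_id n w a n 0))"
          by (rule runs_pairs[OF B env3 e3(1) w(2) a(2,1) _ _ e3(4,2) I]) (use e3 r1 r2 in \<open>simp_all add: labels_def\<close>)
        then show "runs B (For ''b'' ''n'' (step_prog ;; arc_prog)) \<tau>' (70 * n ^ 3) (\<lambda>\<tau>'. ?I (Suc a) (nupdate ''a'' 0 (Suc a) \<tau>'))"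
        proof (rule runs_weaken)
          fix \<tau>''
          assume "arcs_done \<tau>'' (arc_id n w a n 0)"
          then have "arcs_done \<tau>'' (arc_id n w (Suc a) 0 0)"
            by (simp add: arc_id_def algebra_simps)
          then show "?I (Suc a) (nupdate ''a'' 0 (Suc a) \<tau>'')"
            by (subst arcs_done_cong[of _ \<tau>'']) auto
        qed simp
      next
        show "?I 0 (nupdate ''a'' 0 0 \<rho>)"
          using written2 by (subst arcs_done_cong[of _ \<rho>]) auto
      qed (use env_n[OF env2] nB in simp_all)
      then show "runs B (For ''a'' ''n'' (For ''b'' ''n'' (step_prog ;; arc_prog))) \<rho> (n * (70 * n ^ 3 + 2) + 2)
          (\<lambda>\<tau>. arcs_done \<tau> (arc_id n (Suc w) 0 0 0))"
        by (rule runs_weaken) (simp_all add: arc_id_def algebra_simps)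
    qed
  qed
  then show ?thesis
  proof (rule runs_weaken)
    \<comment> \<open>Splitting and decoding the word are of lower order: the coefficients sum to
      101, below 110.\<close>
    have "n \<le> n ^ 4" "n ^ 2 \<le> n ^ 4" "1 \<le> n ^ 4"
      using n_pos by (simp_all add: self_le_power power_increasing)
    moreover have "?Td + (?Tl + (n * (70 * n ^ 3 + 2) + 2)) = 70 * n ^ 4 + 4 * n ^ 2 + 19 * n + 8"
      by (simp add: power2_eq_square power3_eq_cube power4_eq_xxxx algebra_simps)
    ultimately show "?Td + (?Tl + (n * (70 * n ^ 3 + 2) + 2)) \<le> 110 * n ^ 4"
      by linarith
  qed
qed

lemma runs_states:
  assumes B: "6 ^ n * n * n * n + 6 ^ n * n + 8 < B" and env: "env \<sigma>"
    and W: "nmem \<sigma> ''W'' 0 = 6 ^ n" and sink: "nmem \<sigma> ''sink'' 0 = 6 ^ n * n"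
  shows "runs B (For ''w'' ''W'' state_prog) \<sigma> (6 ^ n * (110 * n ^ 4 + 2) + 2) (\<lambda>\<tau>. arcs_done \<tau> (6 ^ n * n * n * n))"
proof -
  have "6 ^ n \<le> 6 ^ n * n"
    using n_pos by simp
  then have nB: "6 ^ n < B"
    using B by linarith
  have wr: "v \<notin> writes state_prog" if "v \<in> {''w'', ''W'', ''n'', ''ord'', ''sink''}" for v
    using that unfolding state_prog_def by auto
  let ?I = "\<lambda>w \<tau>. arcs_done \<tau> (arc_id n w 0 0 0)"
  have "runs B (For ''w'' ''W'' state_prog) \<sigma> (6 ^ n * (110 * n ^ 4 + 2) + 2) (?I (6 ^ n))"
  proof (rule runs_For[where I = ?I])
    fix w \<tau>
    assume w: "w < 6 ^ n" "nmem \<tau> ''w'' 0 = w" and I: "?I w \<tau>" and keep: "keeps (insert ''w'' (writes state_prog)) \<sigma> \<tau>"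
    have "env \<tau>"
      by (rule env_keeps[OF env keep]) (use wr in simp_all)
    moreover have "nmem \<tau> ''sink'' 0 = 6 ^ n * n"
      using keepsD(2)[OF keep, of "''sink''"] wr sink by simp
    ultimately have "runs B state_prog \<tau> (110 * n ^ 4) (\<lambda>\<tau>. arcs_done \<tau> (arc_id n (Suc w) 0 0 0))"
      by (rule runs_state[OF B _ w(2,1) _ I])
    then show "runs B state_prog \<tau> (110 * n ^ 4) (\<lambda>\<tau>'. ?I (Suc w) (nupdate ''w'' 0 (Suc w) \<tau>'))"
    proof (rule runs_weaken)
      fix \<tau>'
      assume "arcs_done \<tau>' (arc_id n (Suc w) 0 0 0)"
      then show "?I (Suc w) (nupdate ''w'' 0 (Suc w) \<tau>')"
        by (subst arcs_done_cong[of _ \<tau>']) auto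
    qed simp
  next
    show "?I 0 (nupdate ''w'' 0 0 \<sigma>)"
      by (simp add: arcs_done_def arc_id_def)
  qed (use W nB wr in simp_all)
  then show ?thesis
    by (rule runs_weaken) (simp_all add: arc_id_def)
qed

end

text \<open>\<open>''source''\<close> is never written and stays 0, the vertex of the empty state
  with mark 0. \<open>For\<close> wants its bound in a variable, hence \<open>''W''\<close>.\<close>

definition graph_prog :: com where
  "graph_prog = rank_prog ;;
     Assign ''W'' (C 1) ;; For ''i'' ''n'' (Assign ''W'' (NMul (V ''W'') (C 6))) ;;
     Assign ''sink'' (NMul (V ''W'') (V ''n'')) ;;
     Assign ''vertices'' (NAdd (V ''sink'') (C 2)) ;;
     Assign ''edges'' (NMul (NMul (V ''sink'') (V ''n'')) (V ''n'')) ;;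
     For ''w'' ''W'' state_prog"

lemma runs_power:
  assumes n: "nmem \<sigma> ''n'' 0 = n" "n < B" "6 ^ n < B" and W: "nmem \<sigma> ''W'' 0 = 1"
  shows "runs B (For ''i'' ''n'' (Assign ''W'' (NMul (V ''W'') (C 6)))) \<sigma> (n * (1 + 2) + 2) (\<lambda>\<tau>. nmem \<tau> ''W'' 0 = 6 ^ n)"
proof (rule runs_For[where I = "\<lambda>i \<tau>. nmem \<tau> ''W'' 0 = 6 ^ i"])
  fix i and \<tau> :: state
  assume i: "i < n" "nmem \<tau> ''W'' 0 = 6 ^ i"
  have "(6::nat) ^ Suc i \<le> 6 ^ n"
    using i(1) by (intro power_increasing) simp_all
  then have "6 ^ Suc i < B"
    using n(3) by linarith
  then show "runs B (Assign ''W'' (NMul (V ''W'') (C 6))) \<tau> 1 (\<lambda>\<tau>'. nmem (nupdate ''i'' 0 (Suc i) \<tau>') ''W'' 0 = 6 ^ Suc i)"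
    using i n by (intro runs_Store[where j = 0 and v = "6 ^ Suc i"]) simp_all
qed (use n W in simp_all)

context sorted_point_set
begin

lemma runs_graph:
  assumes B: "6 ^ n * n * n * n + 6 ^ n * n + 8 < B"
    and rk: "bij_betw (\<lambda>i. card {j. j < n \<and> fst (p j) < fst (p i)}) {..<n} {..<n}"
    and q: "\<And>i. i < n \<Longrightarrow> q (card {j. j < n \<and> fst (p j) < fst (p i)}) = p i"
  shows "runs B graph_prog (input_state n p) (150 * (6 ^ n * n ^ 4)) (\<lambda>\<tau>. arcs_done \<tau> (6 ^ n * n * n * n) \<and>
    nmem \<tau> ''vertices'' 0 = 6 ^ n * n + 2 \<and> nmem \<tau> ''edges'' 0 = 6 ^ n * n * n * n \<and>
    nmem \<tau> ''sink'' 0 = 6 ^ n * n \<and> nmem \<tau> ''source'' 0 = 0 \<and> (\<forall>k<n. p (nmem \<tau> ''ord'' k) = q k))"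
proof -
  let ?\<sigma> = "input_state n p"
  \<comment> \<open>The input array is 0 from index \<open>n\<close> on, so it agrees with the
    coordinates only below \<open>n\<close>; ranks count no other indices.\<close>
  define x where "x = rmem ?\<sigma> ''x''"
  define r where "r i = card {j. j < n \<and> x j < x i}" for i
  have xp: "x i = fst (p i)" if "i < n" for i
    using that by (simp add: x_def input_state_def)
  have r: "r i = card {j. j < n \<and> fst (p j) < fst (p i)}" if "i < n" for i
    unfolding r_def by (rule arg_cong[of _ _ card]) (use xp that in auto)
  have bij: "bij_betw r {..<n} {..<n}"
    using rk by (subst bij_betw_cong[of _ _ "\<lambda>i. card {j. j < n \<and> fst (p j) < fst (p i)}"]) (simp_all add: r)
  have "n \<le> 6 ^ n * n" "6 ^ n \<le> 6 ^ n * n"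
    using n_pos by simp_all
  then have nB: "n < B" "6 ^ n < B" "8 < B"
    using B by linarith+
  have n: "nmem ?\<sigma> ''n'' 0 = n"
    by (simp add: input_state_def)
  let ?Tr = "n * (1 + ((n * (1 + max 1 1 + 2) + 2) + 1) + 2) + 2"
  let ?Ts = "6 ^ n * (110 * n ^ 4 + 2) + 2"
  let ?Q = "\<lambda>\<tau>. arcs_done \<tau> (6 ^ n * n * n * n) \<and>
    nmem \<tau> ''vertices'' 0 = 6 ^ n * n + 2 \<and> nmem \<tau> ''edges'' 0 = 6 ^ n * n * n * n \<and>
    nmem \<tau> ''sink'' 0 = 6 ^ n * n \<and> (\<forall>k<n. p (nmem \<tau> ''ord'' k) = q k)"
  have rank: "runs B rank_prog ?\<sigma> ?Tr (\<lambda>\<tau>. \<forall>i<n. nmem \<tau> ''ord'' (r i) = i)"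
    unfolding r_def
    by (rule runs_rank) (use n nB bij x_def in \<open>simp_all add: bij_betw_def r_def[abs_def]\<close>)
  let ?pow = "For ''i'' ''n'' (Assign ''W'' (NMul (V ''W'') (C 6)))"
  let ?p3 = "Assign ''edges'' (NMul (NMul (V ''sink'') (V ''n'')) (V ''n'')) ;; For ''w'' ''W'' state_prog"
  let ?p2 = "Assign ''vertices'' (NAdd (V ''sink'') (C 2)) ;; ?p3"
  let ?p1 = "Assign ''sink'' (NMul (V ''W'') (V ''n'')) ;; ?p2"
  have "runs B graph_prog ?\<sigma> (?Tr + (1 + ((n * (1 + 2) + 2) + (1 + (1 + (1 + ?Ts)))))) ?Q"
    unfolding graph_prog_def
  proof (rule runs_Seq[OF rank])
    fix \<tau>1
    assume k1: "keeps (writes rank_prog) ?\<sigma> \<tau>1" and r1: "\<forall>i<n. nmem \<tau>1 ''ord'' (r i) = i"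
    have ord: "nmem \<tau>1 ''ord'' k < n \<and> q k = p (nmem \<tau>1 ''ord'' k)" if "k < n" for k
    proof -
      have "k \<in> r ` {..<n}"
        using bij that by (simp add: bij_betw_def)
      then obtain i where i: "i < n" "k = r i"
        by auto
      then have "nmem \<tau>1 ''ord'' k = i" "q k = p i"
        using r1 q[OF i(1)] r[OF i(1)] by auto
      then show ?thesis
        using i(1) by simp
    qed
    have "rmem \<tau>1 = rmem ?\<sigma>" "nmem \<tau>1 ''n'' 0 = n"
      using keepsD(1)[OF k1] keepsD(2)[OF k1, of "''n''"] n by simp_all
    then have env1: "env \<tau>1"
      using ord by (simp add: env_def input_state_def)
    have pow: "runs B ?pow (nupdate ''W'' 0 1 \<tau>1) (n * (1 + 2) + 2)
        (\<lambda>\<tau>. nmem \<tau> ''W'' 0 = 6 ^ n)"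
      by (rule runs_power) (use env_n[OF env1] nB in simp_all)
    have "runs B (?pow ;;
        ?p1)
        (nupdate ''W'' 0 1 \<tau>1) ((n * (1 + 2) + 2) + (1 + (1 + (1 + ?Ts)))) ?Q"
    proof (rule runs_Seq[OF pow])
      fix \<tau>2
      assume k2: "keeps (writes ?pow) (nupdate ''W'' 0 1 \<tau>1) \<tau>2"
        and W: "nmem \<tau>2 ''W'' 0 = 6 ^ n"
      have env2: "env \<tau>2"
        by (rule env_keeps[OF _ k2]) (use env_nupdate[OF env1, of "''W''"] in simp_all)
      have o2: "nmem \<tau>2 ''ord'' = nmem \<tau>1 ''ord''"
        using keepsD(2)[OF k2, of "''ord''"] by simp
      let ?\<rho>1 = "nupdate ''sink'' 0 (6 ^ n * n) \<tau>2"
      let ?\<rho>2 = "nupdate ''vertices'' 0 (6 ^ n * n + 2) ?\<rho>1"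
      let ?\<rho>3 = "nupdate ''edges'' 0 (6 ^ n * n * n * n) ?\<rho>2"
      have "env ?\<rho>3"
        using env2 by (simp add: env_nupdate)
      then have "runs B (For ''w'' ''W'' state_prog) ?\<rho>3 ?Ts (\<lambda>\<tau>. arcs_done \<tau> (6 ^ n * n * n * n))"
        by (rule runs_states[OF B]) (use W in simp_all)
      then have "runs B (For ''w'' ''W'' state_prog) ?\<rho>3 ?Ts ?Q"
      proof (rule runs_weaken)
        fix \<tau>
        assume k3: "keeps (writes (For ''w'' ''W'' state_prog)) ?\<rho>3 \<tau>" and fin: "arcs_done \<tau> (6 ^ n * n * n * n)"
        have "nmem \<tau> v = nmem ?\<rho>3 v" if "v \<in> {''vertices'', ''edges'', ''sink'', ''ord''}" for v
          by (rule keepsD(2)[OF k3]) (use that in \<open>auto simp: state_prog_def\<close>)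
        then have "nmem \<tau> ''vertices'' = nmem ?\<rho>3 ''vertices''" "nmem \<tau> ''edges'' = nmem ?\<rho>3 ''edges''"
          "nmem \<tau> ''sink'' = nmem ?\<rho>3 ''sink''" "nmem \<tau> ''ord'' = nmem ?\<rho>3 ''ord''"
          by simp_all
        then show "?Q \<tau>"
          using fin o2 ord by simp
      qed simp
      then have "runs B ?p3 ?\<rho>2 (1 + ?Ts) ?Q"
        by (rule runs_Store_Seq[rotated -1]) (use env_n[OF env2] nB B in simp_all)
      then have "runs B ?p2 ?\<rho>1 (1 + (1 + ?Ts)) ?Q"
        by (rule runs_Store_Seq[rotated -1]) (use nB B in simp_all)
      then show "runs B ?p1 \<tau>2 (1 + (1 + (1 + ?Ts))) ?Q"
        by (rule runs_Store_Seq[rotated -1]) (use env_n[OF env2] W nB B in simp_all)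
    qed
    then show "runs B (Assign ''W'' (C 1) ;; ?pow ;;
        ?p1)
        \<tau>1 (1 + ((n * (1 + 2) + 2) + (1 + (1 + (1 + ?Ts))))) ?Q"
      by (rule runs_Store_Seq[rotated -1]) (use nB in simp_all)
  qed
  then show ?thesis
  proof (rule runs_weaken)
    define M where "M = 6 ^ n * n ^ 4"
    have "n ^ 1 \<le> n ^ 4" "n ^ 2 \<le> n ^ 4" "n ^ 4 \<le> M" "6 ^ n \<le> M" "1 \<le> n ^ 4"
      using n_pos unfolding M_def by (simp_all add: self_le_power power_increasing)
    moreover have "?Ts = 110 * M + 2 * 6 ^ n + 2"
      by (simp add: M_def algebra_simps)
    moreover have "?Tr = 4 * n ^ 2 + 5 * n + 2 + n"
      by (simp add: power2_eq_square algebra_simps)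
    ultimately show "?Tr + (1 + ((n * (1 + 2) + 2) + (1 + (1 + (1 + ?Ts))))) \<le> 150 * (6 ^ n * n ^ 4)"
      unfolding M_def[symmetric] by simp
  next
    fix \<tau>
    assume "keeps (writes graph_prog) ?\<sigma> \<tau>"
    moreover have "''source'' \<notin> writes graph_prog"
      by (simp add: graph_prog_def state_prog_def)
    ultimately have "nmem \<tau> ''source'' = nmem ?\<sigma> ''source''"
      by (rule keepsD(2))
    moreover assume "?Q \<tau>"
    ultimately show "arcs_done \<tau> (6 ^ n * n * n * n) \<and>
        nmem \<tau> ''vertices'' 0 = 6 ^ n * n + 2 \<and> nmem \<tau> ''edges'' 0 = 6 ^ n * n * n * n \<and>
        nmem \<tau> ''sink'' 0 = 6 ^ n * n \<and> nmem \<tau> ''source'' 0 = 0 \<and> (\<forall>k<n. p (nmem \<tau> ''ord'' k) = q k)"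
      by (simp add: input_state_def)
  qed
qed

lemma output_graph_correct:
  assumes fin: "arcs_done \<tau> (6 ^ n * n * n * n)" and ord: "\<forall>k<n. p (nmem \<tau> ''ord'' k) = q k"
    and out: "nmem \<tau> ''vertices'' 0 = 6 ^ n * n + 2" "nmem \<tau> ''edges'' 0 = 6 ^ n * n * n * n"
      "nmem \<tau> ''sink'' 0 = 6 ^ n * n" "nmem \<tau> ''source'' 0 = 0"
  shows "combination_graph P (output_graph p \<tau>) \<and>
    represents (output_graph p \<tau>) (crossing_free_spanning_trees P) \<and>
    graph_size (output_graph p \<tau>) \<le> 4 * (6 ^ n * n ^ 3)"
proof -
  have arc: "arc_done \<tau> w a b c" if "w < 6 ^ n" "a < n" "b < n" "c < n" for w a b c
    using fin arc_id_less[OF that] that unfolding arcs_done_def by blast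
  interpret output_graph_spec P n q p "nmem \<tau> ''tail''" "nmem \<tau> ''head''" "nmem \<tau> ''left''" "nmem \<tau> ''right''"
  proof unfold_locales
    fix w a b c e
    assume *: "w < 6 ^ n" "a < n" "b < n" "c < n" "e = arc_id n w a b c"
    show "nmem \<tau> ''tail'' e = w * n + c \<and> nmem \<tau> ''head'' e = succ w a b * n + a \<and>
        p (nmem \<tau> ''left'' e) = q a \<and> p (nmem \<tau> ''right'' e) = q b" if "valid w a b \<and> c < b"
      using arc[OF *(1-4)] that ord *(2,3,5) by (simp add: arc_done_def Let_def)
    show "nmem \<tau> ''tail'' e = (if a = 0 \<and> b = 0 \<and> final w then w * n + c else 6 ^ n * n + 1) \<and>
        nmem \<tau> ''head'' e = 6 ^ n * n" if "\<not> (valid w a b \<and> c < b)"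
      using arc[OF *(1-4)] that unfolding arc_done_def Let_def *(5) by (simp only: if_False)
  qed
  have "output_graph p \<tau> = \<Gamma>"
    unfolding output_graph_def \<Gamma>_def G_def out ..
  then show ?thesis
    using combination_graph_\<Gamma> represents_\<Gamma> graph_size_\<Gamma> by simp
qed

end

text \<open>\<open>6 ^ n\<close> is at most \<open>2 ^ (3 * n)\<close> and each factor
  \<open>n\<close> at most \<open>2 ^ n\<close>, so each power term is at most
  \<open>2 ^ (6 * n)\<close>; a factor \<open>2 ^ 4\<close> pays for the sum. The exponent 20 is
  generous.\<close>

lemma word_bound:
  assumes "1 \<le> (n::nat)"
  shows "6 ^ n * n * n * n + 6 ^ n * n + 8 < 2 ^ (20 * n)"
proof -
  have "(6::nat) ^ n \<le> 8 ^ n"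
    by (intro power_mono) simp_all
  also have "(8::nat) ^ n = 2 ^ (3 * n)"
    by (simp add: power_mult)
  finally have six: "(6::nat) ^ n \<le> 2 ^ (3 * n)" .
  have "n \<le> 2 ^ n"
    by simp
  then have "6 ^ n * n * n * n \<le> 2 ^ (3 * n) * 2 ^ n * 2 ^ n * 2 ^ n"
    using six by (intro mult_mono) simp_all
  also have "\<dots> = 2 ^ (6 * n)"
    by (simp flip: power_add)
  finally have a: "6 ^ n * n * n * n \<le> 2 ^ (6 * n)" .
  have "6 ^ n * n * 1 * 1 \<le> 6 ^ n * n * n * n"
    using assms by (intro mult_mono) simp_all
  then have b: "6 ^ n * n \<le> 2 ^ (6 * n)"
    using a by linarith
  have c: "(2::nat) ^ 4 \<le> 2 ^ (6 * n)"
    using assms by (intro power_increasing) simp_all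
  have "(2::nat) ^ 4 * 2 ^ (6 * n) \<le> 2 ^ (20 * n)"
    using assms unfolding power_add[symmetric] by (intro power_increasing) simp_all
  then show ?thesis
    using a b c by simp
qed

text \<open>Distinct x-coordinates make the rank injective, hence a permutation of the indices;
  \<open>q\<close> is \<open>p\<close> composed with its inverse.\<close>

lemma sorted_point_set_exists:
  fixes p :: "nat \<Rightarrow> point" and n :: nat
  defines "r \<equiv> \<lambda>i. card {j. j < n \<and> fst (p j) < fst (p i)}"
  assumes P: "general_position P" "bij_betw p {..<n} P" "1 \<le> n"
  shows "bij_betw r {..<n} {..<n} \<and>
    (\<exists>q. sorted_point_set P n q \<and> (\<forall>i<n. q (r i) = p i))"
proof -
  have r_less: "r i < r j" if "i < n" "fst (p i) < fst (p j)" for i j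
    unfolding r_def by (rule psubset_card_mono) (use that in auto)
  have fst_inj: "fst (p i) \<noteq> fst (p j)" if "i < n" "j < n" "i \<noteq> j" for i j
  proof
    assume "fst (p i) = fst (p j)"
    moreover have "p i \<in> P" "p j \<in> P"
      using P(2) that by (auto simp: bij_betw_def)
    ultimately have "p i = p j"
      using P(1) unfolding general_position_def by (meson inj_onD)
    then show False
      using P(2) that by (auto simp: bij_betw_def dest: inj_onD)
  qed
  have inj: "inj_on r {..<n}"
  proof (rule inj_onI)
    fix i j
    assume ij: "i \<in> {..<n}" "j \<in> {..<n}" "r i = r j"
    then show "i = j"
      using fst_inj[of i j] r_less[of i j] r_less[of j i] by (cases "fst (p i)" "fst (p j)" rule: linorder_cases) auto
  qed
  have "r i < n" if "i < n" for i
  proof -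
    have "r i < card {..<n}"
      unfolding r_def by (rule psubset_card_mono) (use that in auto)
    then show ?thesis
      by simp
  qed
  then have "r ` {..<n} = {..<n}"
    by (intro endo_inj_surj inj) auto
  then have bij: "bij_betw r {..<n} {..<n}"
    using inj by (simp add: bij_betw_def)
  define s where "s = inv_into {..<n} r"
  have s: "bij_betw s {..<n} {..<n}"
    unfolding s_def by (rule bij_betw_inv_into[OF bij])
  have rs: "r (s k) = k" "s k < n" if "k < n" for k
    using that bij s bij_betw_inv_into_right[OF bij, of k] by (auto simp: s_def bij_betw_def)
  have sr: "s (r i) = i" if "i < n" for i
    unfolding s_def using bij_betw_inv_into_left[OF bij, of i] that by simp
  have "sorted_point_set P n (p \<circ> s)"
  proof
    show "bij_betw (p \<circ> s) {..<n} P"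
      by (rule bij_betw_trans[OF s P(2)])
    show "fst ((p \<circ> s) i) < fst ((p \<circ> s) j)" if "i < j" "j < n" for i j
    proof (rule ccontr)
      assume "\<not> ?thesis"
      then have "fst (p (s j)) < fst (p (s i))"
        using fst_inj[of "s i" "s j"] rs[of i] rs[of j] that by fastforce
      then have "r (s j) < r (s i)"
        by (rule r_less[rotated]) (use rs that in simp)
      then show False
        using rs that by simp
    qed
  qed (use P in simp_all)
  moreover have "\<forall>i<n. (p \<circ> s) (r i) = p i"
    using sr by simp
  ultimately show ?thesis
    using bij by blast
qed

theorem theorem13:
  shows "\<exists>(prog :: com) (w :: nat) (K :: nat).
    \<forall>(P :: point set) (n :: nat) (p :: nat \<Rightarrow> point).
      finite P \<and> card P = n \<and> n \<ge> 1 \<and> general_position P \<and> bij_betw p {..<n} P \<longrightarrow>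
      (\<exists>(\<Gamma> :: (nat, nat) comb_graph).
         combination_graph P \<Gamma> \<and>
         represents \<Gamma> (crossing_free_spanning_trees P) \<and>
         graph_size \<Gamma> \<le> K * (6 ^ n * n ^ 3) \<and>
         (\<exists>(t :: nat) (\<tau> :: state).
            exec (2 ^ (w * n)) prog (input_state n p) t \<tau> \<and>
            t \<le> K * (6 ^ n * n ^ 4) \<and>
            output_graph p \<tau> = \<Gamma>))"
\<comment> \<open>The 20 is the exponent of \<open>word_bound\<close>; the time constant 150 also
  dominates the size constant 4.\<close>
proof (rule exI[of _ graph_prog], rule exI[of _ 20], rule exI[of _ 150], intro allI impI, elim conjE)
  fix P :: "point set" and n :: nat and p :: "nat \<Rightarrow> point"
  assume P: "n \<ge> 1" "general_position P" "bij_betw p {..<n} P"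
  obtain q where q: "sorted_point_set P n q"
    and rank: "bij_betw (\<lambda>i. card {j. j < n \<and> fst (p j) < fst (p i)}) {..<n} {..<n}"
      "\<And>i. i < n \<Longrightarrow> q (card {j. j < n \<and> fst (p j) < fst (p i)}) = p i"
    using sorted_point_set_exists[OF P(2,3,1)] by blast
  obtain t \<tau> where run: "exec (2 ^ (20 * n)) graph_prog (input_state n p) t \<tau>" "t \<le> 150 * (6 ^ n * n ^ 4)"
    and out: "sorted_point_set.arcs_done n q \<tau> (6 ^ n * n * n * n)" "\<forall>k<n. p (nmem \<tau> ''ord'' k) = q k"
      "nmem \<tau> ''vertices'' 0 = 6 ^ n * n + 2" "nmem \<tau> ''edges'' 0 = 6 ^ n * n * n * n"
      "nmem \<tau> ''sink'' 0 = 6 ^ n * n" "nmem \<tau> ''source'' 0 = 0"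
    using sorted_point_set.runs_graph[OF q word_bound[OF P(1)] rank] unfolding runs_def by blast
  have "combination_graph P (output_graph p \<tau>) \<and>
      represents (output_graph p \<tau>) (crossing_free_spanning_trees P) \<and>
      graph_size (output_graph p \<tau>) \<le> 4 * (6 ^ n * n ^ 3)"
    by (rule sorted_point_set.output_graph_correct[OF q out])
  then have "combination_graph P (output_graph p \<tau>)" "represents (output_graph p \<tau>) (crossing_free_spanning_trees P)"
    "graph_size (output_graph p \<tau>) \<le> 150 * (6 ^ n * n ^ 3)"
    by auto
  then show "\<exists>\<Gamma>. combination_graph P \<Gamma> \<and> represents \<Gamma> (crossing_free_spanning_trees P) \<and>
      graph_size \<Gamma> \<le> 150 * (6 ^ n * n ^ 3) \<and>
      (\<exists>t \<tau>. exec (2 ^ (20 * n)) graph_prog (input_state n p) t \<tau> \<and> t \<le> 150 * (6 ^ n * n ^ 4) \<and> output_graph p \<tau> = \<Gamma>)"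
    using run by blast
qed

end
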